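(* Let $\nu>0$ and $\alpha\in\mathbb{R}$, and consider the linearized Boussinesq equations around $v=(y,0)$, $\theta=\alpha y$, in coordinates moving with the shear flow: $$\partial_t\omega=\nu(\partial_y-t\partial_x)^2\omega+\partial_x\theta,\qquad \partial_t\theta=\alpha v_2,$$ on the domain $\mathbb{T}\times\mathbb{R}$. Let $\alpha_*=-\frac{1}{100}\nu^{1/3}<0$. Then the linearized evolution is stable at the level of the vorticity for any $\alpha$ with $|\alpha|<|\alpha_*|$. More precisely, for any $N\in\mathbb{N}$ there exists a constant $0<C=C(\nu,\alpha)$ such that for all times $t>0$ $$\|\omega(t)\|_{H^N}+\|\partial_x\theta(t)\|_{H^N}\le C\|\omega_0\|_{H^N}+C\|\partial_x\theta_0\|_{H^N},$$ where $\omega_0,\theta_0$ denote the initial data.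
   Context: $\omega,\theta$ are the perturbations of vorticity and temperature, as functions of $(t,x,y)$ in coordinates moving with the shear: a function $f(t,x,y)$ in the original coordinates is replaced by $f(t,x+ty,y)$. Set $\Delta_t=\partial_x^2+(\partial_y-t\partial_x)^2$. The velocity is $v=\nabla_t^\perp\Delta_t^{-1}\omega$ with $\nabla_t^\perp=(\partial_y-t\partial_x,\,-\partial_x)$, so that $v_2=-\partial_x\Delta_t^{-1}\omega$; on the Fourier side (frequencies $(k,\xi)\in\mathbb{Z}\times\mathbb{R}$, $k\ne0$) the system reads $\partial_t\tilde\omega=-\nu(\xi-kt)^2\tilde\omega+ik\tilde\theta$, $\partial_t(k\tilde\theta)=\frac{i\alpha}{1+(\xi/k-t)^2}\tilde\omega$, and $v_2$ has vanishing $k=0$ mode. $H^N=H^N(\mathbb{T}\times\mathbb{R})$ is the usual Sobolev space. *)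

theory Defs
  imports "HOL-Analysis.Analysis"
begin

section \<open>Functions on the cylinder\<close>

text \<open>The torus is \<open>\<real> / 2\<pi>\<int>\<close>, so that the frequencies in \<open>x\<close> are the integers. A function
  on the cylinder is a function of \<open>(x, y) \<in> \<real>\<^sup>2\<close> that is \<open>2\<pi>\<close>-periodic in \<open>x\<close>; integrals are taken over
  one period.\<close>

definition cyl :: "(real \<times> real) measure" where
  "cyl = restrict_space lborel ({0..<2 * pi} \<times> UNIV)"

definition cyl_fun :: "(real \<times> real \<Rightarrow> real) \<Rightarrow> bool" where
  "cyl_fun f \<longleftrightarrow> f \<in> borel_measurable borel \<and> (\<forall>x y. f (x + 2 * pi, y) = f (x, y))"

definition cyl_L1loc :: "(real \<times> real \<Rightarrow> real) \<Rightarrow> bool" where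
  "cyl_L1loc f \<longleftrightarrow> cyl_fun f \<and> (\<forall>R. integrable cyl (\<lambda>p. indicator {-R..R} (snd p) * f p))"

definition cyl_L2 :: "(real \<times> real \<Rightarrow> real) \<Rightarrow> bool" where
  "cyl_L2 f \<longleftrightarrow> cyl_fun f \<and> integrable cyl (\<lambda>p. (f p)\<^sup>2)"

definition L2_norm :: "(real \<times> real \<Rightarrow> real) \<Rightarrow> real" where
  "L2_norm f = sqrt (LINT p|cyl. (f p)\<^sup>2)"

definition x_mean :: "(real \<times> real \<Rightarrow> real) \<Rightarrow> real \<Rightarrow> real" where
  "x_mean f y = 1 / (2 * pi) * (LBINT x:{0..<2 * pi}. f (x, y))"

section \<open>Sobolev spaces\<close>

text \<open>The factor \<open>1 / 2\<pi>\<close> makes the transform from \<open>L\<^sup>2(\<T> \<times> \<real>)\<close> to \<open>L\<^sup>2(\<int> \<times> \<real>)\<close> unitary. On \<open>L\<^sup>2\<close> the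
  transform is the \<open>L\<^sup>2\<close> limit of the transforms of the truncations to \<open>\<bar>y\<bar> \<le> R\<close>, hence it is
  determined only up to null sets.\<close>

definition trunc_fourier ::
    "real \<Rightarrow> (real \<times> real \<Rightarrow> real) \<Rightarrow> int \<Rightarrow> real \<Rightarrow> complex" where
  "trunc_fourier R f k \<xi> = 1 / (2 * pi) *
     (LINT p|cyl. (indicator {-R..R} (snd p) * f p) *\<^sub>R cis (- (of_int k * fst p + \<xi> * snd p)))"

definition has_fourier :: "(real \<times> real \<Rightarrow> real) \<Rightarrow> (int \<Rightarrow> real \<Rightarrow> complex) \<Rightarrow> bool" where
  "has_fourier f g \<longleftrightarrow> (\<forall>k. g k \<in> borel_measurable borel) \<and>
     ((\<lambda>R. \<integral>\<^sup>+ k. \<integral>\<^sup>+ \<xi>. ennreal ((cmod (trunc_fourier R f k \<xi> - g k \<xi>))\<^sup>2) \<partial>lborel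
            \<partial>count_space UNIV) \<longlongrightarrow> 0) at_top"

definition fourier :: "(real \<times> real \<Rightarrow> real) \<Rightarrow> int \<Rightarrow> real \<Rightarrow> complex" where
  "fourier f = (SOME g. has_fourier f g)"

definition sobolev_sq :: "nat \<Rightarrow> (real \<times> real \<Rightarrow> real) \<Rightarrow> ennreal" where
  "sobolev_sq N f = (\<integral>\<^sup>+ k. \<integral>\<^sup>+ \<xi>.
     ennreal ((1 + (of_int k)\<^sup>2 + \<xi>\<^sup>2) ^ N * (cmod (fourier f k \<xi>))\<^sup>2) \<partial>lborel \<partial>count_space UNIV)"

definition in_sobolev :: "nat \<Rightarrow> (real \<times> real \<Rightarrow> real) \<Rightarrow> bool" where
  "in_sobolev N f \<longleftrightarrow> cyl_L2 f \<and> sobolev_sq N f < \<infinity>"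

definition sobolev_norm :: "nat \<Rightarrow> (real \<times> real \<Rightarrow> real) \<Rightarrow> real" where
  "sobolev_norm N f = sqrt (enn2real (sobolev_sq N f))"

section \<open>Test functions and weak derivatives\<close>

definition pdx :: "(real \<times> real \<Rightarrow> real) \<Rightarrow> real \<times> real \<Rightarrow> real" where
  "pdx f = (\<lambda>(x, y). deriv (\<lambda>s. f (s, y)) x)"

definition pdy :: "(real \<times> real \<Rightarrow> real) \<Rightarrow> real \<times> real \<Rightarrow> real" where
  "pdy f = (\<lambda>(x, y). deriv (\<lambda>s. f (x, s)) y)"

definition test_fun :: "(real \<times> real \<Rightarrow> real) \<Rightarrow> bool" where
  "test_fun \<phi> \<longleftrightarrow>
     (\<forall>i j p. ((pdx ^^ i) ((pdy ^^ j) \<phi>)) differentiable (at p)) \<and>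
     (\<forall>x y. \<phi> (x + 2 * pi, y) = \<phi> (x, y)) \<and>
     (\<exists>R. \<forall>x y. R < \<bar>y\<bar> \<longrightarrow> \<phi> (x, y) = 0)"

definition has_weak_dx :: "(real \<times> real \<Rightarrow> real) \<Rightarrow> (real \<times> real \<Rightarrow> real) \<Rightarrow> bool" where
  "has_weak_dx f g \<longleftrightarrow> cyl_L1loc f \<and> cyl_L1loc g \<and>
     (\<forall>\<phi>. test_fun \<phi> \<longrightarrow> (LINT p|cyl. g p * \<phi> p) = - (LINT p|cyl. f p * pdx \<phi> p))"

definition weak_dx :: "(real \<times> real \<Rightarrow> real) \<Rightarrow> real \<times> real \<Rightarrow> real" where
  "weak_dx f = (SOME g. has_weak_dx f g)"

section \<open>The linearized Boussinesq equations in moving coordinates\<close>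

definition shear_dy :: "real \<Rightarrow> (real \<times> real \<Rightarrow> real) \<Rightarrow> real \<times> real \<Rightarrow> real" where
  "shear_dy t \<phi> = (\<lambda>p. pdy \<phi> p - t * pdx \<phi> p)"

definition shear_laplacian :: "real \<Rightarrow> (real \<times> real \<Rightarrow> real) \<Rightarrow> real \<times> real \<Rightarrow> real" where
  "shear_laplacian t \<phi> = (\<lambda>p. pdx (pdx \<phi>) p + shear_dy t (shear_dy t \<phi>) p)"

text \<open>\<open>\<psi> = \<Delta>\<^sub>t\<^sup>-\<^sup>1 w\<close> in the weak sense, on the nonzero modes in \<open>x\<close>: the zero mode of \<open>w\<close>, on which
  \<open>\<Delta>\<^sub>t\<close> is not invertible in \<open>L\<^sup>2\<close>, is removed; it does not contribute to \<open>\<partial>\<^sub>x \<Delta>\<^sub>t\<^sup>-\<^sup>1 w\<close>.\<close>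

definition inv_shear_laplacian ::
    "real \<Rightarrow> (real \<times> real \<Rightarrow> real) \<Rightarrow> (real \<times> real \<Rightarrow> real) \<Rightarrow> bool" where
  "inv_shear_laplacian t w \<psi> \<longleftrightarrow> cyl_L2 \<psi> \<and> (AE y in lborel. x_mean \<psi> y = 0) \<and>
     (\<forall>\<phi>. test_fun \<phi> \<longrightarrow>
        (LINT p|cyl. \<psi> p * shear_laplacian t \<phi> p) = (LINT p|cyl. (w p - x_mean w (snd p)) * \<phi> p))"

text \<open>\<open>v = v\<^sub>2 = - \<partial>\<^sub>x \<Delta>\<^sub>t\<^sup>-\<^sup>1 w\<close>\<close>

definition is_v2 :: "real \<Rightarrow> (real \<times> real \<Rightarrow> real) \<Rightarrow> (real \<times> real \<Rightarrow> real) \<Rightarrow> bool" where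
  "is_v2 t w v \<longleftrightarrow> cyl_L2 v \<and>
     (\<exists>\<psi>. inv_shear_laplacian t w \<psi> \<and> has_weak_dx \<psi> (\<lambda>p. - v p))"

text \<open>Weak solutions on \<open>[0, \<infinity>)\<close> with \<open>\<omega>\<close> and \<open>\<partial>\<^sub>x\<theta>\<close> in \<open>L\<^sup>2\<close>, locally bounded in time; the
  operators in the equations are moved to the test function (the second-order operators are
  symmetric, \<open>\<partial>\<^sub>x\<close> is antisymmetric). The \<open>x\<close>-average of \<open>\<theta>\<close> need not be in \<open>L\<^sup>2\<close>.\<close>

definition boussinesq_solution ::
    "real \<Rightarrow> real \<Rightarrow> (real \<Rightarrow> real \<times> real \<Rightarrow> real) \<Rightarrow> (real \<Rightarrow> real \<times> real \<Rightarrow> real) \<Rightarrow> bool" where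
  "boussinesq_solution \<nu> \<alpha> \<omega> \<theta> \<longleftrightarrow>
     (\<forall>t\<ge>0. cyl_L2 (\<omega> t) \<and> has_weak_dx (\<theta> t) (weak_dx (\<theta> t)) \<and> cyl_L2 (weak_dx (\<theta> t))) \<and>
     (\<forall>T. \<exists>B. \<forall>t\<in>{0..T}. L2_norm (\<omega> t) \<le> B \<and> L2_norm (weak_dx (\<theta> t)) \<le> B) \<and>
     (\<forall>\<phi>. test_fun \<phi> \<longrightarrow> (\<forall>t\<ge>0.
        ((\<lambda>s. LINT p|cyl. \<omega> s p * \<phi> p) has_real_derivative
           \<nu> * (LINT p|cyl. \<omega> t p * shear_dy t (shear_dy t \<phi>) p)
           - (LINT p|cyl. \<theta> t p * pdx \<phi> p)) (at t within {0..}))) \<and>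
     (\<exists>v2. (\<forall>t\<ge>0. is_v2 t (\<omega> t) (v2 t)) \<and>
        (\<forall>\<phi>. test_fun \<phi> \<longrightarrow> (\<forall>t\<ge>0.
           ((\<lambda>s. LINT p|cyl. \<theta> s p * \<phi> p) has_real_derivative
              \<alpha> * (LINT p|cyl. v2 t p * \<phi> p)) (at t within {0..}))))"

definition alpha_star :: "real \<Rightarrow> real" where
  "alpha_star \<nu> = - (1 / 100) * \<nu> powr (1 / 3)"

end

theory Submission
  imports Defs "HOL-Probability.Characteristic_Functions"
begin

text \<open>The evolution decouples in frequency. Write \<open>\<Theta> = \<partial>\<^sub>x\<theta>\<close> and, for a frequency \<open>(k, \<xi>)\<close> with
  \<open>k \<noteq> 0\<close>, \<open>\<tau> = t - \<xi>/k\<close>. Then \<open>\<omega>' = -\<nu>k\<^sup>2\<tau>\<^sup>2 \<omega> + \<Theta>\<close> and \<open>\<Theta>' = -\<alpha> \<omega> / (1 + \<tau>\<^sup>2)\<close>, so the energy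
  \<open>E = |\<omega>|\<^sup>2 + |\<Theta>|\<^sup>2\<close> satisfies \<open>E' \<le> 2(1 + |\<alpha>|)|\<omega>||\<Theta>| - 2\<nu>\<tau>\<^sup>2|\<omega>|\<^sup>2\<close>. For \<open>|\<tau>| \<le> 1\<close> the right-hand side is at
  most a multiple of \<open>E\<close>. For \<open>|\<tau>| \<ge> 1\<close> the product is split so that \<open>\<omega>\<close> is absorbed by the dissipation,
  which leaves \<open>(1 + |\<alpha>|)\<^sup>2|\<Theta>|\<^sup>2/(\<nu>\<tau>\<^sup>2)\<close>. In both cases \<open>E' \<le> c E / (1 + \<tau>\<^sup>2)\<close>
  (\<open>dissipation_absorbs_growth\<close>), and \<open>1/(1 + \<tau>\<^sup>2)\<close> has integral \<open>\<pi>\<close> over all times: the energy at a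
  frequency grows at most by the factor \<open>exp (c\<pi>)\<close>, whatever the frequency is. For \<open>k = 0\<close> the function \<open>\<Theta>\<close>
  vanishes and \<open>\<omega>\<close> only decays. An estimate that is uniform in frequency is compatible with every
  Sobolev weight, so that one constant serves all \<open>N\<close>.

  The rest is needed because the solutions are weak. At each time the transform is determined only up to a
  null set, so there is no differential equation at a fixed \<open>\<xi>\<close>. Therefore the energy is integrated over
  \<open>\<xi>\<close> in a unit interval. There the multipliers in the equations are bounded, hence the pair of
  transforms is differentiable in time against every fixed square-integrable function, with bounded weak
  derivative, and \<open>energy_has_derivative\<close> turns this into an ordinary derivative of the energy. The rates
  \<open>1/(1 + \<tau>\<^sup>2)\<close> on a unit interval are comparable (\<open>lorentzian_shift\<close>), so that one Gronwall argument
  treats the whole interval; summing over the intervals and over \<open>k\<close> gives the Sobolev norms.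

  The equations are given against test functions that are compactly supported in \<open>y\<close>, while the energy
  needs test functions whose transform is compactly supported. The latter are limits of cut-off waves
  (\<open>cutoff_exists\<close>), and the time derivatives converge uniformly on bounded time intervals
  (\<open>derivative_uniform_limit\<close>). The stream function \<open>\<psi>\<close> obstructs this in the equation for \<open>\<Theta>\<close>, since no
  bound of \<open>\<psi>\<close> that is locally uniform in time is given. It disappears when \<open>\<Theta>\<close> is tested against
  \<open>\<Delta>\<^sub>t\<phi>\<close> instead of \<open>\<phi>\<close>, because \<open>\<psi>\<close> tested against \<open>\<Delta>\<^sub>t\<phi>\<close> is \<open>\<omega>\<close> tested against \<open>\<phi>\<close>
  (\<open>Theta_laplacian_deriv\<close>); the symbol of \<open>\<Delta>\<^sub>t\<close> is divided out afterwards (\<open>Theta_deriv\<close>).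

  From Fourier analysis only the inequality half of Plancherel's theorem enters: it gives the existence of
  the transform (\<open>has_fourier_exists\<close>) and the identity that moves a test function to the frequency
  side (\<open>parseval\<close>).\<close>

section \<open>Square-integrable functions\<close>

definition sqint :: "'a measure \<Rightarrow> ('a \<Rightarrow> 'b::euclidean_space) \<Rightarrow> bool" where
  "sqint M f \<longleftrightarrow> f \<in> borel_measurable M \<and> integrable M (\<lambda>x. (norm (f x))\<^sup>2)"

definition ip :: "'a measure \<Rightarrow> ('a \<Rightarrow> 'b::euclidean_space) \<Rightarrow> ('a \<Rightarrow> 'b) \<Rightarrow> real" where
  "ip M f g = (LINT x|M. f x \<bullet> g x)"

abbreviation nsq :: "'a measure \<Rightarrow> ('a \<Rightarrow> 'b::euclidean_space) \<Rightarrow> real" where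
  "nsq M f \<equiv> ip M f f"

lemma sqint_measurable[measurable_dest]: "sqint M f \<Longrightarrow> f \<in> borel_measurable M"
  by (simp add: sqint_def)

lemma sqint_integrable: "sqint M f \<Longrightarrow> integrable M (\<lambda>x. (norm (f x))\<^sup>2)"
  by (simp add: sqint_def)

lemma nsq_eq: "nsq M f = (LINT x|M. (norm (f x))\<^sup>2)"
  by (simp add: ip_def power2_norm_eq_inner)

lemma nsq_nonneg [simp]: "0 \<le> nsq M f"
  by (simp add: ip_def)

lemma nn_integral_sqint:
  "sqint M f \<Longrightarrow> (\<integral>\<^sup>+x. ennreal ((norm (f x))\<^sup>2) \<partial>M) = ennreal (nsq M f)"
  by (simp add: nsq_eq nn_integral_eq_integral sqint_def)

lemma sqintI_nn:
  assumes [measurable]: "f \<in> borel_measurable M"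
    and "(\<integral>\<^sup>+x. ennreal ((norm (f x))\<^sup>2) \<partial>M) < \<infinity>"
  shows "sqint M f"
  unfolding sqint_def using assms by (auto intro!: integrableI_bounded)

lemma sqint_bound_AE:
  assumes f: "sqint M f" and [measurable]: "g \<in> borel_measurable M"
    and b: "AE x in M. norm (g x) \<le> B * norm (f x)"
  shows "sqint M g" "nsq M g \<le> B\<^sup>2 * nsq M f"
proof -
  have i: "integrable M (\<lambda>x. B\<^sup>2 * (norm (f x))\<^sup>2)"
    using sqint_integrable[OF f] by simp
  have le: "AE x in M. (norm (g x))\<^sup>2 \<le> B\<^sup>2 * (norm (f x))\<^sup>2"
    using b
  proof eventually_elim
    case (elim x)
    from power_mono[OF elim, of 2] show ?case by (simp add: power_mult_distrib)
  qed
  then have le': "AE x in M. norm ((norm (g x))\<^sup>2) \<le> norm (B\<^sup>2 * (norm (f x))\<^sup>2)"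
    by simp
  show s: "sqint M g"
    unfolding sqint_def
    by (intro conjI Bochner_Integration.integrable_bound[OF i _ le']) measurable
  show "nsq M g \<le> B\<^sup>2 * nsq M f"
    unfolding nsq_eq using sqint_integrable[OF f] sqint_integrable[OF s]
    by (subst integral_mult_right_zero[symmetric]) (intro integral_mono_AE, auto intro: le)
qed

lemma sqint_bound:
  assumes "sqint M f" "g \<in> borel_measurable M"
    and "\<And>x. x \<in> space M \<Longrightarrow> norm (g x) \<le> B * norm (f x)"
  shows "sqint M g" "nsq M g \<le> B\<^sup>2 * nsq M f"
  using sqint_bound_AE[OF assms(1,2)] assms(3) by auto

lemma sqint_inner:
  assumes f: "sqint M f" and g: "sqint M g"
  shows "integrable M (\<lambda>x. f x \<bullet> g x)"
proof (rule Bochner_Integration.integrable_bound)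
  show "integrable M (\<lambda>x. (norm (f x))\<^sup>2 + (norm (g x))\<^sup>2)"
    using f g by (simp add: sqint_def)
  show "(\<lambda>x. f x \<bullet> g x) \<in> borel_measurable M"
    using f g by measurable
  have b: "\<bar>f x \<bullet> g x\<bar> \<le> (norm (f x))\<^sup>2 + (norm (g x))\<^sup>2" for x
  proof -
    have "0 \<le> norm (f x) * norm (g x)" by simp
    then show ?thesis
      using Cauchy_Schwarz_ineq2[of "f x" "g x"] sum_squares_bound[of "norm (f x)" "norm (g x)"]
      by linarith
  qed
  show "AE x in M. norm (f x \<bullet> g x) \<le> norm ((norm (f x))\<^sup>2 + (norm (g x))\<^sup>2)"
    by (intro always_eventually allI) (simp only: real_norm_def, metis abs_of_nonneg b abs_ge_zero order_trans)
qed

lemma sqint_scaleR: "sqint M f \<Longrightarrow> sqint M (\<lambda>x. c *\<^sub>R f x)"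
  by (rule sqint_bound(1)[where B="\<bar>c\<bar>"]) auto

lemma sqint_zero [simp]: "sqint M (\<lambda>x. 0)"
  by (simp add: sqint_def)

lemma sqint_uminus: "sqint M f \<Longrightarrow> sqint M (\<lambda>x. - f x)"
  using sqint_scaleR[of M f "-1"] by simp

lemma sqint_add:
  assumes f: "sqint M f" and g: "sqint M g"
  shows "sqint M (\<lambda>x. f x + g x)"
  unfolding sqint_def
proof
  show "(\<lambda>x. f x + g x) \<in> borel_measurable M"
    using f g by measurable
  have "(\<lambda>x. (norm (f x + g x))\<^sup>2) = (\<lambda>x. (norm (f x))\<^sup>2 + 2 * (f x \<bullet> g x) + (norm (g x))\<^sup>2)"
    by (rule ext) (simp add: dot_norm field_simps)
  then show "integrable M (\<lambda>x. (norm (f x + g x))\<^sup>2)"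
    using sqint_inner[OF f g] sqint_integrable[OF f] sqint_integrable[OF g] by simp
qed

lemma sqint_diff: "sqint M f \<Longrightarrow> sqint M g \<Longrightarrow> sqint M (\<lambda>x. f x - g x)"
  using sqint_add[of M f "\<lambda>x. - g x"] sqint_uminus[of M g] by simp

lemma sqint_sum:
  "(\<And>i. i \<in> I \<Longrightarrow> sqint M (f i)) \<Longrightarrow> sqint M (\<lambda>x. \<Sum>i\<in>I. f i x)"
  by (induction I rule: infinite_finite_induct) (simp_all add: sqint_add)

lemma sqint_mult_bounded:
  fixes f :: "'a \<Rightarrow> complex"
  assumes "sqint M f" "a \<in> borel_measurable M" "\<And>x. x \<in> space M \<Longrightarrow> norm (a x) \<le> B"
  shows "sqint M (\<lambda>x. a x * f x)" "nsq M (\<lambda>x. a x * f x) \<le> B\<^sup>2 * nsq M f"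
  using assms by (auto intro!: sqint_bound[where B=B and f=f] simp: norm_mult mult_right_mono)

lemma sqint_cmult:
  fixes u :: "'a \<Rightarrow> complex"
  shows "sqint M u \<Longrightarrow> sqint M (\<lambda>y. z * u y)"
  by (rule sqint_mult_bounded(1)[where B="norm z"]) auto

lemma ip_commute: "ip M f g = ip M g f"
  by (simp add: ip_def inner_commute)

lemma ip_add_right: "sqint M f \<Longrightarrow> sqint M g \<Longrightarrow> sqint M h \<Longrightarrow>
   ip M f (\<lambda>x. g x + h x) = ip M f g + ip M f h"
  by (simp add: ip_def inner_add_right sqint_inner)

lemma ip_diff_right: "sqint M f \<Longrightarrow> sqint M g \<Longrightarrow> sqint M h \<Longrightarrow>
   ip M f (\<lambda>x. g x - h x) = ip M f g - ip M f h"
  by (simp add: ip_def inner_diff_right sqint_inner)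

lemma ip_add_left: "sqint M f \<Longrightarrow> sqint M g \<Longrightarrow> sqint M h \<Longrightarrow>
   ip M (\<lambda>x. g x + h x) f = ip M g f + ip M h f"
  by (simp add: ip_def inner_add_left sqint_inner)

lemma ip_diff_left: "sqint M f \<Longrightarrow> sqint M g \<Longrightarrow> sqint M h \<Longrightarrow>
   ip M (\<lambda>x. g x - h x) f = ip M g f - ip M h f"
  by (simp add: ip_def inner_diff_left sqint_inner)

lemma ip_scaleR_left: "ip M (\<lambda>x. c *\<^sub>R g x) f = c * ip M g f"
  by (simp add: ip_def)

lemma ip_scaleR_right: "ip M f (\<lambda>x. c *\<^sub>R g x) = c * ip M f g"
  by (simp add: ip_def)

lemma nsq_diff:
  assumes "sqint M f" "sqint M g"
  shows "nsq M (\<lambda>x. f x - g x) = nsq M f - 2 * ip M f g + nsq M g"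
  using assms by (simp add: ip_diff_left ip_diff_right sqint_diff ip_commute[of M g f])

lemma nsq_add:
  assumes "sqint M f" "sqint M g"
  shows "nsq M (\<lambda>x. f x + g x) = nsq M f + 2 * ip M f g + nsq M g"
  using assms by (simp add: ip_add_left ip_add_right sqint_add ip_commute[of M g f])

text \<open>The discriminant of the nonnegative quadratic \<open>t \<mapsto> \<parallel>f - t g\<parallel>\<^sup>2\<close>.\<close>

lemma ip_square_le:
  assumes "sqint M f" "sqint M g"
  shows "(ip M f g)\<^sup>2 \<le> nsq M f * nsq M g"
proof -
  have q: "0 \<le> nsq M f - 2 * t * ip M f g + t\<^sup>2 * nsq M g" for t
    using nsq_diff[OF assms(1) sqint_scaleR[OF assms(2)], of t]
      nsq_nonneg[of M "\<lambda>x. f x - t *\<^sub>R g x"]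
    by (simp add: ip_scaleR_left ip_scaleR_right power2_eq_square mult_ac)
  show ?thesis
  proof (cases "nsq M g = 0")
    case True
    have "ip M f g = 0"
    proof (rule ccontr)
      assume "ip M f g \<noteq> 0"
      then show False
        using q[of "(nsq M f + 1) / (2 * ip M f g)"] True by simp
    qed
    then show ?thesis by simp
  next
    case False
    then have g: "nsq M g > 0" using nsq_nonneg[of M g] by linarith
    show ?thesis
      using q[of "ip M f g / nsq M g"] g
      by (simp add: field_simps power2_eq_square)
  qed
qed

lemma ip_le_sqrt:
  assumes "sqint M f" "sqint M g"
  shows "\<bar>ip M f g\<bar> \<le> sqrt (nsq M f) * sqrt (nsq M g)"
  using real_sqrt_le_mono[OF ip_square_le[OF assms]] by (simp add: real_sqrt_mult)

lemma nsq_add_le: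
  assumes "sqint M f" "sqint M g"
  shows "nsq M (\<lambda>x. f x + g x) \<le> 2 * nsq M f + 2 * nsq M g"
  using nsq_add[OF assms] nsq_diff[OF assms] nsq_nonneg[of M "\<lambda>x. f x - g x"] by linarith

lemma sqint_Pair:
  fixes f :: "'a \<Rightarrow> 'b::euclidean_space" and g :: "'a \<Rightarrow> 'c::euclidean_space"
  assumes f: "sqint M f" and g: "sqint M g"
  shows "sqint M (\<lambda>x. (f x, g x))" "nsq M (\<lambda>x. (f x, g x)) = nsq M f + nsq M g"
proof -
  note [measurable] = sqint_measurable[OF f] sqint_measurable[OF g]
  have "(\<lambda>x. (f x, g x)) \<in> borel_measurable M" by measurable
  then show "sqint M (\<lambda>x. (f x, g x))"
    using f g by (simp add: sqint_def norm_Pair)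
  show "nsq M (\<lambda>x. (f x, g x)) = nsq M f + nsq M g"
    unfolding ip_def using sqint_inner[OF f f] sqint_inner[OF g g] by (simp add: inner_Pair)
qed

lemma ip_Pair:
  fixes H :: "'a \<Rightarrow> 'b::euclidean_space \<times> 'c::euclidean_space"
  assumes H: "sqint M H"
  shows "sqint M (\<lambda>x. fst (H x))" "sqint M (\<lambda>x. snd (H x))"
    "sqint M f \<Longrightarrow> sqint M g \<Longrightarrow>
      ip M H (\<lambda>x. (f x, g x)) = ip M (\<lambda>x. fst (H x)) f + ip M (\<lambda>x. snd (H x)) g"
proof -
  note [measurable] = sqint_measurable[OF H]
  have m: "(\<lambda>x. fst (H x)) \<in> borel_measurable M" "(\<lambda>x. snd (H x)) \<in> borel_measurable M"
    by (auto intro!: borel_measurable_continuous_on[OF _ sqint_measurable[OF H]] continuous_intros)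
  show 1: "sqint M (\<lambda>x. fst (H x))"
    by (rule sqint_bound(1)[OF H m(1), where B=1]) (simp, metis norm_fst_le prod.collapse)
  show 2: "sqint M (\<lambda>x. snd (H x))"
    by (rule sqint_bound(1)[OF H m(2), where B=1]) (simp, metis norm_snd_le prod.collapse)
  assume fg: "sqint M f" "sqint M g"
  have "ip M H (\<lambda>x. (f x, g x)) = (LINT x|M. fst (H x) \<bullet> f x + snd (H x) \<bullet> g x)"
    unfolding ip_def by (simp add: inner_prod_def)
  also have "\<dots> = ip M (\<lambda>x. fst (H x)) f + ip M (\<lambda>x. snd (H x)) g"
    unfolding ip_def by (rule Bochner_Integration.integral_add[OF sqint_inner[OF 1 fg(1)] sqint_inner[OF 2 fg(2)]])
  finally show "ip M H (\<lambda>x. (f x, g x)) = ip M (\<lambda>x. fst (H x)) f + ip M (\<lambda>x. snd (H x)) g" .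
qed

text \<open>Weak differentiability suffices for the norm. Testing the increment \<open>u r - u s\<close> against itself shows that
  \<open>u\<close> is Lipschitz in norm, because its weak derivative is bounded. In
  \<open>\<parallel>u r\<parallel>\<^sup>2 - \<parallel>u s\<parallel>\<^sup>2 = 2 \<langle>u s, u r - u s\<rangle> + \<parallel>u r - u s\<parallel>\<^sup>2\<close> the last term is then of second order, and the first one is
  differentiable since \<open>u s\<close> is a fixed test function.\<close>

lemma energy_has_derivative:
  fixes u u' :: "real \<Rightarrow> 'a \<Rightarrow> 'b::euclidean_space"
  assumes S: "convex S" "s \<in> S"
    and u: "\<And>r. r \<in> S \<Longrightarrow> sqint M (u r)"
    and u': "\<And>r. r \<in> S \<Longrightarrow> sqint M (u' r)"
    and B: "\<And>r. r \<in> S \<Longrightarrow> nsq M (u' r) \<le> B"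
    and der: "\<And>h r. sqint M h \<Longrightarrow> r \<in> S \<Longrightarrow>
       ((\<lambda>q. ip M h (u q)) has_real_derivative ip M h (u' r)) (at r within S)"
  shows "((\<lambda>r. nsq M (u r)) has_real_derivative 2 * ip M (u s) (u' s)) (at s within S)"
proof -
  let ?d = "\<lambda>r x. u r x - u s x"
  have dS: "sqint M (?d r)" if "r \<in> S" for r
    using u[OF that] u[OF S(2)] by (rule sqint_diff)
  have "B \<ge> 0" using B[OF S(2)] nsq_nonneg[of M "u' s"] by linarith
  \<comment> \<open>the increment is its own test function\<close>
  have lip: "nsq M (?d r) \<le> B * (r - s)\<^sup>2" if r: "r \<in> S" for r
  proof -
    let ?D = "nsq M (?d r)"
    have b: "norm (ip M (?d r) (u' q)) \<le> sqrt ?D * sqrt B" if "q \<in> S" for q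
      using order_trans[OF ip_le_sqrt[OF dS[OF r] u'[OF that]]]
        B[OF that] by (simp add: mult_left_mono)
    have "?D = ip M (?d r) (u r) - ip M (?d r) (u s)"
      using dS[OF r] u[OF r] u[OF S(2)] by (rule ip_diff_right)
    also have "\<bar>\<dots>\<bar> \<le> sqrt ?D * sqrt B * \<bar>r - s\<bar>"
      using field_differentiable_bound[OF S(1) der[OF dS[OF r]] b r S(2)] by simp
    finally have "sqrt ?D * sqrt ?D \<le> sqrt ?D * (sqrt B * \<bar>r - s\<bar>)"
      by (simp add: mult.assoc)
    then have "sqrt ?D \<le> sqrt B * \<bar>r - s\<bar>"
    proof (cases "?D = 0")
      case True
      then show ?thesis using \<open>B \<ge> 0\<close> by simp
    next
      case False
      then have "0 < sqrt ?D" using nsq_nonneg[of M "?d r"] by (simp add: less_le)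
      with \<open>sqrt ?D * sqrt ?D \<le> sqrt ?D * (sqrt B * \<bar>r - s\<bar>)\<close> show ?thesis
        by (simp only: mult_le_cancel_left_pos)
    qed
    then have "(sqrt ?D)\<^sup>2 \<le> (sqrt B * \<bar>r - s\<bar>)\<^sup>2"
      by (intro power_mono) auto
    then show ?thesis using \<open>B \<ge> 0\<close> by (simp add: power_mult_distrib)
  qed
  have eq: "(nsq M (u r) - nsq M (u s)) / (r - s) =
     2 * ((ip M (u s) (u r) - ip M (u s) (u s)) / (r - s)) + nsq M (?d r) / (r - s)" if "r \<in> S" for r
  proof -
    have "nsq M (u r) - nsq M (u s) = 2 * (ip M (u s) (u r) - ip M (u s) (u s)) + nsq M (?d r)"
      using nsq_diff[OF u[OF that] u[OF S(2)]] ip_commute[of M "u r" "u s"] by simp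
    then show ?thesis by (simp only: add_divide_distrib times_divide_eq_right)
  qed
  have t1: "((\<lambda>r. 2 * ((ip M (u s) (u r) - ip M (u s) (u s)) / (r - s))) \<longlongrightarrow> 2 * ip M (u s) (u' s)) (at s within S)"
    using der[OF u[OF S(2)] S(2)] unfolding has_field_derivative_iff by (intro tendsto_mult_left)
  have t2: "((\<lambda>r. nsq M (?d r) / (r - s)) \<longlongrightarrow> 0) (at s within S)"
  proof (rule Lim_null_comparison)
    show "\<forall>\<^sub>F r in at s within S. norm (nsq M (?d r) / (r - s)) \<le> B * \<bar>r - s\<bar>"
      unfolding eventually_at_filter
      using lip by (auto intro!: always_eventually simp: divide_le_eq power2_eq_square abs_mult mult.assoc)
    have "((\<lambda>r. B * \<bar>r - s\<bar>) \<longlongrightarrow> B * \<bar>s - s\<bar>) (at s within S)"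
      by (intro tendsto_intros)
    then show "((\<lambda>r. B * \<bar>r - s\<bar>) \<longlongrightarrow> 0) (at s within S)" by simp
  qed
  show ?thesis
    unfolding has_field_derivative_iff
    apply (rule Lim_transform_eventually[OF tendsto_add[OF t1 t2, simplified]])
    using eq unfolding eventually_at_filter by (auto intro!: always_eventually)
qed

section \<open>The Fourier transform on the line\<close>

definition ft :: "(real \<Rightarrow> complex) \<Rightarrow> real \<Rightarrow> complex" where
  "ft f \<xi> = (LINT y|lborel. cis (- (\<xi> * y)) * f y)"

lemma cis_measurable [measurable]: "cis \<in> borel_measurable borel"
  by (intro borel_measurable_continuous_onI continuous_intros)

lemma cnj_measurable [measurable]: "cnj \<in> borel_measurable borel"
  by (intro borel_measurable_continuous_onI continuous_intros)

lemma sqint_cnj: "sqint M h \<Longrightarrow> sqint M (\<lambda>x. cnj (h x))"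
  by (rule sqint_bound(1)[where B=1 and f=h]) auto

lemma integrable_cis_mult:
  fixes f :: "'a \<Rightarrow> complex"
  assumes "integrable M f" "a \<in> borel_measurable M"
  shows "integrable M (\<lambda>x. cis (a x) * f x)"
  by (rule Bochner_Integration.integrable_bound[OF assms(1)]) (use assms in \<open>auto simp: norm_mult\<close>)

lemma has_vector_derivative_cis:
  "((\<lambda>x. cis (a * x)) has_vector_derivative (\<i> * of_real a * cis (a * x))) (at x within S)"
proof -
  have "((\<lambda>z. exp (\<i> * of_real a * z)) has_field_derivative (exp (\<i> * of_real a * of_real x) * (\<i> * of_real a)))
      (at (of_real x))"
    by (auto intro!: derivative_eq_intros)
  from has_vector_derivative_real_field[OF this]
  show ?thesis by (simp add: cis_conv_exp mult_ac)
qed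

lemma ennreal_norm_integral_le:
  fixes f :: "'a \<Rightarrow> 'b::{banach, second_countable_topology}"
  shows "ennreal (norm (integral\<^sup>L M f)) \<le> (\<integral>\<^sup>+x. ennreal (norm (f x)) \<partial>M)"
  by (cases "integrable M f") (simp_all add: integral_norm_bound_ennreal not_integrable_integral_eq)

lemma ft_measurable [measurable]:
  assumes [measurable]: "f \<in> borel_measurable borel"
  shows "ft f \<in> borel_measurable borel"
  unfolding ft_def by measurable

lemma ft_bound:
  assumes "integrable lborel f"
  shows "norm (ft f \<xi>) \<le> (LINT y|lborel. norm (f y))"
proof -
  have "norm (ft f \<xi>) \<le> (LINT y|lborel. norm (cis (- (\<xi> * y)) * f y))"
    unfolding ft_def by (rule integral_norm_bound)
  then show ?thesis by (simp add: norm_mult)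
qed

text \<open>Fubini's theorem: both sides are the double integral of \<open>cis (- \<xi> y) f(y) g(\<xi>)\<close>.\<close>

lemma ft_multiplication:
  fixes f g :: "real \<Rightarrow> complex"
  assumes f: "integrable lborel f" and g: "integrable lborel g"
  shows "(LINT \<xi>|lborel. ft f \<xi> * g \<xi>) = (LINT y|lborel. f y * ft g y)"
proof -
  have [measurable]: "f \<in> borel_measurable borel" "g \<in> borel_measurable borel"
    using f g by auto
  let ?F = "\<lambda>\<xi> y. cis (- (\<xi> * y)) * f y * g \<xi>"
  have "integrable (lborel \<Otimes>\<^sub>M lborel) (case_prod ?F)"
  proof (rule lborel_pair.Fubini_integrable)
    show "case_prod ?F \<in> borel_measurable (lborel \<Otimes>\<^sub>M lborel)" by measurable
    show "integrable lborel (\<lambda>x. LINT y|lborel. norm (case (x, y) of (\<xi>, y) \<Rightarrow> ?F \<xi> y))"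
      using integrable_norm[OF g] by (simp add: norm_mult)
    show "AE x in lborel. integrable lborel (\<lambda>y. case (x, y) of (\<xi>, y) \<Rightarrow> ?F \<xi> y)"
      using integrable_cis_mult[OF f] by simp
  qed
  from lborel_pair.Fubini_integral[OF this]
  have "(LINT y|lborel. LINT \<xi>|lborel. ?F \<xi> y) = (LINT \<xi>|lborel. LINT y|lborel. ?F \<xi> y)" .
  moreover have "(LINT \<xi>|lborel. ?F \<xi> y) = f y * ft g y" for y
    unfolding ft_def by (subst integral_mult_right_zero[symmetric]) (simp add: mult_ac)
  moreover have "(LINT y|lborel. ?F \<xi> y) = ft f \<xi> * g \<xi>" for \<xi>
    unfolding ft_def by (subst integral_mult_left_zero[symmetric]) (simp add: mult_ac)
  ultimately show ?thesis by (simp only:)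
qed

text \<open>The weights \<open>gauss n\<close> increase to \<open>1\<close>, and their transforms \<open>gkernel n\<close> below are nonnegative with
  integral \<open>2\<pi>\<close> for every \<open>n\<close>.\<close>

definition gauss :: "real \<Rightarrow> real \<Rightarrow> real" where
  "gauss n \<xi> = exp (- (\<xi> / n)\<^sup>2 / 2)"

lemma gauss_measurable [measurable]: "gauss n \<in> borel_measurable borel"
  unfolding gauss_def by measurable

lemma gauss_eq: "gauss n \<xi> = sqrt (2 * pi) * std_normal_density (\<xi> / n)"
  by (simp add: gauss_def std_normal_density_def)

lemma integrable_gauss: "n > 0 \<Longrightarrow> integrable lborel (gauss n)"
  using lborel_integrable_real_affine[of std_normal_density "1/n" 0]
  unfolding gauss_eq[abs_def] by simp

lemma ft_std_normal: "(LINT x|lborel. cis (t * x) * of_real (std_normal_density x)) = of_real (exp (- t\<^sup>2 / 2))"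
proof -
  have "of_real (exp (- t\<^sup>2 / 2)) = (LINT x|std_normal_distribution. iexp (t * x))"
    using char_std_normal_distribution by (simp add: char_def fun_eq_iff)
  also have "\<dots> = (LINT x|lborel. std_normal_density x *\<^sub>R iexp (t * x))"
    by (subst integral_density) auto
  finally show ?thesis
    by (simp add: cis_conv_exp scaleR_conv_of_real mult_ac)
qed

definition gkernel :: "real \<Rightarrow> real \<Rightarrow> real" where
  "gkernel n u = 2 * pi * n * std_normal_density (n * u)"

lemma gkernel_measurable [measurable]: "gkernel n \<in> borel_measurable borel"
  unfolding gkernel_def by measurable

lemma gkernel_nonneg: "n > 0 \<Longrightarrow> 0 \<le> gkernel n u"
  by (simp add: gkernel_def)

lemma ft_gauss:
  assumes "n > 0"
  shows "ft (\<lambda>\<xi>. of_real (gauss n \<xi>)) u = of_real (gkernel n u)"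
proof -
  have "of_real (exp (- (- (n * u))\<^sup>2 / 2)) =
      (LINT x|lborel. cis ((- (n * u)) * x) * of_real (std_normal_density x))"
    using ft_std_normal[of "- (n * u)"] by simp
  also have "\<dots> = \<bar>1/n\<bar> *\<^sub>R (LINT x|lborel. cis ((- (n * u)) * (0 + 1/n * x)) * of_real (std_normal_density (0 + 1/n * x)))"
    by (rule lborel_integral_real_affine) (use assms in simp)
  also have "\<dots> = (1/n) *\<^sub>R (LINT x|lborel. cis (- (u * x)) * of_real (std_normal_density (x / n)))"
    using assms by simp
  finally have e1: "(LINT x|lborel. cis (- (u * x)) * complex_of_real (std_normal_density (x / n))) =
     of_real n * of_real (exp (- (n * u)\<^sup>2 / 2))"
    using assms by (simp add: scaleR_conv_of_real field_simps)
  have e2: "ft (\<lambda>\<xi>. of_real (gauss n \<xi>)) u =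
     of_real (sqrt (2 * pi)) * (LINT x|lborel. cis (- (u * x)) * complex_of_real (std_normal_density (x / n)))"
    unfolding ft_def gauss_eq by (subst integral_mult_right_zero[symmetric]) (simp add: mult_ac)
  have "ft (\<lambda>\<xi>. of_real (gauss n \<xi>)) u = of_real (sqrt (2 * pi) * n * exp (- (n * u)\<^sup>2 / 2))"
    unfolding e1 e2 by simp
  also have "sqrt (2 * pi) * n * exp (- (n * u)\<^sup>2 / 2) = gkernel n u"
    by (simp add: gkernel_def std_normal_density_def field_simps)
  finally show ?thesis .
qed

lemma nn_integral_gkernel:
  assumes "n > 0"
  shows "(\<integral>\<^sup>+u. ennreal (gkernel n (u + a)) \<partial>lborel) = ennreal (2 * pi)"
proof -
  have "ennreal 1 = (\<integral>\<^sup>+u. ennreal (std_normal_density u) \<partial>lborel)"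
    by (subst nn_integral_eq_integral) auto
  also have "\<dots> = \<bar>n\<bar> * (\<integral>\<^sup>+u. ennreal (std_normal_density (n * a + n * u)) \<partial>lborel)"
    using assms by (intro nn_integral_real_affine) auto
  also have "\<dots> = (\<integral>\<^sup>+u. ennreal (n * std_normal_density (n * (u + a))) \<partial>lborel)"
    using assms by (subst nn_integral_cmult[symmetric]) (auto simp: ennreal_mult' algebra_simps)
  finally have 1: "(\<integral>\<^sup>+u. ennreal (n * std_normal_density (n * (u + a))) \<partial>lborel) = 1" by simp
  have "(\<integral>\<^sup>+u. ennreal (gkernel n (u + a)) \<partial>lborel) =
     (\<integral>\<^sup>+u. ennreal (2 * pi) * ennreal (n * std_normal_density (n * (u + a))) \<partial>lborel)"
    using assms by (simp add: gkernel_def ennreal_mult'[symmetric] mult_ac)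
  also have "\<dots> = ennreal (2 * pi)"
    by (subst nn_integral_cmult) (auto simp: 1)
  finally show ?thesis .
qed

text \<open>By the multiplication formula the left-hand side is the quadratic form of \<open>f\<close> with kernel
  \<open>gkernel n (y - z)\<close>. Bounding \<open>|f(y) f(z)|\<close> by the mean of the squares leaves the total mass \<open>2\<pi>\<close> of the kernel.\<close>

lemma weighted_bessel:
  fixes f :: "real \<Rightarrow> complex"
  assumes f: "integrable lborel f" and f2: "sqint lborel f" and n: "n > 0"
  shows "(\<integral>\<^sup>+\<xi>. ennreal (gauss n \<xi> * (norm (ft f \<xi>))\<^sup>2) \<partial>lborel) \<le> ennreal (2 * pi * nsq lborel f)"
proof -
  have fm [measurable]: "f \<in> borel_measurable borel" using f by auto
  let ?W = "\<lambda>\<xi>. complex_of_real (gauss n \<xi>)"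
  let ?g = "\<lambda>z. cnj (f (- z))"
  have gk: "(\<integral>\<^sup>+y. ennreal (gkernel n (z + y)) \<partial>lborel) = ennreal (2 * pi)" for z
    using nn_integral_gkernel[OF n, of z] by (simp only: add.commute)
  have W: "integrable lborel ?W" using integrable_gauss[OF n] by simp
  have g: "integrable lborel ?g"
    using lborel_integrable_real_affine[of f "-1" 0] f by simp
  have cg: "cnj (ft f \<xi>) = ft ?g \<xi>" for \<xi>
  proof -
    have "ft ?g \<xi> = (LINT y|lborel. cis (- (\<xi> * y)) * cnj (f (- y)))" by (simp add: ft_def)
    also have "\<dots> = \<bar>-1\<bar> *\<^sub>R (LINT y|lborel. cis (- (\<xi> * (0 + (-1) * y))) * cnj (f (- (0 + (-1) * y))))"
      by (rule lborel_integral_real_affine) simp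
    also have "\<dots> = (LINT y|lborel. cnj (cis (- (\<xi> * y)) * f y))"
      by (simp add: cis_cnj)
    also have "\<dots> = cnj (ft f \<xi>)"
      unfolding ft_def by (rule Bochner_Integration.integral_cnj)
    finally show ?thesis by simp
  qed
  have bd: "norm (ft f \<xi>) \<le> (LINT y|lborel. norm (f y))" for \<xi> by (rule ft_bound[OF f])
  have Wf: "integrable lborel (\<lambda>\<xi>. ?W \<xi> * cnj (ft f \<xi>))"
  proof (rule Bochner_Integration.integrable_bound)
    show "integrable lborel (\<lambda>\<xi>. ?W \<xi> * of_real (LINT y|lborel. norm (f y)))" using W by simp
    show "AE \<xi> in lborel. norm (?W \<xi> * cnj (ft f \<xi>)) \<le> norm (?W \<xi> * of_real (LINT y|lborel. norm (f y)))"
      using bd by (auto simp: norm_mult abs_mult intro!: mult_left_mono always_eventually order_trans[OF bd])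
  qed measurable
  have inner: "ft (\<lambda>\<xi>. ?W \<xi> * cnj (ft f \<xi>)) y = (LINT z|lborel. ?g z * of_real (gkernel n (z + y)))" for y
  proof -
    let ?Wy = "\<lambda>\<xi>. cis (- (y * \<xi>)) * ?W \<xi>"
    have Wy: "integrable lborel ?Wy" by (rule integrable_cis_mult[OF W]) simp
    have "ft (\<lambda>\<xi>. ?W \<xi> * cnj (ft f \<xi>)) y = (LINT \<xi>|lborel. ft ?g \<xi> * ?Wy \<xi>)"
      by (simp only: cg ft_def[of "\<lambda>\<xi>. ?W \<xi> * ft ?g \<xi>"] mult_ac)
    also have "\<dots> = (LINT z|lborel. ?g z * ft ?Wy z)"
      by (rule ft_multiplication[OF g Wy])
    also have "ft ?Wy = (\<lambda>z. ft ?W (z + y))"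
    proof -
      have "cis (- (z * \<xi>)) * ?Wy \<xi> = cis (- ((z + y) * \<xi>)) * ?W \<xi>" for z \<xi>
      proof -
        have "cis (- ((z + y) * \<xi>)) = cis (- (z * \<xi>)) * cis (- (y * \<xi>))"
          by (simp add: cis_mult distrib_right)
        then show ?thesis by (simp only: mult.assoc)
      qed
      then show ?thesis unfolding ft_def by (simp only:)
    qed
    finally show ?thesis by (simp add: ft_gauss[OF n])
  qed
  have sqW: "integrable lborel (\<lambda>\<xi>. gauss n \<xi> * (norm (ft f \<xi>))\<^sup>2)"
  proof (rule Bochner_Integration.integrable_bound)
    show "integrable lborel (\<lambda>\<xi>. gauss n \<xi> * (LINT y|lborel. norm (f y))\<^sup>2)"
      using integrable_gauss[OF n] by simp
    show "AE \<xi> in lborel. norm (gauss n \<xi> * (norm (ft f \<xi>))\<^sup>2) \<le> norm (gauss n \<xi> * (LINT y|lborel. norm (f y))\<^sup>2)"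
      using bd by (auto simp: abs_mult intro!: mult_left_mono always_eventually power_mono)
  qed measurable
  let ?I = "LINT \<xi>|lborel. gauss n \<xi> * (norm (ft f \<xi>))\<^sup>2"
  have "of_real ?I = (LINT \<xi>|lborel. ft f \<xi> * (?W \<xi> * cnj (ft f \<xi>)))"
    by (subst integral_of_real[OF sqW, symmetric])
      (intro Bochner_Integration.integral_cong refl, simp add: complex_norm_square[symmetric] mult.left_commute[of "ft f _"])
  also have "\<dots> = (LINT y|lborel. f y * ft (\<lambda>\<xi>. ?W \<xi> * cnj (ft f \<xi>)) y)"
    by (rule ft_multiplication[OF f Wf])
  also have "\<dots> = (LINT y|lborel. LINT z|lborel. f y * (?g z * of_real (gkernel n (z + y))))"
    unfolding inner by simp
  finally have eq: "complex_of_real ?I = (LINT y|lborel. LINT z|lborel. f y * (?g z * of_real (gkernel n (z + y))))" .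
  have I0: "?I \<ge> 0" by (intro integral_nonneg_AE) (auto simp: gauss_def)
  have "ennreal ?I = ennreal (norm (complex_of_real ?I))" using I0 by simp
  also have "\<dots> \<le> (\<integral>\<^sup>+y. ennreal (norm (LINT z|lborel. f y * (?g z * of_real (gkernel n (z + y))))) \<partial>lborel)"
    unfolding eq by (rule ennreal_norm_integral_le)
  also have "\<dots> \<le> (\<integral>\<^sup>+y. \<integral>\<^sup>+z. ennreal (norm (f y * (?g z * of_real (gkernel n (z + y))))) \<partial>lborel \<partial>lborel)"
    by (intro nn_integral_mono ennreal_norm_integral_le)
  also have "\<dots> \<le> (\<integral>\<^sup>+y. \<integral>\<^sup>+z. ennreal ((norm (f y))\<^sup>2 / 2) * ennreal (gkernel n (z + y)) +
       ennreal ((norm (?g z))\<^sup>2 / 2) * ennreal (gkernel n (z + y)) \<partial>lborel \<partial>lborel)"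
  proof (intro nn_integral_mono)
    fix y z
    have "norm (f y) * norm (?g z) \<le> (norm (f y))\<^sup>2 / 2 + (norm (?g z))\<^sup>2 / 2"
      using sum_squares_bound[of "norm (f y)" "norm (?g z)"] by simp
    then have "norm (f y) * norm (?g z) * gkernel n (z + y) \<le> ((norm (f y))\<^sup>2 / 2 + (norm (?g z))\<^sup>2 / 2) * gkernel n (z + y)"
      by (rule mult_right_mono) (rule gkernel_nonneg[OF n])
    then show "ennreal (norm (f y * (?g z * of_real (gkernel n (z + y))))) \<le>
       ennreal ((norm (f y))\<^sup>2 / 2) * ennreal (gkernel n (z + y)) +
       ennreal ((norm (?g z))\<^sup>2 / 2) * ennreal (gkernel n (z + y))"
      using gkernel_nonneg[OF n]
      by (simp add: norm_mult ennreal_mult'[symmetric] ennreal_plus[symmetric] algebra_simps del: ennreal_plus)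
  qed
  also have "\<dots> = (\<integral>\<^sup>+y. \<integral>\<^sup>+z. ennreal ((norm (f y))\<^sup>2 / 2) * ennreal (gkernel n (z + y)) \<partial>lborel \<partial>lborel) +
      (\<integral>\<^sup>+y. \<integral>\<^sup>+z. ennreal ((norm (?g z))\<^sup>2 / 2) * ennreal (gkernel n (z + y)) \<partial>lborel \<partial>lborel)"
    by (subst nn_integral_add, simp, simp) (subst nn_integral_add, auto)
  also have "(\<integral>\<^sup>+y. \<integral>\<^sup>+z. ennreal ((norm (f y))\<^sup>2 / 2) * ennreal (gkernel n (z + y)) \<partial>lborel \<partial>lborel) =
      (\<integral>\<^sup>+y. ennreal ((norm (f y))\<^sup>2 / 2) \<partial>lborel) * ennreal (2 * pi)"
    by (subst nn_integral_cmult, simp) (simp add: nn_integral_gkernel[OF n] nn_integral_multc)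
  also have "(\<integral>\<^sup>+y. \<integral>\<^sup>+z. ennreal ((norm (?g z))\<^sup>2 / 2) * ennreal (gkernel n (z + y)) \<partial>lborel \<partial>lborel) =
     (\<integral>\<^sup>+z. \<integral>\<^sup>+y. ennreal ((norm (?g z))\<^sup>2 / 2) * ennreal (gkernel n (z + y)) \<partial>lborel \<partial>lborel)"
    by (rule lborel_pair.Fubini'[symmetric]) measurable
  also have "\<dots> = (\<integral>\<^sup>+z. ennreal ((norm (?g z))\<^sup>2 / 2) \<partial>lborel) * ennreal (2 * pi)"
    by (subst nn_integral_cmult, simp)
      (simp add: gk nn_integral_multc)
  also have "(\<integral>\<^sup>+z. ennreal ((norm (?g z))\<^sup>2 / 2) \<partial>lborel) = (\<integral>\<^sup>+y. ennreal ((norm (f y))\<^sup>2 / 2) \<partial>lborel)"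
    using nn_integral_real_affine[of "\<lambda>y. ennreal ((norm (f y))\<^sup>2 / 2)" "-1" 0] by simp
  also have "(\<integral>\<^sup>+y. ennreal ((norm (f y))\<^sup>2 / 2) \<partial>lborel) = ennreal (nsq lborel f / 2)"
    using sqint_integrable[OF f2] by (subst nn_integral_eq_integral) (auto simp: nsq_eq)
  also have "ennreal (nsq lborel f / 2) * ennreal (2 * pi) + ennreal (nsq lborel f / 2) * ennreal (2 * pi) = ennreal (2 * pi * nsq lborel f)"
    by (simp add: ennreal_mult'[symmetric] ennreal_plus[symmetric] del: ennreal_plus)
  finally have "ennreal ?I \<le> ennreal (2 * pi * nsq lborel f)" .
  moreover have "(\<integral>\<^sup>+\<xi>. ennreal (gauss n \<xi> * (norm (ft f \<xi>))\<^sup>2) \<partial>lborel) = ennreal ?I"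
    by (rule nn_integral_eq_integral[OF sqW]) (auto simp: gauss_def)
  ultimately show ?thesis by simp
qed

text \<open>Fatou's lemma for the weights \<open>gauss n\<close>; this is the inequality half of Plancherel's theorem.\<close>

lemma ft_bessel:
  fixes f :: "real \<Rightarrow> complex"
  assumes f: "integrable lborel f" and f2: "sqint lborel f"
  shows "(\<integral>\<^sup>+\<xi>. ennreal ((norm (ft f \<xi>))\<^sup>2) \<partial>lborel) \<le> ennreal (2 * pi * nsq lborel f)"
proof -
  have fm [measurable]: "f \<in> borel_measurable borel" using f by auto
  have "(\<lambda>n. ennreal (gauss (real (Suc n)) \<xi> * (norm (ft f \<xi>))\<^sup>2)) \<longlonglongrightarrow> ennreal ((norm (ft f \<xi>))\<^sup>2)" for \<xi>
  proof (intro tendsto_ennrealI)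
    have "(\<lambda>n. \<xi> * (1 / real (Suc n))) \<longlonglongrightarrow> \<xi> * 0"
      using LIMSEQ_inverse_real_of_nat by (intro tendsto_mult_left) (simp add: inverse_eq_divide)
    then have "(\<lambda>n. \<xi> / real (Suc n)) \<longlonglongrightarrow> 0" by simp
    then have "(\<lambda>n. exp (- (\<xi> / real (Suc n))\<^sup>2 / 2) * (norm (ft f \<xi>))\<^sup>2) \<longlonglongrightarrow> exp (- 0\<^sup>2 / 2) * (norm (ft f \<xi>))\<^sup>2"
      by (intro tendsto_intros) auto
    then show "(\<lambda>n. gauss (real (Suc n)) \<xi> * (norm (ft f \<xi>))\<^sup>2) \<longlonglongrightarrow> (norm (ft f \<xi>))\<^sup>2"
      by (simp add: gauss_def)
  qed
  then have "(\<integral>\<^sup>+\<xi>. ennreal ((norm (ft f \<xi>))\<^sup>2) \<partial>lborel) =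
     (\<integral>\<^sup>+\<xi>. liminf (\<lambda>n. ennreal (gauss (real (Suc n)) \<xi> * (norm (ft f \<xi>))\<^sup>2)) \<partial>lborel)"
    by (intro nn_integral_cong lim_imp_Liminf[symmetric]) auto
  also have "\<dots> \<le> liminf (\<lambda>n. \<integral>\<^sup>+\<xi>. ennreal (gauss (real (Suc n)) \<xi> * (norm (ft f \<xi>))\<^sup>2) \<partial>lborel)"
    by (rule nn_integral_liminf) measurable
  also have "\<dots> \<le> ennreal (2 * pi * nsq lborel f)"
    by (rule order_trans[OF Liminf_le_Limsup]) (auto intro!: Limsup_bounded weighted_bessel[OF f f2] always_eventually)
  finally show ?thesis .
qed

section \<open>Fourier coefficients on the cylinder\<close>

definition circle :: "real measure" where
  "circle = restrict_space lborel {0..<2 * pi}"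

lemma sets_circle [measurable_cong]: "sets circle = sets (restrict_space borel {0..<2 * pi})"
  unfolding circle_def by (intro sets_restrict_space_cong) simp

lemma space_circle [simp]: "space circle = {0..<2 * pi}"
  by (simp add: circle_def space_restrict_space)

lemma measurable_circle [measurable]: "(\<lambda>x. x) \<in> borel_measurable circle"
  unfolding circle_def by (intro measurable_restrict_space1) simp

lemma measurable_circleI: "f \<in> borel_measurable borel \<Longrightarrow> f \<in> borel_measurable circle"
  using measurable_compose[OF measurable_circle] by blast

lemma emeasure_circle: "emeasure circle (space circle) = ennreal (2 * pi)"
  by (simp add: circle_def emeasure_restrict_space space_restrict_space)

lemma finite_measure_circle: "finite_measure circle"
  by (rule finite_measureI) (simp only: emeasure_circle, simp)

interpretation circle: finite_measure circle
  by (rule finite_measure_circle)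

interpretation cyl: pair_sigma_finite circle lborel ..

text \<open>This makes Fubini's theorem available on the cylinder.\<close>

lemma cyl_eq: "cyl = circle \<Otimes>\<^sub>M lborel"
proof (rule pair_measure_eqI[symmetric])
  show "sigma_finite_measure circle" "sigma_finite_measure (lborel :: real measure)" ..
  have sp: "space (circle \<Otimes>\<^sub>M lborel) = {0..<2*pi} \<times> (UNIV :: real set)"
    by (simp add: space_pair_measure)
  have Om: "{0..<2 * pi} \<times> UNIV \<in> sets (borel :: (real \<times> real) measure)"
    by (simp add: borel_prod[symmetric])
  show "sets (circle \<Otimes>\<^sub>M lborel) = sets cyl"
  proof
    show "sets (circle \<Otimes>\<^sub>M lborel) \<subseteq> sets cyl"
    proof (rule sets_pair_in_sets)
      fix A and B :: "real set" assume A: "A \<in> sets circle" and B: "B \<in> sets lborel"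
      then have "A \<in> sets borel" "A \<subseteq> {0..<2*pi}"
        unfolding circle_def by (auto simp: sets_restrict_space)
      then have "A \<times> B \<in> sets (borel :: (real \<times> real) measure)" "A \<times> B \<subseteq> {0..<2*pi} \<times> UNIV"
        using B by (auto simp: borel_prod[symmetric])
      then show "A \<times> B \<in> sets cyl"
        unfolding cyl_def using Om by (simp add: sets_restrict_space_iff)
    qed
    show "sets cyl \<subseteq> sets (circle \<Otimes>\<^sub>M lborel)"
    proof
      fix A assume "A \<in> sets cyl"
      then have A: "A \<in> sets borel" "A \<subseteq> {0..<2*pi} \<times> UNIV"
        unfolding cyl_def using Om by (auto simp: sets_restrict_space)
      have "(\<lambda>p. (fst p, snd p)) \<in> (circle \<Otimes>\<^sub>M (lborel :: real measure)) \<rightarrow>\<^sub>M (borel \<Otimes>\<^sub>M borel)"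
      proof (intro measurable_Pair)
        show "fst \<in> borel_measurable (circle \<Otimes>\<^sub>M (lborel :: real measure))"
          using measurable_compose[OF measurable_fst measurable_circle] by simp
        show "snd \<in> borel_measurable (circle \<Otimes>\<^sub>M (lborel :: real measure))"
          using measurable_snd[of circle "lborel :: real measure"] by simp
      qed
      from measurable_sets[OF this[unfolded borel_prod] A(1)]
      have "A \<inter> space (circle \<Otimes>\<^sub>M lborel) \<in> sets (circle \<Otimes>\<^sub>M lborel)" by (simp add: vimage_def)
      then show "A \<in> sets (circle \<Otimes>\<^sub>M lborel)"
        using A(2) unfolding sp by (simp add: Int_absorb2)
    qed
  qed
  fix A and B :: "real set" assume A: "A \<in> sets circle" and B: "B \<in> sets lborel"
  then have A': "A \<in> sets borel" "A \<subseteq> {0..<2*pi}"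
    unfolding circle_def by (auto simp: sets_restrict_space)
  have "emeasure cyl (A \<times> B) = emeasure (lborel \<Otimes>\<^sub>M lborel) (A \<times> B)"
    unfolding cyl_def lborel_prod by (rule emeasure_restrict_space) (use Om A' in auto)
  also have "\<dots> = emeasure lborel A * emeasure lborel B"
    using A' B by (intro lborel.emeasure_pair_measure_Times) auto
  also have "emeasure lborel A = emeasure circle A"
    unfolding circle_def using A' by (intro emeasure_restrict_space[symmetric]) auto
  finally show "emeasure circle A * emeasure lborel B = emeasure cyl (A \<times> B)" by simp
qed

lemma measurable_cyl: "f \<in> borel_measurable borel \<Longrightarrow> f \<in> borel_measurable cyl"
  unfolding cyl_def by (intro measurable_restrict_space1) simp

lemma measurable_fst_cyl [measurable]: "fst \<in> borel_measurable cyl"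
  by (intro measurable_cyl) (simp add: borel_prod[symmetric])

lemma measurable_snd_cyl [measurable]: "snd \<in> borel_measurable cyl"
  by (intro measurable_cyl) (simp add: borel_prod[symmetric])

lemma integral_circle_cis:
  fixes m :: int
  shows "(LINT x|circle. cis (of_int m * x)) = (if m = 0 then 2 * pi else 0)"
proof (cases "m = 0")
  case True
  then show ?thesis
    using emeasure_circle by (simp add: measure_def scaleR_conv_of_real)
next
  case False
  let ?F = "\<lambda>x. cis (of_int m * x) / (\<i> * of_int m)"
  have d: "(?F has_vector_derivative cis (of_int m * x)) (at x within {0..2*pi})" for x
    using has_vector_derivative_mult_right[OF has_vector_derivative_cis[of "of_int m" x "{0..2*pi}"], of "1 / (\<i> * of_int m)"]
      False by simp
  have "(LINT x|circle. cis (of_int m * x)) = (LINT x|lborel. indicator {0..<2*pi} x *\<^sub>R cis (of_int m * x))"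
    unfolding circle_def by (rule integral_restrict_space) simp
  also have "\<dots> = (LINT x|lborel. indicator {0..2*pi} x *\<^sub>R cis (of_int m * x))"
    by (intro integral_cong_AE) (auto intro!: AE_I[where N="{2*pi}"] split: split_indicator)
  also have "\<dots> = ?F (2 * pi) - ?F 0"
    by (intro integral_FTC_atLeastAtMost d continuous_intros) auto
  also have "cis (of_int m * (2 * pi)) = 1"
    using cis_multiple_2pi[of "of_int m"] by (simp add: mult_ac)
  finally show ?thesis using False by simp
qed

text \<open>The partial sum \<open>S\<close> of the Fourier series has the same coefficients as \<open>h\<close> on \<open>F\<close>, so that
  \<open>\<langle>S, S\<rangle> = \<langle>S, h\<rangle>\<close>, and \<open>\<parallel>h - S\<parallel>\<^sup>2 \<ge> 0\<close> is the claim.\<close>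

lemma circle_bessel_sqint:
  fixes h :: "real \<Rightarrow> complex"
  assumes h: "sqint circle h" and F: "finite F"
  shows "(\<Sum>k\<in>F. (norm (LINT x|circle. cis (- (of_int k * x)) * h x))\<^sup>2) \<le> 2 * pi * nsq circle h"
proof -
  define c where "c k = (LINT x|circle. cis (- (of_int k * x)) * h x)" for k :: int
  define S where "S x = (\<Sum>l\<in>F. c l / (2 * pi) * cis (of_int l * x))" for x
  have e: "sqint circle (\<lambda>x. a * cis (r * x))" for r and a :: complex
    unfolding sqint_def by (auto simp: norm_mult intro!: measurable_circleI)
  have S: "sqint circle S"
    unfolding S_def by (intro sqint_sum e)
  have int: "integrable circle (\<lambda>x. cis (- (of_int k * x)) * u x)" if u: "sqint circle u" for k :: int and u
  proof -
    have "integrable circle u"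
    proof (rule Bochner_Integration.integrable_bound)
      show "integrable circle (\<lambda>x. 1 + (norm (u x))\<^sup>2)" using sqint_integrable[OF u] by simp
      show "u \<in> borel_measurable circle" using u by (rule sqint_measurable)
      have "norm z \<le> norm (1 + (norm z)\<^sup>2)" for z :: complex
        using sum_squares_bound[of 1 "norm z"] by (simp add: abs_of_nonneg) (smt (verit) norm_ge_zero)
      then show "AE x in circle. norm (u x) \<le> norm (1 + (norm (u x))\<^sup>2)" by simp
    qed
    then show ?thesis by (rule integrable_cis_mult) (auto intro!: measurable_circleI)
  qed
  \<comment> \<open>only the coefficients of \<open>u\<close> on \<open>F\<close> enter\<close>
  have ipS: "ip circle S u = (\<Sum>k\<in>F. Re (cnj (c k / (2 * pi)) * (LINT x|circle. cis (- (of_int k * x)) * u x)))"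
    if u: "sqint circle u" for u
  proof -
    have "S x \<bullet> u x = (\<Sum>k\<in>F. Re (cnj (c k / (2 * pi)) * (cis (- (of_int k * x)) * u x)))" for x
    proof -
      have "S x \<bullet> u x = Re (cnj (S x) * u x)" by (simp add: inner_complex_def)
      also have "cnj (S x) * u x = (\<Sum>k\<in>F. cnj (c k / (2 * pi)) * (cis (- (of_int k * x)) * u x))"
        unfolding S_def cnj_sum sum_distrib_right by (intro sum.cong refl) (simp add: cis_cnj)
      finally show ?thesis by simp
    qed
    then have "ip circle S u = (LINT x|circle. (\<Sum>k\<in>F. Re (cnj (c k / (2 * pi)) * (cis (- (of_int k * x)) * u x))))"
      unfolding ip_def by simp
    also have "\<dots> = (\<Sum>k\<in>F. LINT x|circle. Re (cnj (c k / (2 * pi)) * (cis (- (of_int k * x)) * u x)))"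
      by (intro Bochner_Integration.integral_sum integrable_Re integrable_mult_right int u)
    also have "\<dots> = (\<Sum>k\<in>F. Re (cnj (c k / (2 * pi)) * (LINT x|circle. cis (- (of_int k * x)) * u x)))"
      by (intro sum.cong refl) (subst integral_Re, auto intro!: int u)
    finally show ?thesis .
  qed
  have cS: "(LINT x|circle. cis (- (of_int k * x)) * S x) = c k" if "k \<in> F" for k
  proof -
    have "(LINT x|circle. cis (- (of_int k * x)) * S x) =
       (LINT x|circle. (\<Sum>l\<in>F. c l / (2 * pi) * cis (of_int (l - k) * x)))"
      unfolding S_def sum_distrib_left
    proof (intro Bochner_Integration.integral_cong refl sum.cong)
      fix x l
      have "cis (of_int (l - k) * x) = cis (- (of_int k * x)) * cis (of_int l * x)"
        by (simp add: cis_mult left_diff_distrib)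
      then show "cis (- (of_int k * x)) * (c l / (2 * pi) * cis (of_int l * x)) = c l / (2 * pi) * cis (of_int (l - k) * x)"
        by simp
    qed
    also have "\<dots> = (\<Sum>l\<in>F. c l / (2 * pi) * (LINT x|circle. cis (of_int (l - k) * x)))"
    proof (subst Bochner_Integration.integral_sum)
      show "integrable circle (\<lambda>x. c l / (2 * pi) * cis (of_int (l - k) * x))" for l
        by (intro integrable_mult_right circle.integrable_const_bound[where B=1] measurable_circleI) auto
    qed (simp only: integral_mult_right_zero)
    also have "\<dots> = (\<Sum>l\<in>F. if l = k then c l else 0)"
      by (intro sum.cong refl) (subst integral_circle_cis, simp)
    also have "\<dots> = c k" using F that by simp
    finally show ?thesis .
  qed
  have sq: "Re (cnj (c k / (2 * pi)) * c k) = (norm (c k))\<^sup>2 / (2 * pi)" for k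
  proof -
    have "cnj (c k / (2 * pi)) * c k = of_real ((norm (c k))\<^sup>2 / (2 * pi))"
      using complex_norm_square[of "c k"] by (simp add: mult.commute)
    then show ?thesis by simp
  qed
  have "ip circle S h = (\<Sum>k\<in>F. (norm (c k))\<^sup>2 / (2 * pi))"
    unfolding ipS[OF h] by (simp only: c_def[symmetric] sq)
  moreover have "ip circle S S = (\<Sum>k\<in>F. (norm (c k))\<^sup>2 / (2 * pi))"
    unfolding ipS[OF S] by (intro sum.cong refl) (simp only: cS sq)
  ultimately have "(\<Sum>k\<in>F. (norm (c k))\<^sup>2 / (2 * pi)) \<le> nsq circle h"
    using nsq_diff[OF h S] nsq_nonneg[of circle "\<lambda>x. h x - S x"] by (simp add: ip_commute[of circle h S])
  then show ?thesis
    unfolding c_def[symmetric] by (simp add: sum_divide_distrib[symmetric] field_simps)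
qed

lemma circle_bessel:
  fixes h :: "real \<Rightarrow> complex"
  assumes [measurable]: "h \<in> borel_measurable circle" and F: "finite F"
  shows "(\<Sum>k\<in>F. ennreal ((norm (LINT x|circle. cis (- (of_int k * x)) * h x))\<^sup>2))
     \<le> ennreal (2 * pi) * (\<integral>\<^sup>+x. ennreal ((norm (h x))\<^sup>2) \<partial>circle)"
proof (cases "(\<integral>\<^sup>+x. ennreal ((norm (h x))\<^sup>2) \<partial>circle) < \<infinity>")
  case True
  then have h: "sqint circle h" by (intro sqintI_nn) auto
  show ?thesis
    unfolding nn_integral_sqint[OF h]
    using circle_bessel_sqint[OF h F] by (simp add: ennreal_mult'[symmetric] ennreal_leI)
next
  case False
  then show ?thesis by (simp add: ennreal_mult_top less_top[symmetric])
qed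

text \<open>Fatou's lemma for the exhaustion of the integers by \<open>{-n..n}\<close>.\<close>

lemma nn_integral_count_int_le:
  fixes f :: "int \<Rightarrow> ennreal"
  assumes "\<And>F. finite F \<Longrightarrow> sum f F \<le> B"
  shows "(\<integral>\<^sup>+k. f k \<partial>count_space UNIV) \<le> B"
proof -
  let ?f = "\<lambda>n k. if k \<in> {- int n..int n} then f k else 0"
  have "(\<lambda>n. ?f n k) \<longlonglongrightarrow> f k" for k
    by (intro tendsto_eventually eventually_sequentiallyI[of "nat \<bar>k\<bar>"]) auto
  then have "(\<integral>\<^sup>+k. f k \<partial>count_space UNIV) = (\<integral>\<^sup>+k. liminf (\<lambda>n. ?f n k) \<partial>count_space UNIV)"
    by (intro nn_integral_cong lim_imp_Liminf[symmetric]) auto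
  also have "\<dots> \<le> liminf (\<lambda>n. \<integral>\<^sup>+k. ?f n k \<partial>count_space UNIV)"
    by (rule nn_integral_liminf) simp
  also have "(\<lambda>n. \<integral>\<^sup>+k. ?f n k \<partial>count_space UNIV) = (\<lambda>n. sum f {- int n..int n})"
  proof
    fix n
    show "(\<integral>\<^sup>+k. ?f n k \<partial>count_space UNIV) = sum f {- int n..int n}"
      by (subst nn_integral_count_space'[where A="{- int n..int n}"]) auto
  qed
  also have "liminf (\<lambda>n. sum f {- int n..int n}) \<le> B"
    by (rule order_trans[OF Liminf_le_Limsup]) (auto intro!: Limsup_bounded assms always_eventually)
  finally show ?thesis .
qed

definition x_coeff :: "(real \<times> real \<Rightarrow> real) \<Rightarrow> int \<Rightarrow> real \<Rightarrow> complex" where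
  "x_coeff g k y = (LINT x|circle. cis (- (of_int k * x)) * of_real (g (x, y)))"

lemma x_coeff_measurable [measurable]:
  assumes [measurable]: "g \<in> borel_measurable cyl"
  shows "x_coeff g k \<in> borel_measurable borel"
proof -
  have [measurable]: "g \<in> borel_measurable (circle \<Otimes>\<^sub>M lborel)"
    using assms unfolding cyl_eq .
  have "(\<lambda>y. LINT x|circle. cis (- (of_int k * x)) * of_real (g (x, y))) \<in> borel_measurable lborel"
    by (rule circle.borel_measurable_lebesgue_integral) measurable
  then show ?thesis by (simp add: x_coeff_def[abs_def])
qed

lemma x_coeff_bessel:
  assumes [measurable]: "g \<in> borel_measurable cyl"
  shows "(\<integral>\<^sup>+k. \<integral>\<^sup>+y. ennreal ((norm (x_coeff g k y))\<^sup>2) \<partial>lborel \<partial>count_space UNIV)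
    \<le> ennreal (2 * pi) * (\<integral>\<^sup>+p. ennreal ((g p)\<^sup>2) \<partial>cyl)"
proof (rule nn_integral_count_int_le)
  fix F :: "int set" assume F: "finite F"
  have [measurable]: "g \<in> borel_measurable (circle \<Otimes>\<^sub>M lborel)"
    using assms unfolding cyl_eq .
  have gy: "(\<lambda>x. complex_of_real (g (x, y))) \<in> borel_measurable circle" for y
    using measurable_compose[OF measurable_Pair2'[of y lborel circle]
      \<open>g \<in> borel_measurable (circle \<Otimes>\<^sub>M lborel)\<close>] by simp
  have "(\<Sum>k\<in>F. \<integral>\<^sup>+y. ennreal ((norm (x_coeff g k y))\<^sup>2) \<partial>lborel) =
     (\<integral>\<^sup>+y. (\<Sum>k\<in>F. ennreal ((norm (x_coeff g k y))\<^sup>2)) \<partial>lborel)"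
    by (rule nn_integral_sum[symmetric]) (use x_coeff_measurable[OF assms] in simp)
  also have "\<dots> \<le> (\<integral>\<^sup>+y. ennreal (2 * pi) * (\<integral>\<^sup>+x. ennreal ((norm (complex_of_real (g (x, y))))\<^sup>2) \<partial>circle) \<partial>lborel)"
    unfolding x_coeff_def by (intro nn_integral_mono circle_bessel F gy)
  also have "\<dots> = ennreal (2 * pi) * (\<integral>\<^sup>+y. (\<integral>\<^sup>+x. ennreal ((g (x, y))\<^sup>2) \<partial>circle) \<partial>lborel)"
    by (simp, subst nn_integral_cmult) (auto intro!: circle.borel_measurable_nn_integral)
  also have "(\<integral>\<^sup>+y. (\<integral>\<^sup>+x. ennreal ((g (x, y))\<^sup>2) \<partial>circle) \<partial>lborel) = (\<integral>\<^sup>+p. ennreal ((g p)\<^sup>2) \<partial>cyl)"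
    unfolding cyl_eq by (rule cyl.nn_integral_snd) measurable
  finally show "(\<Sum>k\<in>F. \<integral>\<^sup>+y. ennreal ((norm (x_coeff g k y))\<^sup>2) \<partial>lborel) \<le>
     ennreal (2 * pi) * (\<integral>\<^sup>+p. ennreal ((g p)\<^sup>2) \<partial>cyl)" .
qed

lemma integrable_x_coeff:
  assumes g: "integrable cyl g"
  shows "integrable lborel (x_coeff g k)"
    and "(LINT p|cyl. g p *\<^sub>R cis (- (of_int k * fst p + \<xi> * snd p))) = ft (x_coeff g k) \<xi>"
proof -
  have [measurable]: "g \<in> borel_measurable cyl" using g by auto
  have i: "integrable cyl (\<lambda>p. cis (a p) * of_real (g p))" if "a \<in> borel_measurable cyl" for a
    using g that by (intro integrable_cis_mult) auto
  have "integrable (circle \<Otimes>\<^sub>M lborel) (\<lambda>(x, y). cis (- (of_int k * x)) * of_real (g (x, y)))"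
    using i[of "\<lambda>p. - (of_int k * fst p)"] unfolding cyl_eq by (simp add: case_prod_beta')
  from cyl.integrable_snd[OF this] show "integrable lborel (x_coeff g k)" by (simp add: x_coeff_def[abs_def])
  have 2: "integrable (circle \<Otimes>\<^sub>M lborel) (\<lambda>(x, y). cis (- (of_int k * x + \<xi> * y)) * of_real (g (x, y)))"
    using i[of "\<lambda>p. - (of_int k * fst p + \<xi> * snd p)"] unfolding cyl_eq by (simp add: case_prod_beta')
  have "(LINT p|cyl. g p *\<^sub>R cis (- (of_int k * fst p + \<xi> * snd p))) =
     (LINT p|(circle \<Otimes>\<^sub>M lborel). (case p of (x, y) \<Rightarrow> cis (- (of_int k * x + \<xi> * y)) * of_real (g (x, y))))"
    unfolding cyl_eq by (simp add: case_prod_beta' scaleR_conv_of_real mult.commute)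
  also have "\<dots> = (LINT y|lborel. LINT x|circle. cis (- (of_int k * x + \<xi> * y)) * of_real (g (x, y)))"
    by (rule cyl.integral_snd[OF 2, symmetric])
  also have "\<dots> = ft (x_coeff g k) \<xi>"
    unfolding ft_def x_coeff_def
  proof (intro Bochner_Integration.integral_cong refl, subst integral_mult_right_zero[symmetric],
      intro Bochner_Integration.integral_cong refl)
    fix x y
    have "cis (- (of_int k * x + \<xi> * y)) = cis (- (\<xi> * y)) * cis (- (of_int k * x))"
      by (simp add: cis_mult add.commute)
    then show "cis (- (of_int k * x + \<xi> * y)) * complex_of_real (g (x, y)) =
      cis (- (\<xi> * y)) * (cis (- (of_int k * x)) * complex_of_real (g (x, y)))"
      by simp
  qed
  finally show "(LINT p|cyl. g p *\<^sub>R cis (- (of_int k * fst p + \<xi> * snd p))) = ft (x_coeff g k) \<xi>" .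
qed

(* as a default rule it diverts measurability goals on the line to the circle *)
declare measurable_circle [measurable del]

section \<open>Existence of the Fourier transform of square-integrable functions\<close>

lemma cyl_L2_sqint: "cyl_L2 f \<Longrightarrow> sqint cyl f"
  by (simp add: cyl_L2_def cyl_fun_def sqint_def measurable_cyl)

lemma sqint_cyl_indicator: "sqint cyl (\<lambda>p. indicator {-R..R} (snd p) :: real)"
proof -
  have "emeasure cyl (space circle \<times> {-R..R}) = emeasure circle (space circle) * emeasure lborel {-R..R}"
    unfolding cyl_eq by (intro lborel.emeasure_pair_measure_Times sets.top) auto
  also have "\<dots> < \<infinity>"
    unfolding emeasure_circle by (simp add: ennreal_mult_less_top emeasure_lborel_Icc_eq)
  finally have fin: "emeasure cyl (space circle \<times> {-R..R}) < \<infinity>" .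
  have "space circle \<times> {-R..R} \<in> sets cyl"
    unfolding cyl_eq by (intro pair_measureI sets.top) auto
  then have "integrable cyl (indicator (space circle \<times> {-R..R}) :: _ \<Rightarrow> real)"
    using fin by simp
  moreover have "((indicator {-R..R} (snd p) :: real))\<^sup>2 = indicator (space circle \<times> {-R..R}) p" if "p \<in> space cyl" for p
    using that unfolding cyl_eq by (auto simp: space_pair_measure split: split_indicator)
  ultimately have "integrable cyl (\<lambda>p. (norm (indicator {-R..R} (snd p) :: real))\<^sup>2)"
    by (subst Bochner_Integration.integrable_cong[OF refl]) auto
  then show ?thesis by (simp add: sqint_def)
qed

lemma integrable_cyl_trunc:
  "sqint cyl f \<Longrightarrow> integrable cyl (\<lambda>p. indicator {-R..R} (snd p) * f p :: real)"
  using sqint_inner[OF sqint_cyl_indicator, of f R] by simp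

lemma sqint_x_coeff:
  assumes "sqint cyl g"
  shows "sqint lborel (x_coeff g k)"
proof (rule sqintI_nn)
  have m: "g \<in> borel_measurable cyl" using assms by (rule sqint_measurable)
  show "x_coeff g k \<in> borel_measurable lborel" using x_coeff_measurable[OF m] by simp
  have "(\<integral>\<^sup>+y. ennreal ((norm (x_coeff g k y))\<^sup>2) \<partial>lborel)
    \<le> (\<integral>\<^sup>+k. \<integral>\<^sup>+y. ennreal ((norm (x_coeff g k y))\<^sup>2) \<partial>lborel \<partial>count_space UNIV)"
    by (rule nn_integral_ge_point) simp
  also have "\<dots> \<le> ennreal (2 * pi) * ennreal (nsq cyl g)"
    using x_coeff_bessel[OF m] nn_integral_sqint[OF assms] by simp
  also have "\<dots> < \<infinity>" by (simp add: ennreal_mult_less_top)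
  finally show "(\<integral>\<^sup>+y. ennreal ((norm (x_coeff g k y))\<^sup>2) \<partial>lborel) < \<infinity>" .
qed

lemma ft_x_coeff_bessel:
  assumes g: "integrable cyl g" and g2: "sqint cyl g"
  shows "(\<integral>\<^sup>+k. \<integral>\<^sup>+\<xi>. ennreal ((norm (1 / (2 * pi) * ft (x_coeff g k) \<xi>))\<^sup>2) \<partial>lborel \<partial>count_space UNIV)
    \<le> ennreal (nsq cyl g)"
proof -
  have m: "g \<in> borel_measurable cyl" using g by auto
  have xm [measurable]: "ft (x_coeff g k) \<in> borel_measurable borel" for k
    by (intro ft_measurable x_coeff_measurable m)
  let ?c = "ennreal (1 / (4 * pi\<^sup>2))"
  have "(norm (1 / (2 * pi) * z))\<^sup>2 = 1 / (4 * pi\<^sup>2) * (norm z)\<^sup>2" for z :: complex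
    by (simp add: norm_mult norm_divide power_mult_distrib power_divide)
  then have "(\<integral>\<^sup>+\<xi>. ennreal ((norm (1 / (2 * pi) * ft (x_coeff g k) \<xi>))\<^sup>2) \<partial>lborel)
     = (\<integral>\<^sup>+\<xi>. ?c * ennreal ((norm (ft (x_coeff g k) \<xi>))\<^sup>2) \<partial>lborel)" for k
    by (simp add: ennreal_mult'[symmetric])
  also have "(\<integral>\<^sup>+\<xi>. ?c * ennreal ((norm (ft (x_coeff g k) \<xi>))\<^sup>2) \<partial>lborel) =
     ?c * (\<integral>\<^sup>+\<xi>. ennreal ((norm (ft (x_coeff g k) \<xi>))\<^sup>2) \<partial>lborel)" for k
    by (rule nn_integral_cmult) simp
  also have "?c * (\<integral>\<^sup>+\<xi>. ennreal ((norm (ft (x_coeff g k) \<xi>))\<^sup>2) \<partial>lborel) \<le>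
     ennreal (1 / (2 * pi)) * (\<integral>\<^sup>+y. ennreal ((norm (x_coeff g k y))\<^sup>2) \<partial>lborel)" for k
  proof -
    have "?c * (\<integral>\<^sup>+\<xi>. ennreal ((norm (ft (x_coeff g k) \<xi>))\<^sup>2) \<partial>lborel) \<le> ?c * ennreal (2 * pi * nsq lborel (x_coeff g k))"
      by (intro mult_left_mono ft_bessel integrable_x_coeff g sqint_x_coeff g2) simp
    also have "\<dots> = ennreal (1 / (2 * pi)) * ennreal (nsq lborel (x_coeff g k))"
      by (simp add: ennreal_mult'[symmetric] power2_eq_square)
    finally show ?thesis by (simp add: nn_integral_sqint[OF sqint_x_coeff[OF g2]])
  qed
  finally have "(\<integral>\<^sup>+k. \<integral>\<^sup>+\<xi>. ennreal ((norm (1 / (2 * pi) * ft (x_coeff g k) \<xi>))\<^sup>2) \<partial>lborel \<partial>count_space UNIV)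
    \<le> (\<integral>\<^sup>+k. ennreal (1 / (2 * pi)) * (\<integral>\<^sup>+y. ennreal ((norm (x_coeff g k y))\<^sup>2) \<partial>lborel) \<partial>count_space UNIV)"
    by (intro nn_integral_mono)
  also have "\<dots> = ennreal (1 / (2 * pi)) * (\<integral>\<^sup>+k. \<integral>\<^sup>+y. ennreal ((norm (x_coeff g k y))\<^sup>2) \<partial>lborel \<partial>count_space UNIV)"
    by (rule nn_integral_cmult) simp
  also have "\<dots> \<le> ennreal (1 / (2 * pi)) * (ennreal (2 * pi) * ennreal (nsq cyl g))"
    using x_coeff_bessel[OF m] nn_integral_sqint[OF g2] by (intro mult_left_mono) auto
  also have "\<dots> = ennreal (nsq cyl g)"
    by (simp add: ennreal_mult'[symmetric])
  finally show ?thesis .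
qed

lemma trunc_fourier_eq:
  assumes "sqint cyl f"
  shows "trunc_fourier R f k = (\<lambda>\<xi>. 1 / (2 * pi) * ft (x_coeff (\<lambda>p. indicator {-R..R} (snd p) * f p) k) \<xi>)"
  unfolding trunc_fourier_def using integrable_x_coeff(2)[OF integrable_cyl_trunc[OF assms]] by simp

lemma trunc_measurable:
  assumes "sqint cyl f"
  shows "trunc_fourier R f k \<in> borel_measurable borel"
proof -
  have [measurable]: "f \<in> borel_measurable cyl" using assms by (rule sqint_measurable)
  have [measurable]: "ft (x_coeff (\<lambda>p. indicator {-R..R} (snd p) * f p) k) \<in> borel_measurable borel"
    by (intro ft_measurable x_coeff_measurable) measurable
  show ?thesis unfolding trunc_fourier_eq[OF assms] by measurable
qed

text \<open>This quantity dominates the squared distance of any two truncations at heights beyond \<open>R\<close>, also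
  after the Fourier transform (\<open>trunc_diff_le\<close>).\<close>

definition tail :: "(real \<times> real \<Rightarrow> real) \<Rightarrow> real \<Rightarrow> real" where
  "tail f R = nsq cyl (\<lambda>p. indicator {y. R < \<bar>y\<bar>} (snd p) * f p)"

lemma tail_tendsto:
  assumes f: "sqint cyl f"
  shows "(tail f \<longlongrightarrow> 0) at_top"
proof -
  have [measurable]: "f \<in> borel_measurable cyl" using f by (rule sqint_measurable)
  have "((\<lambda>R. LINT p|cyl. (norm (indicator {y. R < \<bar>y\<bar>} (snd p) * f p))\<^sup>2) \<longlongrightarrow> (LINT p|cyl. 0)) at_top"
  proof (rule integral_dominated_convergence_at_top[where w="\<lambda>p. (norm (f p))\<^sup>2"])
    show "integrable cyl (\<lambda>p. (norm (f p))\<^sup>2)" by (rule sqint_integrable[OF f])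
    show "\<forall>\<^sub>F R in at_top. AE p in cyl. norm ((norm (indicator {y. R < \<bar>y\<bar>} (snd p) * f p))\<^sup>2) \<le> (norm (f p))\<^sup>2"
      by (auto intro!: always_eventually split: split_indicator)
    show "AE p in cyl. ((\<lambda>R. (norm (indicator {y. R < \<bar>y\<bar>} (snd p) * f p))\<^sup>2) \<longlongrightarrow> 0) at_top"
    proof (rule AE_I2, rule tendsto_eventually)
      fix p :: "real \<times> real"
      show "\<forall>\<^sub>F R in at_top. (norm (indicator {y. R < \<bar>y\<bar>} (snd p) * f p))\<^sup>2 = 0"
        using eventually_ge_at_top[of "\<bar>snd p\<bar>"] by eventually_elim auto
    qed
  qed (measurable)
  moreover have "tail f = (\<lambda>R. LINT p|cyl. (norm (indicator {y. R < \<bar>y\<bar>} (snd p) * f p))\<^sup>2)"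
    by (rule ext) (simp only: tail_def nsq_eq)
  ultimately show ?thesis by simp
qed

lemma trunc_diff_le:
  assumes f: "sqint cyl f" and R: "r \<le> R" "r \<le> R'"
  shows "(\<integral>\<^sup>+k. \<integral>\<^sup>+\<xi>. ennreal ((norm (trunc_fourier R f k \<xi> - trunc_fourier R' f k \<xi>))\<^sup>2) \<partial>lborel \<partial>count_space UNIV)
    \<le> ennreal (tail f r)"
proof -
  have [measurable]: "f \<in> borel_measurable cyl" using f by (rule sqint_measurable)
  let ?d = "\<lambda>p. indicator {-R..R} (snd p) * f p - indicator {-R'..R'} (snd p) * f p"
  have di: "integrable cyl ?d" by (intro Bochner_Integration.integrable_diff integrable_cyl_trunc f)
  have t: "sqint cyl (\<lambda>p. indicator {y. r < \<bar>y\<bar>} (snd p) * f p)"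
    by (rule sqint_bound(1)[OF f, where B=1]) (measurable, auto split: split_indicator)
  have b: "norm (?d p) \<le> 1 * norm (indicator {y. r < \<bar>y\<bar>} (snd p) * f p)" for p
    using R by (auto split: split_indicator)
  have d: "sqint cyl ?d" "nsq cyl ?d \<le> 1\<^sup>2 * tail f r"
    unfolding tail_def by (rule sqint_bound[OF t _ b]; measurable)+
  have eq: "trunc_fourier R f k \<xi> - trunc_fourier R' f k \<xi> = 1 / (2 * pi) * ft (x_coeff ?d k) \<xi>" for k \<xi>
  proof -
    have i: "integrable cyl (\<lambda>p. (indicator {-S..S} (snd p) * f p) *\<^sub>R cis (- (of_int k * fst p + \<xi> * snd p)))" for S
    proof -
      have "integrable cyl (\<lambda>p. cis (- (of_int k * fst p + \<xi> * snd p)) * complex_of_real (indicator {-S..S} (snd p) * f p))"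
        using integrable_cyl_trunc[OF f, of S] by (intro integrable_cis_mult integrable_of_real) auto
      then show ?thesis by (simp add: scaleR_conv_of_real mult_ac)
    qed
    have "(LINT p|cyl. ?d p *\<^sub>R cis (- (of_int k * fst p + \<xi> * snd p))) =
      (LINT p|cyl. (indicator {-R..R} (snd p) * f p) *\<^sub>R cis (- (of_int k * fst p + \<xi> * snd p))) -
      (LINT p|cyl. (indicator {-R'..R'} (snd p) * f p) *\<^sub>R cis (- (of_int k * fst p + \<xi> * snd p)))"
      unfolding scaleR_diff_left by (rule Bochner_Integration.integral_diff[OF i i])
    then show ?thesis
      unfolding trunc_fourier_def integrable_x_coeff(2)[OF di, symmetric] by (simp add: right_diff_distrib)
  qed
  show ?thesis
    unfolding eq by (rule order_trans[OF ft_x_coeff_bessel[OF di d(1)] ennreal_leI]) (use d(2) in simp)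
qed

text \<open>Completeness of \<open>L\<^sup>2\<close>, by hand: along heights \<open>R n\<close> whose tails decay like \<open>4\<^sup>-\<^sup>n\<close> the squared increments are summable
  even with weights \<open>2\<^sup>n\<close>, so the truncated transforms converge almost everywhere. Fatou's lemma
  bounds the distance of their limit to any truncation by the tail.\<close>

lemma has_fourier_exists:
  assumes f: "sqint cyl f"
  shows "\<exists>g. has_fourier f g"
proof -
  note tm [measurable] = trunc_measurable[OF f]
  let ?T = "\<lambda>R k \<xi>. trunc_fourier R f k \<xi>"
  have "\<exists>R\<ge>real n. tail f R \<le> (1/4) ^ n" for n :: nat
  proof -
    have "\<forall>\<^sub>F R in at_top. tail f R < (1/4) ^ n"
      using order_tendstoD(2)[OF tail_tendsto[OF f], of "(1/4)^n"] by simp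
    then have "\<forall>\<^sub>F R in at_top. tail f R < (1/4) ^ n \<and> real n \<le> R"
      using eventually_ge_at_top by (rule eventually_conj)
    then show ?thesis using eventually_happens[of _ "at_top :: real filter"] by fastforce
  qed
  then obtain R0 where R0: "\<And>n. R0 n \<ge> real n" "\<And>n. tail f (R0 n) \<le> (1/4) ^ n" by metis
  define R where "R n = Max (R0 ` {..n})" for n :: nat
  have R_mono: "R n \<le> R (Suc n)" for n unfolding R_def by (intro Max_mono) auto
  have R_ge: "R0 n \<le> R n" for n unfolding R_def by (intro Max_ge) auto
  let ?d = "\<lambda>n k \<xi>. ?T (R (Suc n)) k \<xi> - ?T (R n) k \<xi>"
  let ?S = "\<lambda>k \<xi>. \<Sum>n. ennreal (2 ^ n * (norm (?d n k \<xi>))\<^sup>2)"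
  have dn: "(\<integral>\<^sup>+k. \<integral>\<^sup>+\<xi>. ennreal (2 ^ n * (norm (?d n k \<xi>))\<^sup>2) \<partial>lborel \<partial>count_space UNIV) \<le> ennreal ((1/2) ^ n)" for n
  proof -
    have "(\<integral>\<^sup>+k. \<integral>\<^sup>+\<xi>. ennreal (2 ^ n * (norm (?d n k \<xi>))\<^sup>2) \<partial>lborel \<partial>count_space UNIV) =
      ennreal (2 ^ n) * (\<integral>\<^sup>+k. \<integral>\<^sup>+\<xi>. ennreal ((norm (?d n k \<xi>))\<^sup>2) \<partial>lborel \<partial>count_space UNIV)"
      by (simp add: ennreal_mult' nn_integral_cmult)
    also have "\<dots> \<le> ennreal (2 ^ n) * ennreal (tail f (R0 n))"
      by (intro mult_left_mono trunc_diff_le f) (use R_mono[of n] R_ge[of n] in auto)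
    also have "\<dots> \<le> ennreal (2 ^ n) * ennreal ((1/4) ^ n)"
      by (intro mult_left_mono ennreal_leI R0) simp
    also have "\<dots> = ennreal ((1/2) ^ n)"
      by (simp add: ennreal_mult'[symmetric] power_mult_distrib[symmetric])
    finally show ?thesis .
  qed
  have AE: "AE \<xi> in lborel. ?S k \<xi> < \<infinity>" for k
  proof -
    have "(\<integral>\<^sup>+\<xi>. ?S k \<xi> \<partial>lborel) = (\<Sum>n. \<integral>\<^sup>+\<xi>. ennreal (2 ^ n * (norm (?d n k \<xi>))\<^sup>2) \<partial>lborel)"
      by (rule nn_integral_suminf) simp
    also have "\<dots> \<le> (\<Sum>n. ennreal ((1/2) ^ n))"
    proof (intro suminf_le summableI)
      fix n
      have "(\<integral>\<^sup>+\<xi>. ennreal (2 ^ n * (norm (?d n k \<xi>))\<^sup>2) \<partial>lborel) \<le>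
         (\<integral>\<^sup>+k. \<integral>\<^sup>+\<xi>. ennreal (2 ^ n * (norm (?d n k \<xi>))\<^sup>2) \<partial>lborel \<partial>count_space UNIV)"
        by (rule nn_integral_ge_point) simp
      also note dn
      finally show "(\<integral>\<^sup>+\<xi>. ennreal (2 ^ n * (norm (?d n k \<xi>))\<^sup>2) \<partial>lborel) \<le> ennreal ((1/2) ^ n)" .
    qed
    also have "\<dots> = ennreal (\<Sum>n. (1/2) ^ n)"
      by (intro suminf_ennreal2 summable_geometric) auto
    also have "\<dots> < \<infinity>" by simp
    finally have "(\<integral>\<^sup>+\<xi>. ?S k \<xi> \<partial>lborel) \<noteq> \<infinity>" by simp
    then have "AE \<xi> in lborel. ?S k \<xi> \<noteq> \<infinity>"
      by (rule nn_integral_PInf_AE[rotated]) simp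
    then show ?thesis by (simp add: less_top)
  qed
  define g where "g k \<xi> = lim (\<lambda>n. ?T (R n) k \<xi>)" for k \<xi>
  have [measurable]: "g k \<in> borel_measurable borel" for k
    unfolding g_def by measurable
  have conv: "(\<lambda>n. ?T (R n) k \<xi>) \<longlonglongrightarrow> g k \<xi>" if "?S k \<xi> < \<infinity>" for k \<xi>
  proof -
    have s1: "summable (\<lambda>n. 2 ^ n * (norm (?d n k \<xi>))\<^sup>2)"
      by (rule summable_suminf_not_top) (use that in auto)
    have s2: "summable (\<lambda>n. 2 ^ n * (norm (?d n k \<xi>))\<^sup>2 + (1/2 :: real) ^ n)"
      by (intro summable_add s1 summable_geometric) simp
    have "summable (\<lambda>n. ?d n k \<xi>)"
    proof (rule summable_comparison_test'[OF s2, of 0])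
      fix n
      let ?a = "norm (?d n k \<xi>)" and ?b = "(2::real) ^ n"
      \<comment> \<open>\<open>2a \<le> 2\<^sup>n a\<^sup>2 + 2\<^sup>-\<^sup>n\<close>\<close>
      have "0 \<le> (?b * ?a - 1)\<^sup>2" by simp
      then have "2 * ?b * ?a \<le> ?b\<^sup>2 * ?a\<^sup>2 + 1" by (simp add: power2_eq_square algebra_simps)
      moreover have "0 \<le> ?b * ?a" by simp
      moreover have "?b * (?b * ?a\<^sup>2 + (1/2) ^ n) = ?b\<^sup>2 * ?a\<^sup>2 + 1"
        by (simp add: power2_eq_square algebra_simps power_one_over)
      ultimately have "?b * ?a \<le> ?b * (?b * ?a\<^sup>2 + (1/2) ^ n)" by linarith
      then show "?a \<le> ?b * ?a\<^sup>2 + (1/2) ^ n" by simp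
    qed
    then have "convergent (\<lambda>n. ?T (R 0) k \<xi> + (\<Sum>i<n. ?d i k \<xi>))"
      by (intro convergent_add convergent_const) (simp add: summable_iff_convergent)
    moreover have "?T (R 0) k \<xi> + (\<Sum>i<n. ?d i k \<xi>) = ?T (R n) k \<xi>" for n
      using sum_lessThan_telescope[of "\<lambda>n. ?T (R n) k \<xi>" n] by simp
    ultimately have "convergent (\<lambda>n. ?T (R n) k \<xi>)" by simp
    then show ?thesis unfolding g_def by (rule convergent_LIMSEQ_iff[THEN iffD1])
  qed
  have bound: "(\<integral>\<^sup>+k. \<integral>\<^sup>+\<xi>. ennreal ((norm (?T r k \<xi> - g k \<xi>))\<^sup>2) \<partial>lborel \<partial>count_space UNIV) \<le> ennreal (tail f r)" for r
  proof -
    let ?D = "\<lambda>n k. \<integral>\<^sup>+\<xi>. ennreal ((norm (?T r k \<xi> - ?T (R n) k \<xi>))\<^sup>2) \<partial>lborel"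
    have "(\<integral>\<^sup>+\<xi>. ennreal ((norm (?T r k \<xi> - g k \<xi>))\<^sup>2) \<partial>lborel) \<le> liminf (\<lambda>n. ?D n k)" for k
    proof -
      have "AE \<xi> in lborel. ennreal ((norm (?T r k \<xi> - g k \<xi>))\<^sup>2) =
         liminf (\<lambda>n. ennreal ((norm (?T r k \<xi> - ?T (R n) k \<xi>))\<^sup>2))"
        using AE[of k]
        by eventually_elim (auto intro!: lim_imp_Liminf[symmetric] tendsto_intros conv)
      then have "(\<integral>\<^sup>+\<xi>. ennreal ((norm (?T r k \<xi> - g k \<xi>))\<^sup>2) \<partial>lborel) =
        (\<integral>\<^sup>+\<xi>. liminf (\<lambda>n. ennreal ((norm (?T r k \<xi> - ?T (R n) k \<xi>))\<^sup>2)) \<partial>lborel)"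
        by (rule nn_integral_cong_AE)
      also have "\<dots> \<le> liminf (\<lambda>n. ?D n k)"
        by (rule nn_integral_liminf) simp
      finally show ?thesis .
    qed
    then have "(\<integral>\<^sup>+k. \<integral>\<^sup>+\<xi>. ennreal ((norm (?T r k \<xi> - g k \<xi>))\<^sup>2) \<partial>lborel \<partial>count_space UNIV)
      \<le> (\<integral>\<^sup>+k. liminf (\<lambda>n. ?D n k) \<partial>count_space UNIV)"
      by (intro nn_integral_mono)
    also have "\<dots> \<le> liminf (\<lambda>n. \<integral>\<^sup>+k. ?D n k \<partial>count_space UNIV)"
      by (rule nn_integral_liminf) simp
    also have "\<dots> \<le> ennreal (tail f r)"
    proof (rule order_trans[OF Liminf_le_Limsup Limsup_bounded])
      have "(\<integral>\<^sup>+k. ?D n k \<partial>count_space UNIV) \<le> ennreal (tail f r)" if "n \<ge> nat \<lceil>r\<rceil>" for n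
        by (rule trunc_diff_le[OF f]) (use R_ge[of n] R0(1)[of n] that in linarith)+
      then show "\<forall>\<^sub>F n in sequentially. (\<integral>\<^sup>+k. ?D n k \<partial>count_space UNIV) \<le> ennreal (tail f r)"
        by (rule eventually_sequentiallyI)
    qed simp
    finally show ?thesis .
  qed
  have "has_fourier f g"
    unfolding has_fourier_def
  proof (intro conjI allI)
    have "((\<lambda>r. ennreal (tail f r)) \<longlongrightarrow> 0) at_top"
      using tendsto_ennrealI[OF tail_tendsto[OF f]] by simp
    then show "((\<lambda>R. \<integral>\<^sup>+ k. \<integral>\<^sup>+ \<xi>. ennreal ((cmod (trunc_fourier R f k \<xi> - g k \<xi>))\<^sup>2) \<partial>lborel
            \<partial>count_space UNIV) \<longlongrightarrow> 0) at_top"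
      by (rule tendsto_sandwich[OF _ _ tendsto_const, rotated 2]) (auto intro!: always_eventually bound)
  qed simp
  then show ?thesis by blast
qed

lemma has_fourier_fourier: "sqint cyl f \<Longrightarrow> has_fourier f (fourier f)"
  unfolding fourier_def using someI_ex[OF has_fourier_exists] .

lemma fourier_measurable: "sqint cyl f \<Longrightarrow> fourier f k \<in> borel_measurable borel"
  using has_fourier_fourier[of f] by (simp add: has_fourier_def)

lemma trunc_tendsto_fourier:
  assumes f: "sqint cyl f"
  shows "((\<lambda>R. \<integral>\<^sup>+ \<xi>. ennreal ((norm (trunc_fourier R f k \<xi> - fourier f k \<xi>))\<^sup>2) \<partial>lborel) \<longlongrightarrow> 0) at_top"
proof (rule tendsto_sandwich[OF _ _ tendsto_const])
  show "((\<lambda>R. \<integral>\<^sup>+ k. \<integral>\<^sup>+ \<xi>. ennreal ((norm (trunc_fourier R f k \<xi> - fourier f k \<xi>))\<^sup>2) \<partial>lborel \<partial>count_space UNIV) \<longlongrightarrow> 0) at_top"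
    using has_fourier_fourier[OF f] by (simp add: has_fourier_def)
qed (auto intro!: always_eventually nn_integral_ge_point[of _ _ "\<lambda>k. \<integral>\<^sup>+ \<xi>. ennreal ((norm (trunc_fourier R f k \<xi> - fourier f k \<xi>))\<^sup>2) \<partial>lborel" for R])

lemma sqint_trunc:
  assumes f: "sqint cyl f"
  shows "sqint lborel (trunc_fourier R f k)"
proof -
  have [measurable]: "f \<in> borel_measurable cyl" using f by (rule sqint_measurable)
  let ?g = "\<lambda>p. indicator {-R..R} (snd p) * f p"
  have g: "integrable cyl ?g" "sqint cyl ?g"
    by (rule integrable_cyl_trunc[OF f])
      (rule sqint_bound(1)[OF f, where B=1]; auto split: split_indicator)
  show ?thesis
  proof (rule sqintI_nn)
    show "trunc_fourier R f k \<in> borel_measurable lborel" using trunc_measurable[OF f] by simp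
    have "(\<integral>\<^sup>+\<xi>. ennreal ((norm (trunc_fourier R f k \<xi>))\<^sup>2) \<partial>lborel) \<le>
      (\<integral>\<^sup>+k. \<integral>\<^sup>+\<xi>. ennreal ((norm (trunc_fourier R f k \<xi>))\<^sup>2) \<partial>lborel \<partial>count_space UNIV)"
      by (rule nn_integral_ge_point) simp
    also have "\<dots> \<le> ennreal (nsq cyl ?g)"
      unfolding trunc_fourier_eq[OF f] by (rule ft_x_coeff_bessel[OF g])
    also have "\<dots> < \<infinity>" by simp
    finally show "(\<integral>\<^sup>+\<xi>. ennreal ((norm (trunc_fourier R f k \<xi>))\<^sup>2) \<partial>lborel) < \<infinity>" .
  qed
qed

lemma sqint_fourier:
  assumes f: "sqint cyl f"
  shows "sqint lborel (fourier f k)"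
proof -
  let ?D = "\<lambda>R \<xi>. trunc_fourier R f k \<xi> - fourier f k \<xi>"
  have "\<forall>\<^sub>F R in at_top. (\<integral>\<^sup>+ \<xi>. ennreal ((norm (?D R \<xi>))\<^sup>2) \<partial>lborel) < 1"
    using order_tendstoD(2)[OF trunc_tendsto_fourier[OF f], of 1 k] by simp
  then obtain R where R: "(\<integral>\<^sup>+ \<xi>. ennreal ((norm (?D R \<xi>))\<^sup>2) \<partial>lborel) < 1"
    using eventually_happens[of _ "at_top :: real filter"] by auto
  have "sqint lborel (?D R)"
  proof (rule sqintI_nn)
    show "?D R \<in> borel_measurable lborel"
      using trunc_measurable[OF f] fourier_measurable[OF f] by simp
    show "(\<integral>\<^sup>+ \<xi>. ennreal ((norm (?D R \<xi>))\<^sup>2) \<partial>lborel) < \<infinity>"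
      using R by (rule less_trans) simp
  qed
  from sqint_diff[OF sqint_trunc[OF f, of R k] this] show ?thesis by simp
qed

lemma nsq_trunc_tendsto:
  assumes f: "sqint cyl f"
  shows "((\<lambda>R. nsq lborel (\<lambda>\<xi>. trunc_fourier R f k \<xi> - fourier f k \<xi>)) \<longlongrightarrow> 0) at_top"
proof -
  have "((\<lambda>R. ennreal (nsq lborel (\<lambda>\<xi>. trunc_fourier R f k \<xi> - fourier f k \<xi>))) \<longlongrightarrow> ennreal 0) at_top"
    using trunc_tendsto_fourier[OF f, of k]
    by (simp add: nn_integral_sqint sqint_diff sqint_trunc sqint_fourier f)
  then show ?thesis by (subst (asm) tendsto_ennreal_iff) auto
qed

lemma nsq_trunc_le:
  assumes f: "sqint cyl f"
  shows "nsq lborel (trunc_fourier R f k) \<le> nsq cyl f"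
proof -
  have [measurable]: "f \<in> borel_measurable cyl" using f by (rule sqint_measurable)
  let ?g = "\<lambda>p. indicator {-R..R} (snd p) * f p"
  have g: "sqint cyl ?g" "nsq cyl ?g \<le> 1\<^sup>2 * nsq cyl f"
    by (rule sqint_bound[OF f, where B=1]; auto split: split_indicator)+
  have "ennreal (nsq lborel (trunc_fourier R f k)) = (\<integral>\<^sup>+\<xi>. ennreal ((norm (trunc_fourier R f k \<xi>))\<^sup>2) \<partial>lborel)"
    by (rule nn_integral_sqint[OF sqint_trunc[OF f], symmetric])
  also have "\<dots> \<le> (\<integral>\<^sup>+k. \<integral>\<^sup>+\<xi>. ennreal ((norm (trunc_fourier R f k \<xi>))\<^sup>2) \<partial>lborel \<partial>count_space UNIV)"
    by (rule nn_integral_ge_point) simp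
  also have "\<dots> \<le> ennreal (nsq cyl ?g)"
    unfolding trunc_fourier_eq[OF f] by (rule ft_x_coeff_bessel[OF integrable_cyl_trunc[OF f] g(1)])
  finally show ?thesis using g(2) by simp
qed

text \<open>The factor \<open>2\<close> comes from the triangle inequality in squared form, applied to the difference from a truncation.\<close>

lemma nsq_fourier_le:
  assumes f: "sqint cyl f"
  shows "nsq lborel (fourier f k) \<le> 2 * nsq cyl f"
proof (rule tendsto_lowerbound)
  let ?D = "\<lambda>R \<xi>. trunc_fourier R f k \<xi> - fourier f k \<xi>"
  have "((\<lambda>R. 2 * nsq lborel (?D R) + 2 * nsq cyl f) \<longlongrightarrow> 2 * 0 + 2 * nsq cyl f) at_top"
    by (intro tendsto_intros nsq_trunc_tendsto f)
  then show "((\<lambda>R. 2 * nsq lborel (?D R) + 2 * nsq cyl f) \<longlongrightarrow> 2 * nsq cyl f) at_top" by simp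
  have "nsq lborel (fourier f k) \<le> 2 * nsq lborel (?D R) + 2 * nsq cyl f" for R
  proof -
    have D: "sqint lborel (?D R)" by (intro sqint_diff sqint_trunc sqint_fourier f)
    have "nsq lborel (\<lambda>\<xi>. - ?D R \<xi> + trunc_fourier R f k \<xi>) \<le> 2 * nsq lborel (\<lambda>\<xi>. - ?D R \<xi>) + 2 * nsq lborel (trunc_fourier R f k)"
      by (intro nsq_add_le sqint_uminus D sqint_trunc f)
    also have "nsq lborel (\<lambda>\<xi>. - ?D R \<xi>) = nsq lborel (?D R)"
      by (simp only: ip_def inner_minus_left inner_minus_right minus_minus)
    finally show ?thesis using nsq_trunc_le[OF f, of R k] by simp
  qed
  then show "\<forall>\<^sub>F R in at_top. nsq lborel (fourier f k) \<le> 2 * nsq lborel (?D R) + 2 * nsq cyl f" by simp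
qed simp

section \<open>Smooth cutoffs and Fourier modes as test functions\<close>

text \<open>Existence of \<open>n\<close> successive derivatives, phrased so that closure properties follow by induction on \<open>n\<close>.\<close>

primrec times_differentiable :: "nat \<Rightarrow> (real \<Rightarrow> complex) \<Rightarrow> bool" where
  "times_differentiable 0 f \<longleftrightarrow> True"
| "times_differentiable (Suc n) f \<longleftrightarrow> (\<exists>f'. (\<forall>y. (f has_vector_derivative f' y) (at y)) \<and> times_differentiable n f')"

definition smooth :: "(real \<Rightarrow> complex) \<Rightarrow> bool" where
  "smooth f \<longleftrightarrow> (\<forall>n. times_differentiable n f)"

lemma times_differentiable_Suc_imp: "times_differentiable (Suc n) f \<Longrightarrow> times_differentiable n f"
  by (induction n arbitrary: f) (simp, metis times_differentiable.simps(2))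

lemma times_differentiable_SucI: "(\<And>y. (f has_vector_derivative f' y) (at y)) \<Longrightarrow> times_differentiable n f' \<Longrightarrow> times_differentiable (Suc n) f"
  by auto

lemma times_differentiable_const: "times_differentiable n (\<lambda>_. c)"
  by (induction n arbitrary: c) (auto intro!: exI[of _ "\<lambda>_. 0"] has_vector_derivative_const)

lemma times_differentiable_add: "times_differentiable n f \<Longrightarrow> times_differentiable n g \<Longrightarrow> times_differentiable n (\<lambda>y. f y + g y)"
proof (induction n arbitrary: f g)
  case (Suc n)
  then obtain f' g' where "\<And>y. (f has_vector_derivative f' y) (at y)" "times_differentiable n f'"
    "\<And>y. (g has_vector_derivative g' y) (at y)" "times_differentiable n g'" by auto
  with Suc.IH[of f' g'] show ?case
    by (auto intro!: exI[of _ "\<lambda>y. f' y + g' y"] has_vector_derivative_add)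
qed simp

lemma times_differentiable_mult: "times_differentiable n f \<Longrightarrow> times_differentiable n g \<Longrightarrow> times_differentiable n (\<lambda>y. f y * g y)"
proof (induction n arbitrary: f g)
  case (Suc n)
  then obtain f' g' where d: "\<And>y. (f has_vector_derivative f' y) (at y)" "times_differentiable n f'"
    "\<And>y. (g has_vector_derivative g' y) (at y)" "times_differentiable n g'" by auto
  have "times_differentiable n f" "times_differentiable n g" using Suc.prems by (auto intro: times_differentiable_Suc_imp simp del: times_differentiable.simps)
  with d Suc.IH have "times_differentiable n (\<lambda>y. f y * g' y + f' y * g y)" by (intro times_differentiable_add) auto
  with d show ?case
    by (auto intro!: exI[of _ "\<lambda>y. f y * g' y + f' y * g y"] has_vector_derivative_mult)
qed simp

lemma times_differentiable_affine: "times_differentiable n f \<Longrightarrow> times_differentiable n (\<lambda>y. f (a * y + b))"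
proof (induction n arbitrary: f)
  case (Suc n)
  then obtain f' where d: "\<And>y. (f has_vector_derivative f' y) (at y)" "times_differentiable n f'" by auto
  have "((\<lambda>y. f (a * y + b)) has_vector_derivative (of_real a * f' (a * y + b))) (at y)" for y
  proof -
    have "((\<lambda>y. a * y + b) has_vector_derivative a) (at y)"
      by (auto intro!: derivative_eq_intros)
    from vector_diff_chain_at[OF this d(1)] show ?thesis
      by (simp add: o_def scaleR_conv_of_real)
  qed
  moreover have "times_differentiable n (\<lambda>y. of_real a * f' (a * y + b))"
    by (intro times_differentiable_mult times_differentiable_const Suc.IH d)
  ultimately show ?case by (rule times_differentiable_SucI)
qed simp

lemma smooth_const: "smooth (\<lambda>_. c)" by (simp add: smooth_def times_differentiable_const)
lemma smooth_add: "smooth f \<Longrightarrow> smooth g \<Longrightarrow> smooth (\<lambda>y. f y + g y)" by (simp add: smooth_def times_differentiable_add)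
lemma smooth_mult: "smooth f \<Longrightarrow> smooth g \<Longrightarrow> smooth (\<lambda>y. f y * g y)" by (simp add: smooth_def times_differentiable_mult)
lemma smooth_affine: "smooth f \<Longrightarrow> smooth (\<lambda>y. f (a * y + b))" by (simp add: smooth_def times_differentiable_affine)

lemma smooth_deriv:
  assumes "smooth f" "\<And>y. (f has_vector_derivative f' y) (at y)"
  shows "smooth f'"
  unfolding smooth_def
proof
  fix n
  from assms(1) have "times_differentiable (Suc n) f" by (simp add: smooth_def del: times_differentiable.simps)
  then obtain g where g: "\<And>y. (f has_vector_derivative g y) (at y)" "times_differentiable n g" by auto
  have "g = f'" using vector_derivative_unique_at[OF g(1) assms(2)] by auto
  with g show "times_differentiable n f'" by simp
qed

lemma smooth_has_deriv:
  assumes "smooth f"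
  obtains f' where "\<And>y. (f has_vector_derivative f' y) (at y)" "smooth f'"
proof -
  have "times_differentiable (Suc 0) f" using assms by (simp add: smooth_def del: times_differentiable.simps)
  then obtain f' where f': "\<And>y. (f has_vector_derivative f' y) (at y)" by auto
  show ?thesis using that[OF f' smooth_deriv[OF assms f']] .
qed

text \<open>Functions of the form \<open>p(1/x) exp(-1/x)\<close>, extended by zero. The polynomial makes the class closed under
  differentiation, which gives smoothness at the origin by induction.\<close>

definition flat :: "real poly \<Rightarrow> real \<Rightarrow> real" where
  "flat p x = (if x > 0 then poly p (1 / x) * exp (- 1 / x) else 0)"

lemma poly_exp_tendsto: "((\<lambda>u. poly p u * exp (- u)) \<longlongrightarrow> (0::real)) at_top"
proof -
  have "((\<lambda>u. \<Sum>i\<le>degree p. coeff p i * (u ^ i / exp u)) \<longlongrightarrow> (\<Sum>i\<le>degree p. coeff p i * 0)) at_top"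
    by (intro tendsto_sum tendsto_mult_left tendsto_power_div_exp_0)
  then show ?thesis
    by (simp add: poly_altdef sum_distrib_right exp_minus divide_inverse mult.assoc)
qed

lemma flat_tendsto: "(flat p \<longlongrightarrow> 0) (at 0)"
proof -
  have "((\<lambda>x. poly p (inverse x) * exp (- inverse x)) \<longlongrightarrow> (0::real)) (at_right 0)"
    by (rule filterlim_compose[OF poly_exp_tendsto filterlim_inverse_at_top_right])
  then have "(flat p \<longlongrightarrow> 0) (at_right 0)"
    by (rule Lim_transform_eventually)
      (auto simp: eventually_at_right_less flat_def inverse_eq_divide intro!: eventually_at_right_less[THEN eventually_mono])
  moreover have "(flat p \<longlongrightarrow> 0) (at_left 0)"
    by (rule tendsto_eventually) (auto simp: flat_def eventually_at_filter)
  ultimately show ?thesis by (simp add: filterlim_split_at)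
qed

lemma flat_deriv: "(flat p has_real_derivative flat (monom 1 2 * (p - pderiv p)) x) (at x)"
proof -
  consider "x > 0" | "x < 0" | "x = 0" by linarith
  then show ?thesis
  proof cases
    case 1
    have "((\<lambda>x. poly p (1 / x) * exp (- 1 / x)) has_real_derivative
       (poly (pderiv p) (1 / x) * (- 1 / x\<^sup>2)) * exp (- 1 / x) + poly p (1 / x) * (exp (- 1 / x) * (1 / x\<^sup>2))) (at x)"
      using 1 by (auto intro!: derivative_eq_intros DERIV_chain2[OF poly_DERIV] simp: power2_eq_square)
    also have "(poly (pderiv p) (1 / x) * (- 1 / x\<^sup>2)) * exp (- 1 / x) + poly p (1 / x) * (exp (- 1 / x) * (1 / x\<^sup>2))
       = flat (monom 1 2 * (p - pderiv p)) x"
      using 1 by (simp add: flat_def poly_monom field_simps power2_eq_square)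
    finally show ?thesis
      by (rule has_field_derivative_transform_within_open[of _ _ _ "{0<..}"]) (use 1 in \<open>auto simp: flat_def\<close>)
  next
    case 2
    have "((\<lambda>x. 0) has_real_derivative 0) (at x)" by simp
    then have "(flat p has_real_derivative 0) (at x)"
      by (rule has_field_derivative_transform_within_open[of _ _ _ "{..<0}"]) (use 2 in \<open>auto simp: flat_def\<close>)
    then show ?thesis using 2 by (simp add: flat_def)
  next
    case 3
    have "(\<lambda>y. (flat p y - flat p 0) / (y - 0)) = flat (pCons 0 p)"
      by (auto simp: flat_def fun_eq_iff)
    then show ?thesis
      using flat_tendsto[of "pCons 0 p"] 3 unfolding has_field_derivative_iff by (simp add: flat_def)
  qed
qed

lemma smooth_flat: "smooth (\<lambda>x. of_real (flat p x))"
  unfolding smooth_def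
proof
  fix n
  show "times_differentiable n (\<lambda>x. of_real (flat p x))"
  proof (induction n arbitrary: p)
    case (Suc n)
    have "((\<lambda>x. complex_of_real (flat p x)) has_vector_derivative of_real (flat (monom 1 2 * (p - pderiv p)) x)) (at x)" for x
      using flat_deriv[of p x] by (intro has_vector_derivative_of_real) (simp add: has_real_derivative_iff_has_vector_derivative)
    then show ?case using Suc.IH[of "monom 1 2 * (p - pderiv p)"] by (rule times_differentiable_SucI)
  qed simp
qed

text \<open>The factor \<open>exp 2\<close> normalises the value at the origin to \<open>1\<close>; hence the rescaled functions
  \<open>y \<mapsto> bump (y / n)\<close> tend to \<open>1\<close>.\<close>

definition bump :: "real \<Rightarrow> complex" where
  "bump y = of_real (exp 2) * (of_real (flat 1 (1 - y)) * of_real (flat 1 (1 + y)))"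

lemma smooth_bump: "smooth bump"
proof -
  have "smooth (\<lambda>y. of_real (exp 2) * (of_real (flat 1 (- 1 * y + 1)) * of_real (flat 1 (1 * y + 1))))"
    by (intro smooth_mult smooth_const smooth_affine[of "\<lambda>y. of_real (flat 1 y)"] smooth_flat)
  then show ?thesis by (simp add: bump_def[abs_def] add.commute)
qed

lemma bump_0: "bump 0 = 1"
  by (simp add: bump_def flat_def flip: of_real_mult exp_add)

lemma bump_eq_0: "1 \<le> \<bar>y\<bar> \<Longrightarrow> bump y = 0"
  by (auto simp: bump_def flat_def)

lemma smooth_continuous: "smooth f \<Longrightarrow> continuous_on S f"
  by (metis smooth_has_deriv has_vector_derivative_continuous continuous_at_imp_continuous_on)

lemma deriv_eq_0_outside:
  assumes "\<And>y. (f has_vector_derivative f' y) (at y)" "\<And>y. R < \<bar>y\<bar> \<Longrightarrow> f y = 0" "R < \<bar>y\<bar>"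
  shows "f' y = (0::complex)"
proof -
  have "((\<lambda>y. 0) has_vector_derivative 0) (at y)" by simp
  then have "(f has_vector_derivative 0) (at y)"
    by (rule has_vector_derivative_transform_within_open[of _ _ _ "{y. R < \<bar>y\<bar>}"])
      (use assms in \<open>auto intro!: open_Collect_less continuous_intros\<close>)
  with assms(1)[of y] show ?thesis by (rule vector_derivative_unique_at)
qed

lemma bounded_compact_support:
  assumes "continuous_on UNIV f" "\<And>y. R < \<bar>y\<bar> \<Longrightarrow> f y = 0"
  obtains B where "\<And>y::real. norm (f y :: complex) \<le> B"
proof -
  have "bounded (f ` {-R..R})"
    by (intro compact_imp_bounded compact_continuous_image continuous_on_subset[OF assms(1)]) auto
  then obtain B where B: "\<And>y. y \<in> {-R..R} \<Longrightarrow> norm (f y) \<le> B" unfolding bounded_iff by blast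
  have "norm (f y) \<le> max B 0" for y
    using B[of y] assms(2)[of y] by (cases "\<bar>y\<bar> \<le> R") (auto simp: abs_le_iff)
  then show ?thesis using that by blast
qed

text \<open>Real parts of complex waves: \<open>\<partial>\<^sub>x\<close> and \<open>\<partial>\<^sub>y\<close> act on the complex profile \<open>c\<close> as multiplication
  by \<open>-\<i>k\<close> and as differentiation. The sign of the exponent is the one of the Fourier transform, so that pairing with
  a mode reads off the coefficient at \<open>+k\<close>.\<close>

definition mode :: "int \<Rightarrow> (real \<Rightarrow> complex) \<Rightarrow> real \<times> real \<Rightarrow> real" where
  "mode k c p = Re (cis (- (of_int k * fst p)) * c (snd p))"

lemma mode_add: "mode k (\<lambda>y. a y + b y) p = mode k a p + mode k b p"
  by (simp add: mode_def algebra_simps)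

lemma mode_diff: "mode k (\<lambda>y. a y - b y) p = mode k a p - mode k b p"
  by (simp add: mode_def algebra_simps)

lemma mode_real: "mode k (\<lambda>y. of_real r * a y) p = r * mode k a p"
  by (simp add: mode_def algebra_simps)

lemma pdx_mode: "pdx (mode k c) = mode k (\<lambda>y. - \<i> * of_int k * c y)"
proof (intro ext, clarify)
  fix x y
  have "((\<lambda>s. cis (- of_int k * s) * c y) has_vector_derivative (\<i> * of_real (- of_int k) * cis (- of_int k * x)) * c y) (at x)"
    by (intro has_vector_derivative_mult_left has_vector_derivative_cis)
  then have "((\<lambda>s. Re (cis (- of_int k * s) * c y)) has_vector_derivative Re ((\<i> * of_real (- of_int k) * cis (- of_int k * x)) * c y)) (at x)"
    by (rule bounded_linear.has_vector_derivative[OF bounded_linear_Re])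
  then have "((\<lambda>s. mode k c (s, y)) has_real_derivative Re ((\<i> * of_real (- of_int k) * cis (- of_int k * x)) * c y)) (at x)"
    by (simp add: mode_def has_real_derivative_iff_has_vector_derivative)
  then have "pdx (mode k c) (x, y) = Re ((\<i> * of_real (- of_int k) * cis (- of_int k * x)) * c y)"
    by (simp add: pdx_def DERIV_imp_deriv)
  also have "\<dots> = mode k (\<lambda>y. - \<i> * of_int k * c y) (x, y)"
    by (simp add: mode_def mult_ac)
  finally show "pdx (mode k c) (x, y) = mode k (\<lambda>y. - \<i> * of_int k * c y) (x, y)" .
qed

lemma pdy_mode:
  assumes "\<And>y. (c has_vector_derivative c' y) (at y)"
  shows "pdy (mode k c) = mode k c'"
proof (intro ext, clarify)
  fix x y
  have "((\<lambda>s. cis (- (of_int k * x)) * c s) has_vector_derivative cis (- (of_int k * x)) * c' y) (at y)"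
    by (intro has_vector_derivative_mult_right assms)
  then have "((\<lambda>s. Re (cis (- (of_int k * x)) * c s)) has_vector_derivative Re (cis (- (of_int k * x)) * c' y)) (at y)"
    by (rule bounded_linear.has_vector_derivative[OF bounded_linear_Re])
  then have "((\<lambda>s. mode k c (x, s)) has_real_derivative mode k c' (x, y)) (at y)"
    by (simp add: mode_def has_real_derivative_iff_has_vector_derivative)
  then show "pdy (mode k c) (x, y) = mode k c' (x, y)"
    by (simp add: pdy_def DERIV_imp_deriv)
qed

lemma mode_differentiable:
  assumes "smooth c"
  shows "mode k c differentiable (at p)"
proof -
  obtain c' where c': "\<And>y. (c has_vector_derivative c' y) (at y)"
    using smooth_has_deriv[OF assms] by blast
  have 1: "(\<lambda>p. cis (- of_int k * fst p)) differentiable (at p)"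
    using has_derivative_compose[OF has_derivative_fst[OF has_derivative_ident]
      has_vector_derivative_cis[of "- of_int k" "fst p" UNIV, unfolded has_vector_derivative_def]]
    by (auto simp: differentiable_def)
  have 2: "(\<lambda>p. c (snd p)) differentiable (at p)"
    using has_derivative_compose[OF has_derivative_snd[OF has_derivative_ident]
      c'[of "snd p", unfolded has_vector_derivative_def]]
    by (auto simp: differentiable_def)
  have "(\<lambda>p. Re (cis (- of_int k * fst p) * c (snd p))) differentiable (at p)"
    using bounded_linear.has_derivative[OF bounded_linear_Re] differentiable_mult[OF 1 2]
    unfolding differentiable_def by blast
  then show ?thesis by (simp add: mode_def[abs_def])
qed

definition smooth_compact :: "(real \<Rightarrow> complex) \<Rightarrow> bool" where
  "smooth_compact c \<longleftrightarrow> smooth c \<and> (\<exists>R. \<forall>y. R < \<bar>y\<bar> \<longrightarrow> c y = 0)"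

lemma test_fun_mode:
  assumes "smooth_compact c"
  shows "test_fun (mode k c)"
proof -
  from assms obtain R where c: "smooth c" and R: "\<And>y. R < \<bar>y\<bar> \<Longrightarrow> c y = 0" by (auto simp: smooth_compact_def)
  have y: "\<exists>d. smooth d \<and> (pdy ^^ j) (mode k c) = mode k d" for j
  proof (induction j)
    case (Suc j)
    then obtain d where d: "smooth d" "(pdy ^^ j) (mode k c) = mode k d" by blast
    obtain d' where d': "\<And>y. (d has_vector_derivative d' y) (at y)" "smooth d'"
      using smooth_has_deriv[OF d(1)] by blast
    have "(pdy ^^ Suc j) (mode k c) = mode k d'" using d(2) pdy_mode[OF d'(1)] by simp
    with d' show ?case by blast
  qed (use c in auto)
  have x: "\<exists>e. smooth e \<and> (pdx ^^ i) (mode k d) = mode k e" if "smooth d" for i d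
  proof (induction i)
    case (Suc i)
    then obtain e where e: "smooth e" "(pdx ^^ i) (mode k d) = mode k e" by blast
    have "(pdx ^^ Suc i) (mode k d) = mode k (\<lambda>y. - \<i> * of_int k * e y)" using e(2) pdx_mode by simp
    moreover have "smooth (\<lambda>y. - \<i> * of_int k * e y)" by (intro smooth_mult smooth_const e)
    ultimately show ?case by blast
  qed (use that in auto)
  show ?thesis
    unfolding test_fun_def
  proof (intro conjI allI)
    fix i j p
    show "(pdx ^^ i) ((pdy ^^ j) (mode k c)) differentiable at p"
      using x y mode_differentiable by metis
  next
    fix x y
    have "cis (- (of_int k * (x + 2 * pi))) = cis (- (of_int k * x)) * cis (2 * pi * of_int (- k))"
      by (simp add: cis_mult algebra_simps)
    also have "\<dots> = cis (- (of_int k * x))"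
      by (subst cis_multiple_2pi) auto
    finally show "mode k c (x + 2 * pi, y) = mode k c (x, y)" by (simp add: mode_def)
  next
    show "\<exists>R. \<forall>x y. R < \<bar>y\<bar> \<longrightarrow> mode k c (x, y) = 0"
      using R by (intro exI[of _ R]) (simp add: mode_def)
  qed
qed

lemma smooth_compact_deriv:
  assumes "smooth_compact c" "\<And>y. (c has_vector_derivative c' y) (at y)"
  shows "smooth_compact c'"
  using assms smooth_deriv deriv_eq_0_outside[OF assms(2)] unfolding smooth_compact_def by metis

lemma smooth_compact_mult: "smooth a \<Longrightarrow> smooth_compact c \<Longrightarrow> smooth_compact (\<lambda>y. a y * c y)"
  unfolding smooth_compact_def using smooth_mult by fastforce

lemma smooth_compact_scale: "smooth_compact c \<Longrightarrow> smooth_compact (\<lambda>y. a * c y)"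
  by (rule smooth_compact_mult[OF smooth_const])

lemma smooth_compact_add:
  assumes "smooth_compact c" "smooth_compact d"
  shows "smooth_compact (\<lambda>y. c y + d y)"
proof -
  from assms obtain R R' where "\<And>y. R < \<bar>y\<bar> \<Longrightarrow> c y = 0" "\<And>y. R' < \<bar>y\<bar> \<Longrightarrow> d y = 0"
    unfolding smooth_compact_def by blast
  then have "\<forall>y. max R R' < \<bar>y\<bar> \<longrightarrow> c y + d y = 0" by simp
  then show ?thesis using smooth_add assms unfolding smooth_compact_def by blast
qed

lemma shear_mode:
  assumes c: "\<And>y. (c has_vector_derivative c1 y) (at y)" "\<And>y. (c1 has_vector_derivative c2 y) (at y)"
  shows "shear_dy t (shear_dy t (mode k c)) =
     mode k (\<lambda>y. c2 y + 2 * \<i> * of_real t * of_int k * c1 y - of_real (t\<^sup>2 * (of_int k)\<^sup>2) * c y)"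
    and "shear_laplacian t (mode k c) =
     mode k (\<lambda>y. c2 y + 2 * \<i> * of_real t * of_int k * c1 y - of_real (t\<^sup>2 * (of_int k)\<^sup>2) * c y - of_real ((of_int k)\<^sup>2) * c y)"
proof -
  let ?c = "\<lambda>y. c1 y + \<i> * of_real t * of_int k * c y"
  have s: "shear_dy t (mode k d) = mode k (\<lambda>y. d1 y + \<i> * of_real t * of_int k * d y)"
    if "\<And>y. (d has_vector_derivative d1 y) (at y)" for d d1
    unfolding shear_dy_def pdx_mode pdy_mode[OF that]
    by (rule ext) (simp add: mode_def algebra_simps)
  have d: "(?c has_vector_derivative (c2 y + \<i> * of_real t * of_int k * c1 y)) (at y)" for y
    by (intro has_vector_derivative_add has_vector_derivative_mult_right c)
  have e: "(c2 y + \<i> * of_real t * of_int k * c1 y) + \<i> * of_real t * of_int k * ?c y =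
     c2 y + 2 * \<i> * of_real t * of_int k * c1 y - of_real (t\<^sup>2 * (of_int k)\<^sup>2) * c y" for y
    by (simp add: algebra_simps power2_eq_square)
  show 1: "shear_dy t (shear_dy t (mode k c)) =
     mode k (\<lambda>y. c2 y + 2 * \<i> * of_real t * of_int k * c1 y - of_real (t\<^sup>2 * (of_int k)\<^sup>2) * c y)"
    unfolding s[OF c(1)] s[OF d] by (simp only: e)
  show "shear_laplacian t (mode k c) =
     mode k (\<lambda>y. c2 y + 2 * \<i> * of_real t * of_int k * c1 y - of_real (t\<^sup>2 * (of_int k)\<^sup>2) * c y - of_real ((of_int k)\<^sup>2) * c y)"
    unfolding shear_laplacian_def 1 pdx_mode
    by (rule ext) (simp add: mode_def algebra_simps power2_eq_square)
qed

lemma sqint_mode: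
  assumes "sqint lborel c"
  shows "sqint cyl (mode k c)" "nsq cyl (mode k c) \<le> 2 * pi * nsq lborel c"
proof -
  have [measurable]: "c \<in> borel_measurable borel" using sqint_measurable[OF assms] by simp
  have [measurable]: "mode k c \<in> borel_measurable cyl" unfolding mode_def[abs_def] by measurable
  have "(\<integral>\<^sup>+p. ennreal ((norm (mode k c p))\<^sup>2) \<partial>cyl) \<le> (\<integral>\<^sup>+p. ennreal ((norm (c (snd p)))\<^sup>2) \<partial>cyl)"
  proof (intro nn_integral_mono ennreal_leI power_mono)
    fix p
    have "norm (mode k c p) \<le> norm (cis (- (of_int k * fst p)) * c (snd p))"
      unfolding mode_def real_norm_def by (rule abs_Re_le_cmod)
    then show "norm (mode k c p) \<le> norm (c (snd p))" by (simp add: norm_mult)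
  qed simp
  also have "\<dots> = (\<integral>\<^sup>+y. (\<integral>\<^sup>+x. ennreal ((norm (c (snd (x, y))))\<^sup>2) \<partial>circle) \<partial>lborel)"
    unfolding cyl_eq by (rule cyl.nn_integral_snd[symmetric]) measurable
  also have "\<dots> = (\<integral>\<^sup>+y. ennreal ((norm (c y))\<^sup>2) * ennreal (2 * pi) \<partial>lborel)"
    using emeasure_circle by simp
  also have "\<dots> = ennreal (nsq lborel c) * ennreal (2 * pi)"
    by (subst nn_integral_multc) (simp_all add: nn_integral_sqint[OF assms])
  finally have le: "(\<integral>\<^sup>+p. ennreal ((norm (mode k c p))\<^sup>2) \<partial>cyl) \<le> ennreal (2 * pi * nsq lborel c)"
    by (simp add: ennreal_mult'[symmetric] mult_ac)
  show s: "sqint cyl (mode k c)"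
    by (rule sqintI_nn) (measurable, rule le_less_trans[OF le], simp)
  show "nsq cyl (mode k c) \<le> 2 * pi * nsq lborel c"
    using le unfolding nn_integral_sqint[OF s] by (simp add: ennreal_le_iff)
qed

lemma sqint_smooth_compact:
  assumes "smooth_compact c"
  shows "sqint lborel c"
proof -
  from assms obtain R where c: "smooth c" and R: "\<And>y. R < \<bar>y\<bar> \<Longrightarrow> c y = 0" by (auto simp: smooth_compact_def)
  have cont: "continuous_on UNIV c" by (rule smooth_continuous[OF c])
  obtain B where B: "\<And>y. norm (c y) \<le> B" using bounded_compact_support[OF cont R] by blast
  have [measurable]: "c \<in> borel_measurable borel" by (rule borel_measurable_continuous_onI[OF cont])
  have "sqint lborel (\<lambda>y. indicator {-R..R} y :: real)"
  proof -
    have "(\<lambda>y. (norm (indicator {-R..R} y :: real))\<^sup>2) = indicator {-R..R}"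
      by (auto split: split_indicator)
    moreover have "integrable lborel (indicator {-R..R} :: real \<Rightarrow> real)"
      by (intro integrable_real_indicator) (auto simp: emeasure_lborel_Icc_eq)
    ultimately show ?thesis by (simp add: sqint_def)
  qed
  then show ?thesis
  proof (rule sqint_bound(1)[where B=B])
    show "norm (c y) \<le> B * norm (indicator {-R..R} y :: real)" for y
      using B[of y] R[of y] by (auto split: split_indicator simp: abs_le_iff not_le)
  qed simp
qed

section \<open>Parseval's identity and removal of the cutoff\<close>

text \<open>These are the profiles on the frequency side. The support condition makes polynomial multipliers bounded and the transform
  smooth.\<close>

definition compact_L2 :: "(real \<Rightarrow> complex) \<Rightarrow> bool" where
  "compact_L2 h \<longleftrightarrow> sqint lborel h \<and> (\<exists>L. \<forall>\<xi>. L < \<bar>\<xi>\<bar> \<longrightarrow> h \<xi> = 0)"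

lemma compact_L2_sqint: "compact_L2 h \<Longrightarrow> sqint lborel h"
  by (simp add: compact_L2_def)

lemma compact_L2_mult:
  assumes h: "compact_L2 h" and a: "continuous_on UNIV a"
  shows "compact_L2 (\<lambda>\<xi>. a \<xi> * h \<xi>)"
proof -
  from h obtain L where s: "sqint lborel h" and L: "\<And>\<xi>. L < \<bar>\<xi>\<bar> \<Longrightarrow> h \<xi> = 0"
    by (auto simp: compact_L2_def)
  have [measurable]: "h \<in> borel_measurable borel" using sqint_measurable[OF s] by simp
  have [measurable]: "a \<in> borel_measurable borel" by (rule borel_measurable_continuous_onI[OF a])
  have "bounded (a ` {-L..L})"
    by (intro compact_imp_bounded compact_continuous_image continuous_on_subset[OF a]) auto
  then obtain B where B: "\<And>y. y \<in> {-L..L} \<Longrightarrow> norm (a y) \<le> B" unfolding bounded_iff by blast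
  have "sqint lborel (\<lambda>\<xi>. a \<xi> * h \<xi>)"
  proof (rule sqint_bound(1)[OF s, where B=B])
    show "norm (a \<xi> * h \<xi>) \<le> B * norm (h \<xi>)" for \<xi>
      using B[of \<xi>] L[of \<xi>] by (cases "\<bar>\<xi>\<bar> \<le> L") (auto simp: norm_mult abs_le_iff intro!: mult_right_mono)
  qed simp
  with L show ?thesis unfolding compact_L2_def by (metis mult_zero_right)
qed

lemma compact_L2_add:
  assumes "compact_L2 g" "compact_L2 h"
  shows "compact_L2 (\<lambda>\<xi>. g \<xi> + h \<xi>)"
proof -
  from assms obtain R R' where "\<And>y. R < \<bar>y\<bar> \<Longrightarrow> g y = 0" "\<And>y. R' < \<bar>y\<bar> \<Longrightarrow> h y = 0"
    unfolding compact_L2_def by blast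
  then have "\<forall>y. max R R' < \<bar>y\<bar> \<longrightarrow> g y + h y = 0" by simp
  then show ?thesis using sqint_add assms unfolding compact_L2_def by blast
qed

lemma compact_L2_integrable:
  assumes "compact_L2 h"
  shows "integrable lborel h"
proof -
  from assms obtain L where s: "sqint lborel h" and L: "\<And>\<xi>. L < \<bar>\<xi>\<bar> \<Longrightarrow> h \<xi> = 0"
    by (auto simp: compact_L2_def)
  show ?thesis
  proof (rule Bochner_Integration.integrable_bound)
    show "integrable lborel (\<lambda>\<xi>. indicator {-L..L} \<xi> + (norm (h \<xi>))\<^sup>2)"
      by (intro Bochner_Integration.integrable_add integrable_real_indicator sqint_integrable[OF s])
        (auto simp: emeasure_lborel_Icc_eq)
    show "h \<in> borel_measurable lborel" by (rule sqint_measurable[OF s])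
    have n: "norm z \<le> 1 + (norm z)\<^sup>2" for z :: complex
    proof -
      have "2 * norm z \<le> 1 + (norm z)\<^sup>2" using sum_squares_bound[of 1 "norm z"] by simp
      then show ?thesis using norm_ge_zero[of z] by linarith
    qed
    have "norm (h \<xi>) \<le> norm (indicator {-L..L} \<xi> + (norm (h \<xi>))\<^sup>2)" for \<xi>
      using n[of "h \<xi>"] L[of \<xi>] by (cases "\<bar>\<xi>\<bar> \<le> L") (auto simp: abs_le_iff)
    then show "AE \<xi> in lborel. norm (h \<xi>) \<le> norm (indicator {-L..L} \<xi> + (norm (h \<xi>))\<^sup>2)" by simp
  qed
qed

lemma ft_scale: "ft (\<lambda>\<xi>. a * f \<xi>) y = a * ft f y"
  unfolding ft_def by (subst integral_mult_right_zero[symmetric]) (simp add: mult.left_commute)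

lemma cis_quadratic_bound: "norm (cis x - 1 - \<i> * of_real x) \<le> x\<^sup>2"
proof -
  have "norm (iexp x - (\<Sum>k\<le>1. (\<i> * x)^k / fact k)) \<le> \<bar>x\<bar>^(Suc 1) / fact (Suc 1)"
    by (rule iexp_approx1)
  also have "\<dots> \<le> x\<^sup>2" by (simp add: power2_eq_square)
  finally show ?thesis by (simp add: cis_conv_exp diff_diff_eq)
qed

text \<open>The remainder of the first-order expansion of \<open>cis\<close> is quadratic, and \<open>\<xi>\<^sup>2 h\<close> is integrable.\<close>

lemma ft_has_vector_derivative:
  assumes h: "compact_L2 h"
  shows "(ft h has_vector_derivative ft (\<lambda>\<xi>. - \<i> * of_real \<xi> * h \<xi>) y) (at y)"
proof -
  let ?h1 = "\<lambda>\<xi>. - \<i> * of_real \<xi> * h \<xi>" and ?h2 = "\<lambda>\<xi>. of_real (\<xi>\<^sup>2) * h \<xi>"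
  note i0 = compact_L2_integrable[OF h]
  have i1: "integrable lborel ?h1" by (intro compact_L2_integrable compact_L2_mult h continuous_intros)
  have i2: "integrable lborel ?h2" by (intro compact_L2_integrable compact_L2_mult h continuous_intros)
  define K where "K = (LINT \<xi>|lborel. norm (?h2 \<xi>))"
  have bd: "norm (ft h z - ft h y - (z - y) *\<^sub>R ft ?h1 y) \<le> K * (z - y)\<^sup>2" for z
  proof -
    let ?e = "\<lambda>\<xi>. cis (- (z * \<xi>)) * h \<xi> - cis (- (y * \<xi>)) * h \<xi> - (z - y) *\<^sub>R (cis (- (y * \<xi>)) * ?h1 \<xi>)"
    have ie: "integrable lborel ?e"
      by (intro Bochner_Integration.integrable_diff integrable_scaleR_right integrable_cis_mult i0 i1) auto
    have eq: "ft h z - ft h y - (z - y) *\<^sub>R ft ?h1 y = (LINT \<xi>|lborel. ?e \<xi>)"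
    proof -
      have A: "integrable lborel (\<lambda>\<xi>. cis (- (w * \<xi>)) * h \<xi>)" for w
        by (intro integrable_cis_mult i0) simp
      have C: "integrable lborel (\<lambda>\<xi>. cis (- (y * \<xi>)) * ?h1 \<xi>)"
        by (intro integrable_cis_mult i1) simp
      have "(LINT \<xi>|lborel. ?e \<xi>) = (LINT \<xi>|lborel. cis (- (z * \<xi>)) * h \<xi> - cis (- (y * \<xi>)) * h \<xi>)
          - (LINT \<xi>|lborel. (z - y) *\<^sub>R (cis (- (y * \<xi>)) * ?h1 \<xi>))"
        by (rule Bochner_Integration.integral_diff[OF Bochner_Integration.integrable_diff[OF A A] integrable_scaleR_right[OF C]])
      also have "(LINT \<xi>|lborel. cis (- (z * \<xi>)) * h \<xi> - cis (- (y * \<xi>)) * h \<xi>) = ft h z - ft h y"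
        unfolding ft_def by (rule Bochner_Integration.integral_diff[OF A A])
      also have "(LINT \<xi>|lborel. (z - y) *\<^sub>R (cis (- (y * \<xi>)) * ?h1 \<xi>)) = (z - y) *\<^sub>R ft ?h1 y"
        unfolding ft_def by (rule integral_scaleR_right)
      finally show ?thesis by simp
    qed
    have "norm (LINT \<xi>|lborel. ?e \<xi>) \<le> (LINT \<xi>|lborel. norm (?e \<xi>))" by (rule integral_norm_bound)
    also have "\<dots> \<le> (LINT \<xi>|lborel. (z - y)\<^sup>2 * norm (?h2 \<xi>))"
    proof (rule integral_mono)
      fix \<xi>
      have split: "cis (- (z * \<xi>)) = cis (- (y * \<xi>)) * cis (- ((z - y) * \<xi>))"
        by (subst cis_mult, rule arg_cong[of _ _ cis]) (simp add: left_diff_distrib)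
      have alg: "C * E * w - C * w - (z - y) *\<^sub>R (C * (- \<i> * of_real \<xi> * w))
          = C * w * (E - 1 - \<i> * of_real (- ((z - y) * \<xi>)))" for C E w :: complex
        by (simp add: scaleR_conv_of_real right_diff_distrib left_diff_distrib mult_ac)
      have "?e \<xi> = cis (- (y * \<xi>)) * h \<xi> * (cis (- ((z - y) * \<xi>)) - 1 - \<i> * of_real (- ((z - y) * \<xi>)))"
        by (simp only: split alg)
      also have "norm \<dots> \<le> norm (h \<xi>) * (- ((z - y) * \<xi>))\<^sup>2"
        unfolding norm_mult using cis_quadratic_bound[of "- ((z - y) * \<xi>)"] by (simp add: mult_left_mono)
      also have "\<dots> = (z - y)\<^sup>2 * norm (?h2 \<xi>)"
        by (simp add: norm_mult norm_power power_mult_distrib mult_ac)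
      finally show "norm (?e \<xi>) \<le> (z - y)\<^sup>2 * norm (?h2 \<xi>)" .
    qed (use ie i2 in auto)
    also have "\<dots> = K * (z - y)\<^sup>2" by (simp add: K_def)
    finally show ?thesis unfolding eq .
  qed
  show ?thesis
    unfolding has_vector_derivative_def
  proof (rule has_derivativeI_sandwich[where e=1 and H="\<lambda>z. K * \<bar>z - y\<bar>"])
    show "bounded_linear (\<lambda>x. x *\<^sub>R ft ?h1 y)" by (rule bounded_linear_scaleR_left)
    show "norm (ft h z - ft h y - (z - y) *\<^sub>R ft ?h1 y) / norm (z - y) \<le> K * \<bar>z - y\<bar>" if "z \<noteq> y" for z
      using bd[of z] that by (simp add: divide_le_eq power2_eq_square abs_mult[symmetric])
    have "((\<lambda>z. K * \<bar>z - y\<bar>) \<longlongrightarrow> K * \<bar>y - y\<bar>) (at y)" by (intro tendsto_intros)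
    then show "((\<lambda>z. K * \<bar>z - y\<bar>) \<longlongrightarrow> 0) (at y)" by simp
  qed simp
qed

lemma smooth_ft:
  assumes "compact_L2 h"
  shows "smooth (ft h)"
  unfolding smooth_def
proof
  fix n
  show "times_differentiable n (ft h)" using assms
  proof (induction n arbitrary: h)
    case (Suc n)
    have "compact_L2 (\<lambda>\<xi>. - \<i> * of_real \<xi> * h \<xi>)" by (intro compact_L2_mult Suc.prems continuous_intros)
    from Suc.IH[OF this] show ?case
      using ft_has_vector_derivative[OF Suc.prems] by (intro times_differentiable_SucI)
  qed simp
qed

lemma sqint_ft:
  assumes h: "compact_L2 h"
  shows "sqint lborel (ft h)"
proof (rule sqintI_nn)
  have [measurable]: "h \<in> borel_measurable borel" using sqint_measurable[OF compact_L2_sqint[OF h]] by simp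
  show "ft h \<in> borel_measurable lborel" by simp
  show "(\<integral>\<^sup>+\<xi>. ennreal ((norm (ft h \<xi>))\<^sup>2) \<partial>lborel) < \<infinity>"
    by (rule le_less_trans[OF ft_bessel[OF compact_L2_integrable[OF h] compact_L2_sqint[OF h]]]) simp
qed

lemma integral_mode:
  assumes g: "integrable cyl g" and [measurable]: "c \<in> borel_measurable borel" and B: "\<And>y. norm (c y) \<le> B"
  shows "(LINT p|cyl. g p * mode k c p) = Re (LINT y|lborel. x_coeff g k y * c y)"
proof -
  have [measurable]: "g \<in> borel_measurable cyl" using g by auto
  have "integrable cyl (\<lambda>p. of_real (g p) * (cis (- (of_int k * fst p)) * c (snd p)))"
  proof (rule Bochner_Integration.integrable_bound)
    show "integrable cyl (\<lambda>p. B * norm (g p))" using g by simp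
    show "AE p in cyl. norm (of_real (g p) * (cis (- (of_int k * fst p)) * c (snd p))) \<le> norm (B * norm (g p))"
    proof (rule AE_I2)
      fix p
      have "norm (of_real (g p) * (cis (- (of_int k * fst p)) * c (snd p))) = norm (c (snd p)) * norm (g p)"
        by (simp add: norm_mult)
      also have "\<dots> \<le> B * norm (g p)" by (intro mult_right_mono B) simp
      finally show "norm (of_real (g p) * (cis (- (of_int k * fst p)) * c (snd p))) \<le> norm (B * norm (g p))" by simp
    qed
  qed measurable
  then have i: "integrable cyl (\<lambda>p. cis (- (of_int k * fst p)) * of_real (g p) * c (snd p))"
    by (simp add: mult_ac)
  have "(LINT p|cyl. g p * mode k c p) = (LINT p|cyl. Re (cis (- (of_int k * fst p)) * of_real (g p) * c (snd p)))"
    by (intro Bochner_Integration.integral_cong refl) (simp add: mode_def algebra_simps)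
  also have "\<dots> = Re (LINT p|cyl. cis (- (of_int k * fst p)) * of_real (g p) * c (snd p))"
    by (rule integral_Re[OF i])
  also have "(LINT p|cyl. cis (- (of_int k * fst p)) * of_real (g p) * c (snd p)) =
     (LINT y|lborel. LINT x|circle. cis (- (of_int k * x)) * of_real (g (x, y)) * c y)"
    using cyl.integral_snd[of "\<lambda>x y. cis (- (of_int k * x)) * of_real (g (x, y)) * c y"] i
    unfolding cyl_eq by (simp add: case_prod_beta')
  also have "\<dots> = (LINT y|lborel. x_coeff g k y * c y)"
    unfolding x_coeff_def by simp
  finally show ?thesis .
qed

text \<open>The real part of \<open>\<integral> h(\<xi>) f^(k, \<xi>) d\<xi>\<close>, without a complex conjugate on \<open>h\<close>.\<close>

definition pairing :: "(real \<times> real \<Rightarrow> real) \<Rightarrow> int \<Rightarrow> (real \<Rightarrow> complex) \<Rightarrow> real" where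
  "pairing f k h = ip lborel (\<lambda>\<xi>. cnj (h \<xi>)) (fourier f k)"

text \<open>For truncated \<open>f\<close> this is Fubini's theorem. On the left the truncation is removed by dominated
  convergence, since \<open>ft h\<close> is square-integrable; on the right by the convergence that defines the transform.\<close>

lemma parseval:
  assumes f: "sqint cyl f" and h: "compact_L2 h"
  shows "ip cyl f (mode k (ft h)) = 2 * pi * pairing f k h"
proof -
  have [measurable]: "f \<in> borel_measurable cyl" using f by (rule sqint_measurable)
  note hi = compact_L2_integrable[OF h]
  have [measurable]: "ft h \<in> borel_measurable borel" using hi by (intro ft_measurable) auto
  let ?g = "\<lambda>R p. indicator {-R..R} (snd p) * f p"
  let ?cnj = "\<lambda>\<xi>. cnj (h \<xi>)"
  note m2 = sqint_mode(1)[OF sqint_ft[OF h], of k]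
  have [measurable]: "mode k (ft h) \<in> borel_measurable cyl" using m2 by (rule sqint_measurable)
  have 1: "(LINT p|cyl. ?g R p * mode k (ft h) p) = 2 * pi * ip lborel ?cnj (trunc_fourier R f k)" for R
  proof -
    note gi = integrable_cyl_trunc[OF f, of R]
    have "(LINT p|cyl. ?g R p * mode k (ft h) p) = Re (LINT y|lborel. x_coeff (?g R) k y * ft h y)"
      by (rule integral_mode[OF gi _ ft_bound[OF hi]]) measurable
    also have "(LINT y|lborel. x_coeff (?g R) k y * ft h y) = (LINT \<xi>|lborel. ft (x_coeff (?g R) k) \<xi> * h \<xi>)"
      by (rule ft_multiplication[OF integrable_x_coeff(1)[OF gi] hi, symmetric])
    also have "\<dots> = (LINT \<xi>|lborel. (2 * pi) * (h \<xi> * trunc_fourier R f k \<xi>))"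
      unfolding trunc_fourier_eq[OF f] by (intro Bochner_Integration.integral_cong refl) simp
    also have "\<dots> = (2 * pi) * (LINT \<xi>|lborel. h \<xi> * trunc_fourier R f k \<xi>)"
      by (rule integral_mult_right_zero)
    also have "Re \<dots> = 2 * pi * Re (LINT \<xi>|lborel. h \<xi> * trunc_fourier R f k \<xi>)" by simp
    also have "Re (LINT \<xi>|lborel. h \<xi> * trunc_fourier R f k \<xi>) = (LINT \<xi>|lborel. Re (h \<xi> * trunc_fourier R f k \<xi>))"
    proof (rule integral_Re[symmetric], rule Bochner_Integration.integrable_bound)
      show "integrable lborel (\<lambda>\<xi>. (norm (h \<xi>))\<^sup>2 + (norm (trunc_fourier R f k \<xi>))\<^sup>2)"
        by (intro Bochner_Integration.integrable_add sqint_integrable sqint_trunc f compact_L2_sqint h)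
      show "(\<lambda>\<xi>. h \<xi> * trunc_fourier R f k \<xi>) \<in> borel_measurable lborel"
        using hi trunc_measurable[OF f] by (intro borel_measurable_times) auto
      have "norm (a * b) \<le> norm ((norm a)\<^sup>2 + (norm b)\<^sup>2)" for a b :: complex
      proof -
        have "0 \<le> norm a * norm b" by simp
        then have "norm a * norm b \<le> (norm a)\<^sup>2 + (norm b)\<^sup>2"
          using sum_squares_bound[of "norm a" "norm b"] by linarith
        then show ?thesis by (simp add: norm_mult)
      qed
      then show "AE \<xi> in lborel. norm (h \<xi> * trunc_fourier R f k \<xi>) \<le> norm ((norm (h \<xi>))\<^sup>2 + (norm (trunc_fourier R f k \<xi>))\<^sup>2)"
        by simp
    qed
    finally show ?thesis by (simp add: ip_def inner_complex_def)
  qed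
  have "((\<lambda>R. LINT p|cyl. ?g R p * mode k (ft h) p) \<longlongrightarrow> (LINT p|cyl. f p * mode k (ft h) p)) at_top"
  proof (rule integral_dominated_convergence_at_top[where w="\<lambda>p. norm (f p * mode k (ft h) p)"])
    show "integrable cyl (\<lambda>p. norm (f p * mode k (ft h) p))"
      using sqint_inner[OF f m2] by simp
    show "\<forall>\<^sub>F R in at_top. AE p in cyl. norm (?g R p * mode k (ft h) p) \<le> norm (f p * mode k (ft h) p)"
      by (intro always_eventually allI AE_I2) (auto split: split_indicator)
    show "AE p in cyl. ((\<lambda>R. ?g R p * mode k (ft h) p) \<longlongrightarrow> f p * mode k (ft h) p) at_top"
    proof (rule AE_I2, rule tendsto_eventually)
      fix p :: "real \<times> real"
      show "\<forall>\<^sub>F R in at_top. ?g R p * mode k (ft h) p = f p * mode k (ft h) p"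
        using eventually_ge_at_top[of "\<bar>snd p\<bar>"] by eventually_elim (auto simp: abs_le_iff split: split_indicator)
    qed
  qed measurable
  then have l1: "((\<lambda>R. 2 * pi * ip lborel ?cnj (trunc_fourier R f k)) \<longlongrightarrow> ip cyl f (mode k (ft h))) at_top"
    unfolding 1 by (simp add: ip_def)
  have s: "sqint lborel ?cnj" by (rule sqint_cnj[OF compact_L2_sqint[OF h]])
  have "((\<lambda>R. ip lborel ?cnj (trunc_fourier R f k) - ip lborel ?cnj (fourier f k)) \<longlongrightarrow> 0) at_top"
  proof (rule Lim_null_comparison)
    let ?D = "\<lambda>R \<xi>. trunc_fourier R f k \<xi> - fourier f k \<xi>"
    show "\<forall>\<^sub>F R in at_top. norm (ip lborel ?cnj (trunc_fourier R f k) - ip lborel ?cnj (fourier f k))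
       \<le> sqrt (nsq lborel ?cnj) * sqrt (nsq lborel (?D R))"
      using ip_le_sqrt[OF s sqint_diff[OF sqint_trunc[OF f] sqint_fourier[OF f]]]
      by (intro always_eventually allI) (simp add: ip_diff_right s sqint_trunc sqint_fourier f)
    have "((\<lambda>R. sqrt (nsq lborel ?cnj) * sqrt (nsq lborel (?D R))) \<longlongrightarrow> sqrt (nsq lborel ?cnj) * sqrt 0) at_top"
      by (intro tendsto_mult_left tendsto_real_sqrt nsq_trunc_tendsto f)
    then show "((\<lambda>R. sqrt (nsq lborel ?cnj) * sqrt (nsq lborel (?D R))) \<longlongrightarrow> 0) at_top" by simp
  qed
  then have "((\<lambda>R. ip lborel ?cnj (trunc_fourier R f k)) \<longlongrightarrow> ip lborel ?cnj (fourier f k)) at_top"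
    by (simp add: Lim_null[symmetric])
  then have "((\<lambda>R. 2 * pi * ip lborel ?cnj (trunc_fourier R f k)) \<longlongrightarrow> 2 * pi * pairing f k h) at_top"
    unfolding pairing_def by (rule tendsto_mult_left)
  with l1 show ?thesis by (rule tendsto_unique[OF trivial_limit_at_top_linorder])
qed

definition L2_tendsto :: "(nat \<Rightarrow> real \<Rightarrow> complex) \<Rightarrow> (real \<Rightarrow> complex) \<Rightarrow> bool" where
  "L2_tendsto c d \<longleftrightarrow> (\<forall>n. sqint lborel (c n)) \<and> sqint lborel d \<and> (\<lambda>n. nsq lborel (\<lambda>y. c n y - d y)) \<longlonglongrightarrow> 0"

lemma L2_tendsto_add:
  assumes "L2_tendsto c d" "L2_tendsto c' d'"
  shows "L2_tendsto (\<lambda>n y. c n y + c' n y) (\<lambda>y. d y + d' y)"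
proof -
  have "(\<lambda>n. nsq lborel (\<lambda>y. c n y + c' n y - (d y + d' y))) \<longlonglongrightarrow> 0"
  proof (rule Lim_null_comparison)
    let ?u = "\<lambda>n. nsq lborel (\<lambda>y. c n y - d y)" and ?v = "\<lambda>n. nsq lborel (\<lambda>y. c' n y - d' y)"
    have "nsq lborel (\<lambda>y. (c n y - d y) + (c' n y - d' y)) \<le> 2 * ?u n + 2 * ?v n" for n
      using assms by (intro nsq_add_le sqint_diff) (auto simp: L2_tendsto_def)
    then show "\<forall>\<^sub>F n in sequentially. norm (nsq lborel (\<lambda>y. c n y + c' n y - (d y + d' y))) \<le> 2 * ?u n + 2 * ?v n"
      by (simp add: add_diff_add)
    have "(\<lambda>n. 2 * ?u n + 2 * ?v n) \<longlonglongrightarrow> 2 * 0 + 2 * 0"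
      using assms unfolding L2_tendsto_def by (intro tendsto_intros) auto
    then show "(\<lambda>n. 2 * ?u n + 2 * ?v n) \<longlonglongrightarrow> 0" by simp
  qed
  then show ?thesis using assms unfolding L2_tendsto_def by (auto intro: sqint_add)
qed

lemma L2_tendsto_mult:
  assumes u: "sqint lborel u" and a: "\<And>n. a n \<in> borel_measurable borel" and B: "\<And>n y. norm (a n y) \<le> B"
    and lim: "\<And>y. (\<lambda>n. a n y) \<longlonglongrightarrow> b"
  shows "L2_tendsto (\<lambda>n y. a n y * u y) (\<lambda>y. b * u y)"
proof -
  note a[measurable]
  have [measurable]: "u \<in> borel_measurable borel" using sqint_measurable[OF u] by simp
  have b: "norm b \<le> B" by (rule Lim_bounded[OF tendsto_norm[OF lim]]) (use B in auto)
  have "(\<lambda>n. LINT y|lborel. (norm (a n y * u y - b * u y))\<^sup>2) \<longlonglongrightarrow> (LINT y|(lborel :: real measure). 0)"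
  proof (rule integral_dominated_convergence[where w="\<lambda>y. (2 * B)\<^sup>2 * (norm (u y))\<^sup>2"])
    show "integrable lborel (\<lambda>y. (2 * B)\<^sup>2 * (norm (u y))\<^sup>2)" using sqint_integrable[OF u] by simp
    show "AE y in lborel. norm ((norm (a n y * u y - b * u y))\<^sup>2) \<le> (2 * B)\<^sup>2 * (norm (u y))\<^sup>2" for n
    proof (rule AE_I2)
      fix y
      have "norm (a n y * u y - b * u y) = norm (a n y - b) * norm (u y)"
        by (simp add: left_diff_distrib[symmetric] norm_mult)
      also have "\<dots> \<le> (2 * B) * norm (u y)"
        using norm_triangle_ineq4[of "a n y" b] B[of n y] b by (intro mult_right_mono) auto
      finally have "(norm (a n y * u y - b * u y))\<^sup>2 \<le> ((2 * B) * norm (u y))\<^sup>2"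
        by (intro power_mono) auto
      then show "norm ((norm (a n y * u y - b * u y))\<^sup>2) \<le> (2 * B)\<^sup>2 * (norm (u y))\<^sup>2"
        by (simp add: power_mult_distrib)
    qed
    show "AE y in lborel. (\<lambda>n. (norm (a n y * u y - b * u y))\<^sup>2) \<longlonglongrightarrow> 0"
    proof (rule AE_I2)
      fix y
      have "(\<lambda>n. (norm (a n y * u y - b * u y))\<^sup>2) \<longlonglongrightarrow> (norm (b * u y - b * u y))\<^sup>2"
        by (intro tendsto_intros lim)
      then show "(\<lambda>n. (norm (a n y * u y - b * u y))\<^sup>2) \<longlonglongrightarrow> 0" by simp
    qed
  qed measurable
  then show ?thesis
    unfolding L2_tendsto_def nsq_eq using B b
    by (auto intro!: sqint_mult_bounded(1)[OF u, where B=B])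
qed

text \<open>The uniformity in \<open>r\<close> comes from the bound \<open>B\<close> on the norms of \<open>f r\<close>.\<close>

lemma L2_tendsto_pairing:
  assumes lim: "L2_tendsto c d" and f: "\<And>r. r \<in> S \<Longrightarrow> sqint cyl (f r)" "\<And>r. r \<in> S \<Longrightarrow> nsq cyl (f r) \<le> B"
    and a: "\<And>r. r \<in> S \<Longrightarrow> norm (a r) \<le> A"
  shows "uniform_limit S (\<lambda>n r. ip cyl (f r) (mode k (\<lambda>y. a r * c n y)))
     (\<lambda>r. ip cyl (f r) (mode k (\<lambda>y. a r * d y))) sequentially"
proof -
  let ?D = "\<lambda>n. nsq lborel (\<lambda>y. c n y - d y)"
  have c: "\<And>n. sqint lborel (c n)" and d: "sqint lborel d" and D: "?D \<longlonglongrightarrow> 0"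
    using lim by (auto simp: L2_tendsto_def)
  have s: "sqint lborel (\<lambda>y. z * e y)" if "sqint lborel e" for z and e :: "real \<Rightarrow> complex"
    by (rule sqint_mult_bounded(1)[OF that, where B="norm z"]) auto
  have le: "dist (ip cyl (f r) (mode k (\<lambda>y. a r * c n y))) (ip cyl (f r) (mode k (\<lambda>y. a r * d y)))
     \<le> sqrt B * sqrt (2 * pi * (A\<^sup>2 * ?D n))" if r: "r \<in> S" for n r
  proof -
    have e: "(\<lambda>p. mode k (\<lambda>y. a r * c n y) p - mode k (\<lambda>y. a r * d y) p) = mode k (\<lambda>y. a r * (c n y - d y))"
      by (simp add: mode_diff[symmetric] right_diff_distrib)
    have "ip cyl (f r) (mode k (\<lambda>y. a r * c n y)) - ip cyl (f r) (mode k (\<lambda>y. a r * d y))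
        = ip cyl (f r) (mode k (\<lambda>y. a r * (c n y - d y)))"
      unfolding e[symmetric] by (intro ip_diff_right[symmetric] f r sqint_mode s c d)
    also have "\<bar>\<dots>\<bar> \<le> sqrt (nsq cyl (f r)) * sqrt (nsq cyl (mode k (\<lambda>y. a r * (c n y - d y))))"
      by (intro ip_le_sqrt f r sqint_mode s sqint_diff c d)
    also have "\<dots> \<le> sqrt B * sqrt (2 * pi * (A\<^sup>2 * ?D n))"
    proof (intro mult_mono real_sqrt_le_mono f r)
      have "nsq lborel (\<lambda>y. a r * (c n y - d y)) \<le> A\<^sup>2 * ?D n"
        using a[OF r] by (intro sqint_mult_bounded(2) sqint_diff c d) auto
      then show "nsq cyl (mode k (\<lambda>y. a r * (c n y - d y))) \<le> 2 * pi * (A\<^sup>2 * ?D n)"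
        by (intro order_trans[OF sqint_mode(2)[OF s[OF sqint_diff[OF c d]]]] mult_left_mono) auto
      have "0 \<le> B" using f(2)[OF r] nsq_nonneg[of cyl "f r"] by linarith
      then show "0 \<le> sqrt B" by simp
    qed simp
    finally show ?thesis by (simp add: dist_real_def)
  qed
  have "(\<lambda>n. sqrt B * sqrt (2 * pi * (A\<^sup>2 * ?D n))) \<longlonglongrightarrow> sqrt B * sqrt (2 * pi * (A\<^sup>2 * 0))"
    by (intro tendsto_intros D)
  then have L: "(\<lambda>n. sqrt B * sqrt (2 * pi * (A\<^sup>2 * ?D n))) \<longlonglongrightarrow> 0" by simp
  show ?thesis
  proof (rule uniform_limitI)
    fix e :: real assume "e > 0"
    with L have "\<forall>\<^sub>F n in sequentially. sqrt B * sqrt (2 * pi * (A\<^sup>2 * ?D n)) < e"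
      by (rule order_tendstoD)
    then show "\<forall>\<^sub>F n in sequentially. \<forall>r\<in>S. dist (ip cyl (f r) (mode k (\<lambda>y. a r * c n y))) (ip cyl (f r) (mode k (\<lambda>y. a r * d y))) < e"
      by eventually_elim (use le in \<open>auto intro: le_less_trans\<close>)
  qed
qed

lemma derivative_uniform_limit:
  fixes F :: "nat \<Rightarrow> real \<Rightarrow> real"
  assumes S: "convex S" "t \<in> S"
    and der: "\<And>n r. r \<in> S \<Longrightarrow> (F n has_real_derivative G n r) (at r within S)"
    and F: "\<And>r. r \<in> S \<Longrightarrow> (\<lambda>n. F n r) \<longlonglongrightarrow> F0 r"
    and G: "uniform_limit S G G0 sequentially"
  shows "(F0 has_real_derivative G0 t) (at t within S)"
proof -
  have "\<exists>g. \<forall>x\<in>S. (\<lambda>n. F n x) \<longlonglongrightarrow> g x \<and> (g has_derivative (*) (G0 x)) (at x within S)"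
  proof (rule has_derivative_sequence[OF S(1)])
    show "(F n has_derivative (*) (G n x)) (at x within S)" if "x \<in> S" for n x
      using der[OF that] by (simp add: has_field_derivative_def)
    show "\<forall>\<^sub>F n in sequentially. \<forall>x\<in>S. \<forall>h. norm (G n x * h - G0 x * h) \<le> e * norm h" if "e > 0" for e
    proof -
      have "\<forall>\<^sub>F n in sequentially. \<forall>x\<in>S. dist (G n x) (G0 x) < e"
        using G that by (rule uniform_limitD)
      then show ?thesis
        by eventually_elim
          (auto simp: left_diff_distrib[symmetric] abs_mult dist_real_def less_imp_le intro!: mult_right_mono)
    qed
    show "t \<in> S" by fact
    show "(\<lambda>n. F n t) \<longlonglongrightarrow> F0 t" by (rule F[OF S(2)])
  qed
  then obtain g where g: "\<And>x. x \<in> S \<Longrightarrow> (\<lambda>n. F n x) \<longlonglongrightarrow> g x"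
    "\<And>x. x \<in> S \<Longrightarrow> (g has_derivative (*) (G0 x)) (at x within S)" by blast
  have "F0 x = g x" if "x \<in> S" for x using LIMSEQ_unique[OF F g(1)] that by blast
  then show ?thesis
    unfolding has_field_derivative_def
    by (intro has_derivative_transform[OF S(2) _ g(2)[OF S(2)]]) auto
qed

text \<open>The profiles are \<open>bump (y / n) (ft h) (y)\<close>. Each derivative that falls on the cutoff gains a factor \<open>1/n\<close>, so in
  the limit only the derivatives of \<open>ft h\<close> remain.\<close>

lemma cutoff_exists:
  assumes h: "compact_L2 h"
  obtains c c1 c2 where "\<And>n. smooth_compact (c n)"
    "\<And>n y. (c n has_vector_derivative c1 n y) (at y)" "\<And>n y. (c1 n has_vector_derivative c2 n y) (at y)"
    "L2_tendsto c (ft h)" "L2_tendsto c1 (ft (\<lambda>\<xi>. - \<i> * of_real \<xi> * h \<xi>))"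
    "L2_tendsto c2 (ft (\<lambda>\<xi>. - of_real (\<xi>\<^sup>2) * h \<xi>))"
proof -
  obtain b1 where b1: "\<And>y. (bump has_vector_derivative b1 y) (at y)" "smooth b1"
    using smooth_has_deriv[OF smooth_bump] by blast
  obtain b2 where b2: "\<And>y. (b1 has_vector_derivative b2 y) (at y)" "smooth b2"
    using smooth_has_deriv[OF b1(2)] by blast
  have z0: "bump y = 0" if "1 < \<bar>y\<bar>" for y using that by (intro bump_eq_0) simp
  have z1: "b1 y = 0" if "1 < \<bar>y\<bar>" for y using deriv_eq_0_outside[OF b1(1) _ that] z0 by blast
  have z2: "b2 y = 0" if "1 < \<bar>y\<bar>" for y using deriv_eq_0_outside[OF b2(1) _ that] z1 by blast
  obtain B0 where B0: "\<And>y. norm (bump y) \<le> B0"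
    using bounded_compact_support[OF smooth_continuous[OF smooth_bump] z0] by blast
  obtain B1 where B1: "\<And>y. norm (b1 y) \<le> B1"
    using bounded_compact_support[OF smooth_continuous[OF b1(2)] z1] by blast
  obtain B2 where B2: "\<And>y. norm (b2 y) \<le> B2"
    using bounded_compact_support[OF smooth_continuous[OF b2(2)] z2] by blast
  let ?e = "\<lambda>n. 1 / real (Suc n)"
  let ?h1 = "\<lambda>\<xi>. - \<i> * of_real \<xi> * h \<xi>" and ?h2 = "\<lambda>\<xi>. - of_real (\<xi>\<^sup>2) * h \<xi>"
  have h1: "compact_L2 ?h1" by (intro compact_L2_mult h continuous_intros)
  have h2: "compact_L2 ?h2" by (intro compact_L2_mult h continuous_intros)
  note d0 = ft_has_vector_derivative[OF h]
  have d1: "(ft ?h1 has_vector_derivative ft ?h2 y) (at y)" for y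
  proof -
    have "- \<i> * of_real \<xi> * ?h1 \<xi> = ?h2 \<xi>" for \<xi>
      by (simp add: complex_eq_iff power2_eq_square algebra_simps)
    then show ?thesis using ft_has_vector_derivative[OF h1, of y] by simp
  qed
  define a0 where "a0 n y = bump (?e n * y)" for n y
  define a1 where "a1 n y = of_real (?e n) * b1 (?e n * y)" for n y
  define a2 where "a2 n y = of_real (?e n) * (of_real (?e n) * b2 (?e n * y))" for n y
  have ch: "((\<lambda>y. f (?e n * y)) has_vector_derivative of_real (?e n) * f' (?e n * y)) (at y)"
    if "\<And>y. (f has_vector_derivative f' y) (at y)" for f f' :: "real \<Rightarrow> complex" and n y
  proof -
    have "((\<lambda>y. ?e n * y) has_vector_derivative ?e n) (at y)"
      by (auto intro!: derivative_eq_intros simp del: of_nat_Suc)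
    from vector_diff_chain_at[OF this that] show ?thesis
      by (simp add: o_def scaleR_conv_of_real)
  qed
  have da0: "(a0 n has_vector_derivative a1 n y) (at y)" for n y
    unfolding a0_def a1_def by (rule ch[OF b1(1)])
  have da1: "(a1 n has_vector_derivative a2 n y) (at y)" for n y
    unfolding a1_def a2_def by (intro has_vector_derivative_mult_right ch[OF b2(1)])
  define c where "c n y = a0 n y * ft h y" for n y
  define c1 where "c1 n y = a0 n y * ft ?h1 y + a1 n y * ft h y" for n y
  define c2 where "c2 n y = (a0 n y * ft ?h2 y + a1 n y * ft ?h1 y) + (a1 n y * ft ?h1 y + a2 n y * ft h y)" for n y
  have dc: "(c n has_vector_derivative c1 n y) (at y)" for n y
    unfolding c_def c1_def by (intro has_vector_derivative_mult da0 d0)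
  have dc1: "(c1 n has_vector_derivative c2 n y) (at y)" for n y
    unfolding c1_def c2_def by (intro has_vector_derivative_add has_vector_derivative_mult da0 da1 d0 d1)
  have Cc: "smooth_compact (c n)" for n
  proof -
    have "smooth_compact (a0 n)"
      unfolding smooth_compact_def
    proof (intro conjI exI allI impI)
      show "smooth (a0 n)" using smooth_affine[OF smooth_bump, of "?e n" 0] by (simp add: a0_def[abs_def])
      fix y :: real assume "real (Suc n) < \<bar>y\<bar>"
      then show "a0 n y = 0" unfolding a0_def by (intro bump_eq_0) (simp add: abs_mult field_simps)
    qed
    then have "smooth_compact (\<lambda>y. ft h y * a0 n y)" by (rule smooth_compact_mult[OF smooth_ft[OF h]])
    then show ?thesis by (simp add: c_def[abs_def] mult.commute)
  qed
  have e0: "?e \<longlonglongrightarrow> 0" using LIMSEQ_inverse_real_of_nat by (simp add: inverse_eq_divide)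
  have e1: "norm (complex_of_real (?e n)) \<le> 1" for n by (simp add: norm_divide del: of_nat_Suc)
  have meas: "(\<lambda>y. f (?e n * y)) \<in> borel_measurable borel" if "smooth f" for f n
  proof -
    have "smooth (\<lambda>y. f (?e n * y + 0))" by (rule smooth_affine[OF that])
    then have "smooth (\<lambda>y. f (?e n * y))" by (simp only: add_0_right)
    then show ?thesis by (intro borel_measurable_continuous_onI smooth_continuous)
  qed
  have cont0: "(\<lambda>n. f (?e n * y)) \<longlonglongrightarrow> f 0" if "smooth f" for f y
  proof (rule continuous_on_tendsto_compose[OF smooth_continuous[OF that, of UNIV]])
    show "(\<lambda>n. ?e n * y) \<longlonglongrightarrow> 0" using tendsto_mult_left_zero[OF e0] .
  qed auto
  have A0: "L2_tendsto (\<lambda>n y. a0 n y * u y) u" if "sqint lborel u" for u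
  proof -
    have "L2_tendsto (\<lambda>n y. a0 n y * u y) (\<lambda>y. 1 * u y)"
    proof (rule L2_tendsto_mult[OF that, where B=B0])
      show "a0 n \<in> borel_measurable borel" for n
        unfolding a0_def by (rule meas[OF smooth_bump])
      show "norm (a0 n y) \<le> B0" for n y unfolding a0_def by (rule B0)
      show "(\<lambda>n. a0 n y) \<longlonglongrightarrow> 1" for y
        using cont0[OF smooth_bump] unfolding a0_def bump_0 .
    qed
    then show ?thesis by simp
  qed
  have A1: "L2_tendsto (\<lambda>n y. a1 n y * u y) (\<lambda>y. 0)" if "sqint lborel u" for u
  proof -
    have "L2_tendsto (\<lambda>n y. a1 n y * u y) (\<lambda>y. 0 * u y)"
    proof (rule L2_tendsto_mult[OF that, where B=B1])
      show "a1 n \<in> borel_measurable borel" for n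
        unfolding a1_def using meas[OF b1(2)] by simp
      show "norm (a1 n y) \<le> B1" for n y
        unfolding a1_def norm_mult using mult_mono[OF e1[of n] B1[of "?e n * y"]] by simp
      have "(\<lambda>n. of_real (?e n) * b1 (?e n * y)) \<longlonglongrightarrow> of_real 0 * b1 0" for y
        by (intro tendsto_mult tendsto_of_real e0 cont0 b1)
      then show "(\<lambda>n. a1 n y) \<longlonglongrightarrow> 0" for y by (simp add: a1_def)
    qed
    then show ?thesis by simp
  qed
  have A2: "L2_tendsto (\<lambda>n y. a2 n y * u y) (\<lambda>y. 0)" if "sqint lborel u" for u
  proof -
    have "L2_tendsto (\<lambda>n y. a2 n y * u y) (\<lambda>y. 0 * u y)"
    proof (rule L2_tendsto_mult[OF that, where B=B2])
      show "a2 n \<in> borel_measurable borel" for n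
        unfolding a2_def using meas[OF b2(2)] by simp
      have B2': "norm (of_real (?e n) * b2 (?e n * y)) \<le> B2" for n y
        unfolding norm_mult using mult_mono[OF e1[of n] B2[of "?e n * y"]] by simp
      show "norm (a2 n y) \<le> B2" for n y
        unfolding a2_def norm_mult[of _ "_ * _"] using mult_mono[OF e1[of n] B2'[of n y]] by simp
      have "(\<lambda>n. of_real (?e n) * (of_real (?e n) * b2 (?e n * y))) \<longlonglongrightarrow> of_real 0 * (of_real 0 * b2 0)" for y
        by (intro tendsto_mult tendsto_of_real e0 cont0 b2)
      then show "(\<lambda>n. a2 n y) \<longlonglongrightarrow> 0" for y by (simp add: a2_def)
    qed
    then show ?thesis by simp
  qed
  note s0 = sqint_ft[OF h] and s1 = sqint_ft[OF h1] and s2 = sqint_ft[OF h2]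
  show ?thesis
  proof (rule that[OF Cc dc dc1])
    show "L2_tendsto c (ft h)" using A0[OF s0] by (simp add: c_def[abs_def])
    show "L2_tendsto c1 (ft ?h1)"
      using L2_tendsto_add[OF A0[OF s1] A1[OF s0]] by (simp add: c1_def[abs_def])
    show "L2_tendsto c2 (ft ?h2)"
      using L2_tendsto_add[OF L2_tendsto_add[OF A0[OF s2] A1[OF s1]] L2_tendsto_add[OF A1[OF s1] A2[OF s0]]]
      by (simp add: c2_def[abs_def])
  qed
qed

section \<open>Weights on frequency intervals\<close>

definition interval_weight :: "int \<Rightarrow> (real \<Rightarrow> real) \<Rightarrow> bool" where
  "interval_weight j W \<longleftrightarrow> W \<in> borel_measurable borel \<and> (\<exists>B. \<forall>\<xi>. 0 \<le> W \<xi> \<and> W \<xi> \<le> B) \<and>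
     (\<forall>\<xi>. \<xi> \<notin> {of_int j..<of_int j + 1} \<longrightarrow> W \<xi> = 0)"

definition weighted :: "(real \<Rightarrow> real) \<Rightarrow> real measure" where
  "weighted W = density lborel (\<lambda>\<xi>. ennreal (W \<xi>))"

lemma sets_weighted [measurable_cong]: "sets (weighted W) = sets borel"
  by (simp add: weighted_def)

lemma AE_weighted:
  assumes W: "interval_weight j W" and P: "\<And>\<xi>. \<xi> \<in> {of_int j..<of_int j + 1} \<Longrightarrow> P \<xi>"
  shows "AE \<xi> in weighted W. P \<xi>"
proof -
  have "P \<xi>" if "0 < W \<xi>" for \<xi>
    using that W P[of \<xi>] unfolding interval_weight_def by fastforce
  moreover have "W \<in> borel_measurable borel" using W by (simp add: interval_weight_def)
  ultimately show ?thesis unfolding weighted_def by (subst AE_density) auto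
qed

lemma integral_weighted:
  fixes f :: "real \<Rightarrow> real"
  assumes W: "interval_weight j W" and f: "f \<in> borel_measurable borel"
  shows "(LINT \<xi>|weighted W. f \<xi>) = (LINT \<xi>|lborel. W \<xi> * f \<xi>)"
    "integrable (weighted W) f \<longleftrightarrow> integrable lborel (\<lambda>\<xi>. W \<xi> * f \<xi>)"
proof -
  have "W \<in> borel_measurable borel" "\<And>\<xi>. 0 \<le> W \<xi>" using W unfolding interval_weight_def by blast+
  with f show "(LINT \<xi>|weighted W. f \<xi>) = (LINT \<xi>|lborel. W \<xi> * f \<xi>)"
    "integrable (weighted W) f \<longleftrightarrow> integrable lborel (\<lambda>\<xi>. W \<xi> * f \<xi>)"
    unfolding weighted_def by (simp_all add: integral_density integrable_density)
qed

lemma sqint_weighted: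
  assumes W: "interval_weight j W"
  obtains B where "0 \<le> B" "\<And>f :: real \<Rightarrow> complex. sqint lborel f \<Longrightarrow> sqint (weighted W) f"
    "\<And>f :: real \<Rightarrow> complex. sqint lborel f \<Longrightarrow> nsq (weighted W) f \<le> B * nsq lborel f"
proof -
  obtain B where [measurable]: "W \<in> borel_measurable borel" and W0: "\<And>\<xi>. 0 \<le> W \<xi>" and B: "\<And>\<xi>. W \<xi> \<le> B"
    using W unfolding interval_weight_def by blast
  have B0: "0 \<le> B" using W0[of 0] B[of 0] by linarith
  have "sqint (weighted W) f" "nsq (weighted W) f \<le> B * nsq lborel f" if f: "sqint lborel f" for f :: "real \<Rightarrow> complex"
  proof -
    have [measurable]: "f \<in> borel_measurable borel" using sqint_measurable[OF f] by simp
    have i: "integrable lborel (\<lambda>\<xi>. W \<xi> * (norm (f \<xi>))\<^sup>2)"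
    proof (rule Bochner_Integration.integrable_bound)
      show "integrable lborel (\<lambda>\<xi>. B * (norm (f \<xi>))\<^sup>2)" using sqint_integrable[OF f] by simp
      show "AE \<xi> in lborel. norm (W \<xi> * (norm (f \<xi>))\<^sup>2) \<le> norm (B * (norm (f \<xi>))\<^sup>2)"
        using W0 B B0 by (auto simp: abs_mult intro!: AE_I2 mult_right_mono)
    qed measurable
    then show "sqint (weighted W) f"
      unfolding sqint_def by (subst integral_weighted(2)[OF W]) simp_all
    have "nsq (weighted W) f = (LINT \<xi>|lborel. W \<xi> * (norm (f \<xi>))\<^sup>2)"
      unfolding nsq_eq by (rule integral_weighted(1)[OF W]) measurable
    also have "\<dots> \<le> (LINT \<xi>|lborel. B * (norm (f \<xi>))\<^sup>2)"
      using sqint_integrable[OF f] by (intro integral_mono i mult_right_mono B) auto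
    also have "\<dots> = B * nsq lborel f" by (simp add: nsq_eq)
    finally show "nsq (weighted W) f \<le> B * nsq lborel f" .
  qed
  with B0 show ?thesis using that by blast
qed

lemma compact_L2_weight:
  fixes h :: "real \<Rightarrow> complex"
  assumes W: "interval_weight j W" and h: "sqint (weighted W) h"
  shows "compact_L2 (\<lambda>\<xi>. of_real (W \<xi>) * cnj (h \<xi>))"
proof -
  obtain B where [measurable]: "W \<in> borel_measurable borel" and W0: "\<And>\<xi>. 0 \<le> W \<xi>" and B: "\<And>\<xi>. W \<xi> \<le> B"
    using W unfolding interval_weight_def by blast
  have B0: "0 \<le> B" using W0[of 0] B[of 0] by linarith
  have [measurable]: "h \<in> borel_measurable borel" using sqint_measurable[OF h] by simp
  have i: "integrable lborel (\<lambda>\<xi>. W \<xi> * (norm (h \<xi>))\<^sup>2)"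
    using sqint_integrable[OF h] by (subst (asm) integral_weighted(2)[OF W]) simp_all
  have "integrable lborel (\<lambda>\<xi>. (norm (of_real (W \<xi>) * cnj (h \<xi>)))\<^sup>2)"
  proof (rule Bochner_Integration.integrable_bound)
    show "integrable lborel (\<lambda>\<xi>. B * (W \<xi> * (norm (h \<xi>))\<^sup>2))" using i by simp
    show "AE \<xi> in lborel. norm ((norm (of_real (W \<xi>) * cnj (h \<xi>)))\<^sup>2) \<le> norm (B * (W \<xi> * (norm (h \<xi>))\<^sup>2))"
    proof (rule AE_I2)
      fix \<xi>
      have "W \<xi> * (W \<xi> * (norm (h \<xi>))\<^sup>2) \<le> B * (W \<xi> * (norm (h \<xi>))\<^sup>2)"
        by (intro mult_right_mono B mult_nonneg_nonneg W0) simp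
      then show "norm ((norm (of_real (W \<xi>) * cnj (h \<xi>)))\<^sup>2) \<le> norm (B * (W \<xi> * (norm (h \<xi>))\<^sup>2))"
        using W0[of \<xi>] B0 by (simp add: norm_mult power_mult_distrib power2_eq_square abs_mult mult_ac)
    qed
  qed measurable
  moreover have "\<forall>\<xi>. \<bar>of_int j\<bar> + 1 < \<bar>\<xi>\<bar> \<longrightarrow> of_real (W \<xi>) * cnj (h \<xi>) = 0"
  proof (intro allI impI)
    fix \<xi> :: real assume "\<bar>of_int j\<bar> + 1 < \<bar>\<xi>\<bar>"
    then have "\<xi> \<notin> {of_int j..<of_int j + 1}" by auto
    then have "W \<xi> = 0" using W unfolding interval_weight_def by blast
    then show "of_real (W \<xi>) * cnj (h \<xi>) = 0" by simp
  qed
  ultimately show ?thesis unfolding compact_L2_def sqint_def by auto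
qed

lemma ip_weighted:
  assumes W: "interval_weight j W" and h: "sqint (weighted W) h" and f: "sqint cyl f"
    and [measurable]: "a \<in> borel_measurable borel"
  shows "ip (weighted W) h (\<lambda>\<xi>. of_real (a \<xi>) * fourier f k \<xi>) =
    pairing f k (\<lambda>\<xi>. of_real (a \<xi>) * (of_real (W \<xi>) * cnj (h \<xi>)))"
proof -
  have [measurable]: "h \<in> borel_measurable borel" using sqint_measurable[OF h] by simp
  have [measurable]: "fourier f k \<in> borel_measurable borel" by (rule fourier_measurable[OF f])
  show ?thesis
    unfolding ip_def pairing_def
    by (subst integral_weighted(1)[OF W]) (auto simp: inner_complex_def algebra_simps)
qed

text \<open>For \<open>k = 0\<close> the quotient is zero, also at \<open>\<xi> = 0\<close>, where the denominator vanishes. This agrees with the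
  vanishing of \<open>\<Theta>\<close> at \<open>k = 0\<close>.\<close>

definition shear_symbol :: "int \<Rightarrow> real \<Rightarrow> real \<Rightarrow> real" where
  "shear_symbol k s \<xi> = (of_int k)\<^sup>2 / ((of_int k)\<^sup>2 + (\<xi> - of_int k * s)\<^sup>2)"

text \<open>With values in pairs, one application of \<open>energy_has_derivative\<close> treats the sum of both energies.\<close>

definition state ::
    "(real \<Rightarrow> real \<times> real \<Rightarrow> real) \<Rightarrow> (real \<Rightarrow> real \<times> real \<Rightarrow> real) \<Rightarrow> int \<Rightarrow> real \<Rightarrow> real \<Rightarrow> complex \<times> complex" where
  "state \<omega> \<theta> k s \<xi> = (fourier (\<omega> s) k \<xi>, fourier (weak_dx (\<theta> s)) k \<xi>)"

definition rate ::
    "real \<Rightarrow> real \<Rightarrow> (real \<Rightarrow> real \<times> real \<Rightarrow> real) \<Rightarrow> (real \<Rightarrow> real \<times> real \<Rightarrow> real) \<Rightarrow>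
      int \<Rightarrow> real \<Rightarrow> real \<Rightarrow> complex \<times> complex" where
  "rate \<nu> \<alpha> \<omega> \<theta> k s \<xi> =
     (of_real (- \<nu> * (\<xi> - of_int k * s)\<^sup>2) * fourier (\<omega> s) k \<xi> + fourier (weak_dx (\<theta> s)) k \<xi>,
      of_real (- \<alpha> * shear_symbol k s \<xi>) * fourier (\<omega> s) k \<xi>)"

lemma shear_symbol_bounds: "0 \<le> shear_symbol k s \<xi>" "shear_symbol k s \<xi> \<le> 1"
proof -
  have "0 \<le> a / (a + b) \<and> a / (a + b) \<le> 1" if "0 \<le> a" "0 \<le> b" for a b :: real
    using that by (cases "a + b = 0") (auto simp: divide_le_eq)
  then show "0 \<le> shear_symbol k s \<xi>" "shear_symbol k s \<xi> \<le> 1"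
    unfolding shear_symbol_def by simp_all
qed

section \<open>The equations in frequency\<close>

lemma ip_mode_add:
  assumes "sqint cyl f" "sqint lborel u" "sqint lborel v"
  shows "ip cyl f (mode k (\<lambda>y. u y + v y)) = ip cyl f (mode k u) + ip cyl f (mode k v)"
proof -
  have "mode k (\<lambda>y. u y + v y) = (\<lambda>p. mode k u p + mode k v p)"
    by (rule ext) (rule mode_add)
  then show ?thesis using assms by (simp add: ip_add_right sqint_mode)
qed

lemma ip_mode_real: "ip cyl f (mode k (\<lambda>y. of_real r * u y)) = r * ip cyl f (mode k u)"
proof -
  have "mode k (\<lambda>y. of_real r * u y) = (\<lambda>p. r *\<^sub>R mode k u p)"
    by (rule ext) (simp add: mode_real)
  then show ?thesis by (simp only: ip_scaleR_right)
qed

lemma pairing_add: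
  assumes "sqint cyl f" "compact_L2 g" "compact_L2 h"
  shows "pairing f k (\<lambda>\<xi>. g \<xi> + h \<xi>) = pairing f k g + pairing f k h"
  unfolding pairing_def complex_cnj_add
  by (intro ip_add_left sqint_fourier sqint_cnj compact_L2_sqint assms)

lemma pairing_real: "pairing f k (\<lambda>\<xi>. of_real r * h \<xi>) = r * pairing f k h"
  unfolding pairing_def by (simp add: scaleR_conv_of_real[symmetric] ip_scaleR_left)

lemma pairing_limit:
  assumes lim: "L2_tendsto c d" and f: "\<And>r. r \<in> {0..T} \<Longrightarrow> sqint cyl (f r)" "\<And>r. r \<in> {0..T} \<Longrightarrow> nsq cyl (f r) \<le> B"
    and a: "continuous_on {0..T} a"
  shows "uniform_limit {0..T::real} (\<lambda>n r. ip cyl (f r) (mode k (\<lambda>y. a r * c n y)))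
     (\<lambda>r. ip cyl (f r) (mode k (\<lambda>y. a r * d y))) sequentially"
proof -
  have "bounded (a ` {0..T})"
    by (intro compact_imp_bounded compact_continuous_image a) auto
  then obtain A where "\<And>r. r \<in> {0..T} \<Longrightarrow> norm (a r) \<le> A" unfolding bounded_iff by blast
  then show ?thesis by (intro L2_tendsto_pairing[OF lim f]) auto
qed

lemma parseval_scale:
  assumes "sqint cyl f" "compact_L2 h"
  shows "ip cyl f (mode k (\<lambda>y. a * ft h y)) = 2 * pi * pairing f k (\<lambda>\<xi>. a * h \<xi>)"
proof -
  have "(\<lambda>y. a * ft h y) = ft (\<lambda>\<xi>. a * h \<xi>)" by (rule ext) (rule ft_scale[symmetric])
  moreover have "compact_L2 (\<lambda>\<xi>. a * h \<xi>)" by (intro compact_L2_mult assms continuous_intros)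
  ultimately show ?thesis using parseval[OF assms(1)] by simp
qed

text \<open>For \<open>k \<noteq> 0\<close> a mode has mean zero in \<open>x\<close>, so it does not see the \<open>x\<close>-average of \<open>w\<close>. The truncation to the
  support of \<open>c\<close> serves to have an integrable average.\<close>

lemma x_mean_pairing:
  assumes w: "sqint cyl w" and k: "k \<noteq> 0" and c: "smooth_compact c"
  shows "(LINT p|cyl. (w p - x_mean w (snd p)) * mode k c p) = ip cyl w (mode k c)"
proof -
  from c obtain R where sm: "smooth c" and R: "\<And>y. R < \<bar>y\<bar> \<Longrightarrow> c y = 0" by (auto simp: smooth_compact_def)
  have cont: "continuous_on UNIV c" by (rule smooth_continuous[OF sm])
  have [measurable]: "c \<in> borel_measurable borel" by (rule borel_measurable_continuous_onI[OF cont])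
  obtain B where B: "\<And>y. norm (c y) \<le> B" using bounded_compact_support[OF cont R] by blast
  let ?g = "\<lambda>p. indicator {-R..R} (snd p) * w p"
  define m where "m y = (LINT x|circle. ?g (x, y))" for y
  have g: "integrable (circle \<Otimes>\<^sub>M lborel) (case_prod (\<lambda>x y. ?g (x, y)))"
    using integrable_cyl_trunc[OF w, of R] unfolding cyl_eq by (simp add: case_prod_beta')
  have m: "integrable lborel m"
    unfolding m_def by (rule cyl.integrable_snd[OF g])
  have [measurable]: "m \<in> borel_measurable borel" using m by auto
  have ms: "integrable cyl (\<lambda>p. m (snd p))"
    unfolding cyl_eq
  proof (rule cyl.Fubini_integrable)
    show "(\<lambda>p. m (snd p)) \<in> borel_measurable (circle \<Otimes>\<^sub>M lborel)" by measurable
    show "integrable circle (\<lambda>x. LINT y|lborel. norm (m (snd (x, y))))" by simp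
    show "AE x in circle. integrable lborel (\<lambda>y. m (snd (x, y)))" using m by simp
  qed
  have z: "x_coeff (\<lambda>p. m (snd p)) k y = 0" for y
  proof -
    have "x_coeff (\<lambda>p. m (snd p)) k y = (LINT x|circle. cis (of_int (- k) * x)) * of_real (m y)"
      unfolding x_coeff_def by simp
    then show ?thesis using k by (simp only: integral_circle_cis) simp
  qed
  have mz: "(LINT p|cyl. m (snd p) * mode k c p) = 0"
    by (subst integral_mode[OF ms _ B]) (simp_all add: z)
  have xm: "x_mean w (snd p) * mode k c p = 1 / (2 * pi) * (m (snd p) * mode k c p)" for p
  proof (cases "\<bar>snd p\<bar> \<le> R")
    case True
    then have "snd p \<in> {-R..R}" by (simp add: abs_le_iff)
    then have "m (snd p) = (LINT x|circle. w (x, snd p))" by (simp add: m_def)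
    also have "\<dots> = (LBINT x:{0..<2 * pi}. w (x, snd p))"
      unfolding circle_def set_lebesgue_integral_def by (rule integral_restrict_space) simp
    finally show ?thesis by (simp add: x_mean_def)
  next
    case False
    then have "mode k c p = 0" using R[of "snd p"] by (simp add: mode_def)
    then show ?thesis by simp
  qed
  have mi: "integrable cyl (\<lambda>p. m (snd p) * mode k c p)"
  proof (rule Bochner_Integration.integrable_bound)
    show "integrable cyl (\<lambda>p. B * norm (m (snd p)))" using ms by simp
    show "(\<lambda>p. m (snd p) * mode k c p) \<in> borel_measurable cyl"
      unfolding mode_def by measurable
    show "AE p in cyl. norm (m (snd p) * mode k c p) \<le> norm (B * norm (m (snd p)))"
    proof (rule AE_I2)
      fix p
      have "norm (mode k c p) \<le> norm (cis (- (of_int k * fst p)) * c (snd p))"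
        unfolding mode_def real_norm_def by (rule abs_Re_le_cmod)
      also have "\<dots> \<le> B" using B by (simp add: norm_mult)
      finally have "norm (mode k c p) * norm (m (snd p)) \<le> B * norm (m (snd p))"
        by (intro mult_right_mono) auto
      also have "\<dots> \<le> \<bar>B * norm (m (snd p))\<bar>" by (rule abs_ge_self)
      finally show "norm (m (snd p) * mode k c p) \<le> norm (B * norm (m (snd p)))"
        by (simp only: abs_mult[of "m (snd p)"] real_norm_def mult.commute)
    qed
  qed
  have wi: "integrable cyl (\<lambda>p. w p * mode k c p)"
    using sqint_inner[OF w sqint_mode(1)[OF sqint_smooth_compact[OF c]]] by simp
  have "(LINT p|cyl. (w p - x_mean w (snd p)) * mode k c p) =
     (LINT p|cyl. w p * mode k c p - 1 / (2 * pi) * (m (snd p) * mode k c p))"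
    by (simp only: left_diff_distrib xm)
  also have "\<dots> = (LINT p|cyl. w p * mode k c p) - 1 / (2 * pi) * (LINT p|cyl. m (snd p) * mode k c p)"
    using wi mi by (subst Bochner_Integration.integral_diff) auto
  finally show ?thesis by (simp add: mz ip_def)
qed

lemma has_real_derivative_transform:
  fixes f g :: "real \<Rightarrow> real"
  assumes "t \<in> S" "\<And>s. s \<in> S \<Longrightarrow> g s = f s" "(f has_real_derivative D) (at t within S)"
  shows "(g has_real_derivative D) (at t within S)"
  using has_derivative_transform[OF assms(1) assms(2) assms(3)[unfolded has_field_derivative_def]]
  unfolding has_field_derivative_def by blast

context
  fixes \<nu> \<alpha> :: real and \<omega> \<theta> :: "real \<Rightarrow> real \<times> real \<Rightarrow> real"
  assumes sol: "boussinesq_solution \<nu> \<alpha> \<omega> \<theta>"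
begin

abbreviation \<Theta> :: "real \<Rightarrow> real \<times> real \<Rightarrow> real" where
  "\<Theta> t \<equiv> weak_dx (\<theta> t)"

lemma sqint_sol: "0 \<le> t \<Longrightarrow> sqint cyl (\<omega> t)" "0 \<le> t \<Longrightarrow> sqint cyl (\<Theta> t)"
  using sol by (auto simp: boussinesq_solution_def intro: cyl_L2_sqint)

lemma bounded_sol:
  obtains B where "\<And>t. t \<in> {0..T} \<Longrightarrow> nsq cyl (\<omega> t) \<le> B" "\<And>t. t \<in> {0..T} \<Longrightarrow> nsq cyl (\<Theta> t) \<le> B"
proof -
  obtain B where B: "\<forall>t\<in>{0..T}. L2_norm (\<omega> t) \<le> B \<and> L2_norm (\<Theta> t) \<le> B"
    using sol unfolding boussinesq_solution_def by blast
  have "nsq cyl f \<le> B\<^sup>2" if "L2_norm f \<le> B" for f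
    using that sqrt_le_D[of "nsq cyl f" B] by (simp add: L2_norm_def nsq_eq)
  then show ?thesis using B that[of "B\<^sup>2"] by auto
qed

lemma dx_pairing:
  assumes "0 \<le> t" "test_fun \<phi>"
  shows "(LINT p|cyl. \<theta> t p * pdx \<phi> p) = - ip cyl (\<Theta> t) \<phi>"
  using sol assms by (auto simp: boussinesq_solution_def has_weak_dx_def ip_def)

lemma omega_mode_deriv:
  assumes c: "smooth_compact c" "\<And>y. (c has_vector_derivative c1 y) (at y)" "\<And>y. (c1 has_vector_derivative c2 y) (at y)"
    and t: "0 \<le> t"
  shows "((\<lambda>s. ip cyl (\<omega> s) (mode k c)) has_real_derivative
    \<nu> * ip cyl (\<omega> t) (mode k (\<lambda>y. c2 y + 2 * \<i> * of_real t * of_int k * c1 y - of_real (t\<^sup>2 * (of_int k)\<^sup>2) * c y))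
    + ip cyl (\<Theta> t) (mode k c)) (at t within {0..})"
proof -
  have "((\<lambda>s. LINT p|cyl. \<omega> s p * mode k c p) has_real_derivative
           \<nu> * (LINT p|cyl. \<omega> t p * shear_dy t (shear_dy t (mode k c)) p)
           - (LINT p|cyl. \<theta> t p * pdx (mode k c) p)) (at t within {0..})"
    using sol t test_fun_mode[OF c(1), of k] unfolding boussinesq_solution_def by blast
  then show ?thesis
    unfolding dx_pairing[OF t test_fun_mode[OF c(1)]] shear_mode(1)[OF c(2,3)] by (simp add: ip_def)
qed

text \<open>\<open>\<Theta> = \<partial>\<^sub>x\<theta>\<close>, \<open>\<theta>' = \<alpha> v\<^sub>2\<close> and \<open>v\<^sub>2 = -\<partial>\<^sub>x\<psi>\<close>, where each \<open>\<partial>\<^sub>x\<close> moved to the mode is a factor \<open>-\<i>k\<close>.\<close>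

lemma Theta_mode_deriv:
  obtains \<psi> where "\<And>t. 0 \<le> t \<Longrightarrow> inv_shear_laplacian t (\<omega> t) (\<psi> t)"
    "\<And>t k c. 0 \<le> t \<Longrightarrow> smooth_compact c \<Longrightarrow>
      ((\<lambda>s. ip cyl (\<Theta> s) (mode k c)) has_real_derivative \<alpha> * (of_int k)\<^sup>2 * ip cyl (\<psi> t) (mode k c)) (at t within {0..})"
proof -
  obtain v2 where v2: "\<And>t. 0 \<le> t \<Longrightarrow> is_v2 t (\<omega> t) (v2 t)"
    and d: "\<And>\<phi> t. test_fun \<phi> \<Longrightarrow> 0 \<le> t \<Longrightarrow> ((\<lambda>s. LINT p|cyl. \<theta> s p * \<phi> p) has_real_derivative
              \<alpha> * (LINT p|cyl. v2 t p * \<phi> p)) (at t within {0..})"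
    using sol unfolding boussinesq_solution_def by blast
  have "\<forall>t. \<exists>\<psi>. 0 \<le> t \<longrightarrow> inv_shear_laplacian t (\<omega> t) \<psi> \<and> has_weak_dx \<psi> (\<lambda>p. - v2 t p)"
    using v2 unfolding is_v2_def by blast
  then obtain \<psi> where \<psi>: "\<And>t. 0 \<le> t \<Longrightarrow> inv_shear_laplacian t (\<omega> t) (\<psi> t)"
    "\<And>t. 0 \<le> t \<Longrightarrow> has_weak_dx (\<psi> t) (\<lambda>p. - v2 t p)" by metis
  show ?thesis
  proof (rule that[OF \<psi>(1)])
    fix t k c assume t: "0 \<le> (t::real)" and c: "smooth_compact c"
    let ?c = "\<lambda>y. - \<i> * of_int k * c y"
    have c': "smooth_compact ?c" by (rule smooth_compact_scale[OF c])
    have "(LINT p|cyl. - v2 t p * mode k ?c p) = - (LINT p|cyl. \<psi> t p * pdx (mode k ?c) p)"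
      using \<psi>(2)[OF t] test_fun_mode[OF c'] unfolding has_weak_dx_def by blast
    also have "pdx (mode k ?c) = (\<lambda>p. - (of_int k)\<^sup>2 * mode k c p)"
      unfolding pdx_mode by (rule ext) (simp add: mode_def power2_eq_square algebra_simps)
    also have "(LINT p|cyl. \<psi> t p * (- (of_int k)\<^sup>2 * mode k c p)) = - (of_int k)\<^sup>2 * ip cyl (\<psi> t) (mode k c)"
      unfolding ip_def by (subst integral_mult_right_zero[symmetric]) (simp add: mult_ac)
    finally have v: "(LINT p|cyl. v2 t p * mode k ?c p) = - (of_int k)\<^sup>2 * ip cyl (\<psi> t) (mode k c)"
      by simp
    have "((\<lambda>s. - (LINT p|cyl. \<theta> s p * mode k ?c p)) has_real_derivative
        - (\<alpha> * (LINT p|cyl. v2 t p * mode k ?c p))) (at t within {0..})"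
      by (intro DERIV_minus d test_fun_mode c' t)
    then have "((\<lambda>s. - (LINT p|cyl. \<theta> s p * mode k ?c p)) has_real_derivative
        \<alpha> * (of_int k)\<^sup>2 * ip cyl (\<psi> t) (mode k c)) (at t within {0..})"
      unfolding v by (simp add: mult_ac)
    then show "((\<lambda>s. ip cyl (\<Theta> s) (mode k c)) has_real_derivative
        \<alpha> * (of_int k)\<^sup>2 * ip cyl (\<psi> t) (mode k c)) (at t within {0..})"
    proof (rule has_real_derivative_transform[rotated 2])
      fix s :: real assume "s \<in> {0..}"
      then show "ip cyl (\<Theta> s) (mode k c) = - (LINT p|cyl. \<theta> s p * mode k ?c p)"
        using dx_pairing[OF _ test_fun_mode[OF c], of s k] unfolding pdx_mode by simp
    qed (use t in simp)
  qed
qed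

text \<open>The differentiated function is \<open>\<Theta>(s)\<close> tested against \<open>\<Delta>\<^sub>s\<close> of the mode, sorted by powers of \<open>s\<close>, since the equations
  are only available for test functions that do not depend on time. The terms with \<open>\<psi>\<close> recombine to \<open>\<psi>\<close> tested against
  \<open>\<Delta>\<^sub>t\<close> of the mode, which is \<open>\<omega>\<close> tested against the mode.\<close>

lemma Theta_laplacian_deriv:
  assumes c: "smooth_compact c" "\<And>y. (c has_vector_derivative c1 y) (at y)" "\<And>y. (c1 has_vector_derivative c2 y) (at y)"
    and t: "0 \<le> t" and k: "k \<noteq> 0"
  shows "((\<lambda>s. ip cyl (\<Theta> s) (mode k (\<lambda>y. c2 y - of_real ((of_int k)\<^sup>2) * c y))
        + s * ip cyl (\<Theta> s) (mode k (\<lambda>y. 2 * \<i> * of_int k * c1 y))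
        + s\<^sup>2 * ip cyl (\<Theta> s) (mode k (\<lambda>y. - of_real ((of_int k)\<^sup>2) * c y))) has_real_derivative
     \<alpha> * (of_int k)\<^sup>2 * ip cyl (\<omega> t) (mode k c) + ip cyl (\<Theta> t) (mode k (\<lambda>y. 2 * \<i> * of_int k * c1 y))
        + 2 * t * ip cyl (\<Theta> t) (mode k (\<lambda>y. - of_real ((of_int k)\<^sup>2) * c y))) (at t within {0..})"
proof -
  obtain \<psi> where \<psi>: "\<And>t. 0 \<le> t \<Longrightarrow> inv_shear_laplacian t (\<omega> t) (\<psi> t)"
    and d: "\<And>t k c. 0 \<le> t \<Longrightarrow> smooth_compact c \<Longrightarrow>
      ((\<lambda>s. ip cyl (\<Theta> s) (mode k c)) has_real_derivative \<alpha> * (of_int k)\<^sup>2 * ip cyl (\<psi> t) (mode k c)) (at t within {0..})"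
    using Theta_mode_deriv by blast
  have C1: "smooth_compact c1" by (rule smooth_compact_deriv[OF c(1,2)])
  have C2: "smooth_compact c2" by (rule smooth_compact_deriv[OF C1 c(3)])
  let ?e0 = "\<lambda>y. c2 y - of_real ((of_int k)\<^sup>2) * c y" and ?e1 = "\<lambda>y. 2 * \<i> * of_int k * c1 y"
    and ?e2 = "\<lambda>y. - of_real ((of_int k)\<^sup>2) * c y"
  have E1: "smooth_compact ?e1" by (rule smooth_compact_scale[OF C1])
  have E2: "smooth_compact ?e2" by (rule smooth_compact_scale[OF c(1)])
  have E0: "smooth_compact ?e0" using smooth_compact_add[OF C2 E2] by simp
  have \<psi>2: "sqint cyl (\<psi> t)" using \<psi>[OF t] by (simp add: inv_shear_laplacian_def cyl_L2_sqint)
  let ?Q = "\<lambda>e. ip cyl (\<psi> t) (mode k e)"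
  note sq = sqint_smooth_compact[OF E0] sqint_smooth_compact[OF E1] sqint_smooth_compact[OF E2]
  have s1: "sqint lborel (\<lambda>y. of_real t * ?e1 y)" "sqint lborel (\<lambda>y. of_real (t\<^sup>2) * ?e2 y)"
    by (intro sqint_cmult sq)+
  have "ip cyl (\<omega> t) (mode k c) = (LINT p|cyl. (\<omega> t p - x_mean (\<omega> t) (snd p)) * mode k c p)"
    by (rule x_mean_pairing[OF sqint_sol(1)[OF t] k c(1), symmetric])
  also have "\<dots> = (LINT p|cyl. \<psi> t p * shear_laplacian t (mode k c) p)"
    using \<psi>[OF t] test_fun_mode[OF c(1), of k] unfolding inv_shear_laplacian_def by auto
  also have "shear_laplacian t (mode k c) = mode k (\<lambda>y. (?e0 y + of_real t * ?e1 y) + of_real (t\<^sup>2) * ?e2 y)"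
    unfolding shear_mode(2)[OF c(2,3)] by (intro arg_cong[of _ _ "mode k"] ext) (simp add: algebra_simps)
  also have "(LINT p|cyl. \<psi> t p * mode k (\<lambda>y. (?e0 y + of_real t * ?e1 y) + of_real (t\<^sup>2) * ?e2 y) p) =
     ip cyl (\<psi> t) (mode k (\<lambda>y. (?e0 y + of_real t * ?e1 y) + of_real (t\<^sup>2) * ?e2 y))"
    by (simp add: ip_def)
  also have "\<dots> = ?Q ?e0 + t * ?Q ?e1 + t\<^sup>2 * ?Q ?e2"
    by (simp only: ip_mode_add[OF \<psi>2 sqint_add[OF sq(1) s1(1)] s1(2)] ip_mode_add[OF \<psi>2 sq(1) s1(1)] ip_mode_real)
  finally have Q: "ip cyl (\<omega> t) (mode k c) = ?Q ?e0 + t * ?Q ?e1 + t\<^sup>2 * ?Q ?e2" .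
  show ?thesis
    by (rule derivative_eq_intros d[OF t E0] d[OF t E1] d[OF t E2] refl)+
      (simp add: Q algebra_simps)
qed

text \<open>The weak vorticity equation for the cut-off waves, in the limit of large cutoffs: on the frequency side
  \<open>(\<partial>\<^sub>y - t\<partial>\<^sub>x)\<^sup>2\<close> becomes the multiplier \<open>-(\<xi> - kt)\<^sup>2\<close>.\<close>

lemma omega_pairing_deriv:
  assumes h: "compact_L2 h" and t: "t \<in> {0..T}"
  shows "((\<lambda>s. pairing (\<omega> s) k h) has_real_derivative
     - \<nu> * pairing (\<omega> t) k (\<lambda>\<xi>. of_real ((\<xi> - of_int k * t)\<^sup>2) * h \<xi>) + pairing (\<Theta> t) k h) (at t within {0..T})"
proof -
  let ?h1 = "\<lambda>\<xi>. - \<i> * of_real \<xi> * h \<xi>" and ?h2 = "\<lambda>\<xi>. - of_real (\<xi>\<^sup>2) * h \<xi>"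
  have h1: "compact_L2 ?h1" by (intro compact_L2_mult h continuous_intros)
  have h2: "compact_L2 ?h2" by (intro compact_L2_mult h continuous_intros)
  obtain c c1 c2 where C: "\<And>n. smooth_compact (c n)"
    "\<And>n y. (c n has_vector_derivative c1 n y) (at y)" "\<And>n y. (c1 n has_vector_derivative c2 n y) (at y)"
    and lim: "L2_tendsto c (ft h)" "L2_tendsto c1 (ft ?h1)" "L2_tendsto c2 (ft ?h2)"
    by (rule cutoff_exists[OF h], rule that)
  have C1: "smooth_compact (c1 n)" for n by (rule smooth_compact_deriv[OF C(1,2)])
  have C2: "smooth_compact (c2 n)" for n by (rule smooth_compact_deriv[OF C1 C(3)])
  obtain B where B: "\<And>t. t \<in> {0..T} \<Longrightarrow> nsq cyl (\<omega> t) \<le> B" "\<And>t. t \<in> {0..T} \<Longrightarrow> nsq cyl (\<Theta> t) \<le> B"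
    using bounded_sol by blast
  have s\<omega>: "sqint cyl (\<omega> r)" and s\<Theta>: "sqint cyl (\<Theta> r)" if "r \<in> {0..T}" for r
    using that sqint_sol by auto
  let ?P = "\<lambda>f a u r. ip cyl (f r) (mode k (\<lambda>y. a r * u y))"
  let ?a0 = "\<lambda>r. complex_of_real (- \<nu> * r\<^sup>2 * (of_int k)\<^sup>2)" and ?a1 = "\<lambda>r. 2 * \<i> * of_real (\<nu> * r * of_int k)"
    and ?a2 = "\<lambda>r::real. complex_of_real \<nu>" and ?one = "\<lambda>r::real. 1::complex"
  define F where "F n r = ?P \<omega> ?one (c n) r" for n r
  define G where "G n r = ?P \<omega> ?a2 (c2 n) r + ?P \<omega> ?a1 (c1 n) r + ?P \<omega> ?a0 (c n) r + ?P \<Theta> ?one (c n) r" for n r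
  define F0 where "F0 r = ?P \<omega> ?one (ft h) r" for r
  define G0 where "G0 r = ?P \<omega> ?a2 (ft ?h2) r + ?P \<omega> ?a1 (ft ?h1) r + ?P \<omega> ?a0 (ft h) r + ?P \<Theta> ?one (ft h) r" for r
  have main: "(F0 has_real_derivative G0 t) (at t within {0..T})"
  proof (rule derivative_uniform_limit[where F=F and G=G])
    fix n r assume r: "r \<in> {0..T}"
    then have r0: "0 \<le> r" by simp
    note sq = sqint_smooth_compact[OF C(1)[of n]] sqint_smooth_compact[OF C1[of n]] sqint_smooth_compact[OF C2[of n]]
    have e: "\<nu> * ip cyl (\<omega> r) (mode k (\<lambda>y. c2 n y + 2 * \<i> * of_real r * of_int k * c1 n y - of_real (r\<^sup>2 * (of_int k)\<^sup>2) * c n y))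
      = ?P \<omega> ?a2 (c2 n) r + ?P \<omega> ?a1 (c1 n) r + ?P \<omega> ?a0 (c n) r"
    proof -
      have e': "(\<lambda>y. of_real \<nu> * (c2 n y + 2 * \<i> * of_real r * of_int k * c1 n y - of_real (r\<^sup>2 * (of_int k)\<^sup>2) * c n y))
         = (\<lambda>y. (?a2 r * c2 n y + ?a1 r * c1 n y) + ?a0 r * c n y)"
        by (rule ext) (simp add: algebra_simps)
      show ?thesis
        unfolding ip_mode_real[symmetric] e'
        by (subst ip_mode_add[OF s\<omega>[OF r]], intro sqint_add sqint_cmult sq, intro sqint_cmult sq)
          (subst ip_mode_add[OF s\<omega>[OF r]], intro sqint_cmult sq, intro sqint_cmult sq, simp)
    qed
    have "(F n has_real_derivative G n r) (at r within {0..})"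
      using omega_mode_deriv[OF C r0, of k n] unfolding F_def G_def e by simp
    then show "(F n has_real_derivative G n r) (at r within {0..T})"
      by (rule has_field_derivative_subset) auto
    show "(\<lambda>n. F n r) \<longlonglongrightarrow> F0 r"
      unfolding F_def F0_def
      by (rule tendsto_uniform_limitI[OF pairing_limit[OF lim(1) s\<omega> B(1)] r]) (auto intro!: continuous_intros)
  next
    show "uniform_limit {0..T} G G0 sequentially"
      unfolding G_def G0_def
      by (intro uniform_limit_add pairing_limit[where B=B] lim s\<omega> s\<Theta> B continuous_intros; assumption)
  qed (use t in auto)
  have F0: "F0 r = 2 * pi * pairing (\<omega> r) k h" if "r \<in> {0..T}" for r
    unfolding F0_def using parseval[OF s\<omega>[OF that] h] by simp
  have G0: "G0 t = 2 * pi * (- \<nu> * pairing (\<omega> t) k (\<lambda>\<xi>. of_real ((\<xi> - of_int k * t)\<^sup>2) * h \<xi>) + pairing (\<Theta> t) k h)"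
  proof -
    have L2: "compact_L2 (\<lambda>\<xi>. ?a2 t * ?h2 \<xi>)" "compact_L2 (\<lambda>\<xi>. ?a1 t * ?h1 \<xi>)" "compact_L2 (\<lambda>\<xi>. ?a0 t * h \<xi>)"
      by (intro compact_L2_mult h h1 h2 continuous_intros)+
    note L3 = compact_L2_add[OF L2(1,2)]
    have "G0 t = 2 * pi * (pairing (\<omega> t) k (\<lambda>\<xi>. (?a2 t * ?h2 \<xi> + ?a1 t * ?h1 \<xi>) + ?a0 t * h \<xi>) + pairing (\<Theta> t) k h)"
      unfolding G0_def parseval_scale[OF s\<omega>[OF t] h] parseval_scale[OF s\<omega>[OF t] h1] parseval_scale[OF s\<omega>[OF t] h2]
        parseval_scale[OF s\<Theta>[OF t] h] pairing_add[OF s\<omega>[OF t] L3 L2(3)] pairing_add[OF s\<omega>[OF t] L2(1,2)]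
      by (simp add: algebra_simps)
    also have "(\<lambda>\<xi>. (?a2 t * ?h2 \<xi> + ?a1 t * ?h1 \<xi>) + ?a0 t * h \<xi>) = (\<lambda>\<xi>. of_real (- \<nu>) * (of_real ((\<xi> - of_int k * t)\<^sup>2) * h \<xi>))"
      by (rule ext) (simp add: complex_eq_iff power2_eq_square algebra_simps)
    finally show ?thesis by (simp only: pairing_real)
  qed
  have "((\<lambda>r. 2 * pi * pairing (\<omega> r) k h) has_real_derivative G0 t) (at t within {0..T})"
    by (rule has_real_derivative_transform[OF t _ main]) (simp add: F0)
  from DERIV_cmult[OF this, of "1 / (2 * pi)"] show ?thesis unfolding G0 by simp
qed

text \<open>The same limit in \<open>Theta_laplacian_deriv\<close>; the symbol of \<open>-\<Delta>\<^sub>s\<close> is \<open>k\<^sup>2 + (\<xi> - ks)\<^sup>2\<close>.\<close>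

lemma Theta_pairing_deriv:
  assumes h: "compact_L2 h" and t: "t \<in> {0..T}" and k: "k \<noteq> 0"
  shows "((\<lambda>s. pairing (\<Theta> s) k (\<lambda>\<xi>. of_real ((of_int k)\<^sup>2 + (\<xi> - of_int k * s)\<^sup>2) * h \<xi>)) has_real_derivative
     - \<alpha> * (of_int k)\<^sup>2 * pairing (\<omega> t) k h
     - pairing (\<Theta> t) k (\<lambda>\<xi>. of_real (2 * of_int k * (\<xi> - of_int k * t)) * h \<xi>)) (at t within {0..T})"
proof -
  let ?h1 = "\<lambda>\<xi>. - \<i> * of_real \<xi> * h \<xi>" and ?h2 = "\<lambda>\<xi>. - of_real (\<xi>\<^sup>2) * h \<xi>"
  have h1: "compact_L2 ?h1" by (intro compact_L2_mult h continuous_intros)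
  have h2: "compact_L2 ?h2" by (intro compact_L2_mult h continuous_intros)
  obtain c c1 c2 where C: "\<And>n. smooth_compact (c n)"
    "\<And>n y. (c n has_vector_derivative c1 n y) (at y)" "\<And>n y. (c1 n has_vector_derivative c2 n y) (at y)"
    and lim: "L2_tendsto c (ft h)" "L2_tendsto c1 (ft ?h1)" "L2_tendsto c2 (ft ?h2)"
    by (rule cutoff_exists[OF h], rule that)
  have C1: "smooth_compact (c1 n)" for n by (rule smooth_compact_deriv[OF C(1,2)])
  have C2: "smooth_compact (c2 n)" for n by (rule smooth_compact_deriv[OF C1 C(3)])
  obtain B where B: "\<And>t. t \<in> {0..T} \<Longrightarrow> nsq cyl (\<omega> t) \<le> B" "\<And>t. t \<in> {0..T} \<Longrightarrow> nsq cyl (\<Theta> t) \<le> B"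
    using bounded_sol by blast
  have s\<omega>: "sqint cyl (\<omega> r)" and s\<Theta>: "sqint cyl (\<Theta> r)" if "r \<in> {0..T}" for r
    using that sqint_sol by auto
  let ?P = "\<lambda>f a u r. ip cyl (f r) (mode k (\<lambda>y. a r * u y))"
  let ?K = "real_of_int k"
  let ?b2 = "\<lambda>r::real. 1::complex" and ?b1 = "\<lambda>r. complex_of_real r * (2 * \<i> * of_int k)"
    and ?b0 = "\<lambda>r. complex_of_real (- ?K\<^sup>2 - r\<^sup>2 * ?K\<^sup>2)"
  let ?d0 = "\<lambda>r::real. complex_of_real (\<alpha> * ?K\<^sup>2)" and ?d1 = "\<lambda>r::real. 2 * \<i> * of_int k" and ?d2 = "\<lambda>r. complex_of_real (- 2 * r * ?K\<^sup>2)"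
  define F where "F n r = ?P \<Theta> ?b2 (c2 n) r + ?P \<Theta> ?b1 (c1 n) r + ?P \<Theta> ?b0 (c n) r" for n r
  define G where "G n r = ?P \<omega> ?d0 (c n) r + ?P \<Theta> ?d1 (c1 n) r + ?P \<Theta> ?d2 (c n) r" for n r
  define F0 where "F0 r = ?P \<Theta> ?b2 (ft ?h2) r + ?P \<Theta> ?b1 (ft ?h1) r + ?P \<Theta> ?b0 (ft h) r" for r
  define G0 where "G0 r = ?P \<omega> ?d0 (ft h) r + ?P \<Theta> ?d1 (ft ?h1) r + ?P \<Theta> ?d2 (ft h) r" for r
  have Flim: "uniform_limit {0..T} F F0 sequentially"
    unfolding F_def F0_def
    by (intro uniform_limit_add pairing_limit[where B=B] lim s\<omega> s\<Theta> B continuous_intros; assumption)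
  have main: "(F0 has_real_derivative G0 t) (at t within {0..T})"
  proof (rule derivative_uniform_limit[where F=F and G=G])
    fix n r assume r: "r \<in> {0..T}"
    then have r0: "0 \<le> r" by simp
    note sq = sqint_smooth_compact[OF C(1)[of n]] sqint_smooth_compact[OF C1[of n]] sqint_smooth_compact[OF C2[of n]]
    have eF: "F n s = ip cyl (\<Theta> s) (mode k (\<lambda>y. c2 n y - of_real (?K\<^sup>2) * c n y))
        + s * ip cyl (\<Theta> s) (mode k (\<lambda>y. 2 * \<i> * of_int k * c1 n y))
        + s\<^sup>2 * ip cyl (\<Theta> s) (mode k (\<lambda>y. - of_real (?K\<^sup>2) * c n y))" if "s \<in> {0..T}" for s
    proof -
      have 1: "?P \<Theta> ?b1 (c1 n) s = s * ip cyl (\<Theta> s) (mode k (\<lambda>y. 2 * \<i> * of_int k * c1 n y))"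
        unfolding ip_mode_real[symmetric] by (simp only: mult.assoc)
      have 2: "?P \<Theta> ?b0 (c n) s = (- ?K\<^sup>2 - s\<^sup>2 * ?K\<^sup>2) * ip cyl (\<Theta> s) (mode k (c n))"
        by (rule ip_mode_real)
      have 3: "ip cyl (\<Theta> s) (mode k (\<lambda>y. - of_real (?K\<^sup>2) * c n y)) = - ?K\<^sup>2 * ip cyl (\<Theta> s) (mode k (c n))"
        unfolding ip_mode_real[symmetric] by simp
      have 4: "ip cyl (\<Theta> s) (mode k (\<lambda>y. c2 n y - of_real (?K\<^sup>2) * c n y)) =
          ip cyl (\<Theta> s) (mode k (c2 n)) - ?K\<^sup>2 * ip cyl (\<Theta> s) (mode k (c n))"
        using ip_mode_add[OF s\<Theta>[OF that] sq(3) sqint_cmult[OF sq(1), of "- of_real (?K\<^sup>2)"], of k] 3 by simp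
      show ?thesis unfolding F_def 1 2 3 4 by (simp add: algebra_simps)
    qed
    have eG: "G n r = \<alpha> * ?K\<^sup>2 * ip cyl (\<omega> r) (mode k (c n)) + ip cyl (\<Theta> r) (mode k (\<lambda>y. 2 * \<i> * of_int k * c1 n y))
        + 2 * r * ip cyl (\<Theta> r) (mode k (\<lambda>y. - of_real (?K\<^sup>2) * c n y))"
    proof -
      have 3: "ip cyl (\<Theta> r) (mode k (\<lambda>y. - of_real (?K\<^sup>2) * c n y)) = - ?K\<^sup>2 * ip cyl (\<Theta> r) (mode k (c n))"
        unfolding ip_mode_real[symmetric] by simp
      show ?thesis unfolding G_def ip_mode_real 3 by simp
    qed
    show "(F n has_real_derivative G n r) (at r within {0..T})"
      unfolding eG
      by (rule has_real_derivative_transform[OF r eF has_field_derivative_subset[OF Theta_laplacian_deriv[OF C r0 k]]]) auto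
    show "(\<lambda>n. F n r) \<longlonglongrightarrow> F0 r"
      by (rule tendsto_uniform_limitI[OF Flim r])
  next
    show "uniform_limit {0..T} G G0 sequentially"
      unfolding G_def G0_def
      by (intro uniform_limit_add pairing_limit[where B=B] lim s\<omega> s\<Theta> B continuous_intros; assumption)
  qed (use t in auto)
  have L: "compact_L2 (\<lambda>\<xi>. a * ?h2 \<xi>)" "compact_L2 (\<lambda>\<xi>. a * ?h1 \<xi>)" "compact_L2 (\<lambda>\<xi>. a * h \<xi>)" for a
    by (intro compact_L2_mult h h1 h2 continuous_intros)+
  have F0: "F0 r = - 2 * pi * pairing (\<Theta> r) k (\<lambda>\<xi>. of_real (?K\<^sup>2 + (\<xi> - ?K * r)\<^sup>2) * h \<xi>)" if r: "r \<in> {0..T}" for r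
  proof -
    have "F0 r = 2 * pi * pairing (\<Theta> r) k (\<lambda>\<xi>. (?b2 r * ?h2 \<xi> + ?b1 r * ?h1 \<xi>) + ?b0 r * h \<xi>)"
      unfolding F0_def parseval_scale[OF s\<Theta>[OF r] h] parseval_scale[OF s\<Theta>[OF r] h1] parseval_scale[OF s\<Theta>[OF r] h2]
        pairing_add[OF s\<Theta>[OF r] compact_L2_add[OF L(1,2)] L(3)] pairing_add[OF s\<Theta>[OF r] L(1,2)]
      by (simp add: algebra_simps)
    also have "(\<lambda>\<xi>. (?b2 r * ?h2 \<xi> + ?b1 r * ?h1 \<xi>) + ?b0 r * h \<xi>) = (\<lambda>\<xi>. of_real (- 1) * (of_real (?K\<^sup>2 + (\<xi> - ?K * r)\<^sup>2) * h \<xi>))"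
      by (rule ext) (simp add: complex_eq_iff power2_eq_square algebra_simps)
    finally show ?thesis by (simp only: pairing_real)
  qed
  have G0: "G0 t = 2 * pi * (\<alpha> * ?K\<^sup>2 * pairing (\<omega> t) k h + pairing (\<Theta> t) k (\<lambda>\<xi>. of_real (2 * ?K * (\<xi> - ?K * t)) * h \<xi>))"
  proof -
    have "G0 t = 2 * pi * (pairing (\<omega> t) k (\<lambda>\<xi>. ?d0 t * h \<xi>) + pairing (\<Theta> t) k (\<lambda>\<xi>. ?d1 t * ?h1 \<xi> + ?d2 t * h \<xi>))"
      unfolding G0_def parseval_scale[OF s\<Theta>[OF t] h] parseval_scale[OF s\<Theta>[OF t] h1] parseval_scale[OF s\<omega>[OF t] h]
        pairing_add[OF s\<Theta>[OF t] L(2,3)]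
      by (simp add: algebra_simps)
    also have "(\<lambda>\<xi>. ?d1 t * ?h1 \<xi> + ?d2 t * h \<xi>) = (\<lambda>\<xi>. of_real (2 * ?K * (\<xi> - ?K * t)) * h \<xi>)"
      by (rule ext) (simp add: complex_eq_iff power2_eq_square algebra_simps)
    finally show ?thesis by (simp only: pairing_real)
  qed
  have "((\<lambda>r. - 2 * pi * pairing (\<Theta> r) k (\<lambda>\<xi>. of_real (?K\<^sup>2 + (\<xi> - ?K * r)\<^sup>2) * h \<xi>)) has_real_derivative G0 t) (at t within {0..T})"
    by (rule has_real_derivative_transform[OF t _ main]) (simp add: F0)
  from DERIV_cmult[OF this, of "- 1 / (2 * pi)"] show ?thesis unfolding G0 by (simp add: algebra_simps)
qed

text \<open>A mode with \<open>k = 0\<close> does not depend on \<open>x\<close>, so the \<open>x\<close>-derivative \<open>\<Theta>\<close> is orthogonal to it.\<close>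

lemma Theta_zero_mode:
  assumes h: "compact_L2 h" and t: "0 \<le> t"
  shows "pairing (\<Theta> t) 0 h = 0"
proof -
  obtain c c1 c2 where C: "\<And>n. smooth_compact (c n)"
    "\<And>n y. (c n has_vector_derivative c1 n y) (at y)" "\<And>n y. (c1 n has_vector_derivative c2 n y) (at y)"
    and lim: "L2_tendsto c (ft h)" "L2_tendsto c1 (ft (\<lambda>\<xi>. - \<i> * of_real \<xi> * h \<xi>))" "L2_tendsto c2 (ft (\<lambda>\<xi>. - of_real (\<xi>\<^sup>2) * h \<xi>))"
    by (rule cutoff_exists[OF h], rule that)
  have "ip cyl (\<Theta> t) (mode 0 (c n)) = 0" for n
    using dx_pairing[OF t test_fun_mode[OF C(1)[of n], of 0]] by (simp add: pdx_mode mode_def)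
  moreover have "(\<lambda>n. ip cyl (\<Theta> t) (mode 0 (\<lambda>y. 1 * c n y))) \<longlonglongrightarrow> ip cyl (\<Theta> t) (mode 0 (\<lambda>y. 1 * ft h y))"
    by (rule tendsto_uniform_limitI[OF L2_tendsto_pairing[OF lim(1), where S="{t}" and f=\<Theta> and B="nsq cyl (\<Theta> t)" and A=1]])
      (use sqint_sol(2)[OF t] in auto)
  ultimately have "ip cyl (\<Theta> t) (mode 0 (ft h)) = 0"
    by (simp add: LIMSEQ_const_iff)
  then show ?thesis using parseval[OF sqint_sol(2)[OF t] h, of 0] by simp
qed

section \<open>Energy on a frequency interval\<close>

lemma pairing_Theta_bounded:
  assumes g: "compact_L2 g"
  obtains A where "\<And>r. r \<in> {0..T} \<Longrightarrow> \<bar>pairing (\<Theta> r) k g\<bar> \<le> A"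
proof -
  obtain B where B: "\<And>t. t \<in> {0..T} \<Longrightarrow> nsq cyl (\<Theta> t) \<le> B"
    using bounded_sol by blast
  let ?m = "mode k (ft g)"
  have m: "sqint cyl ?m" by (rule sqint_mode(1)[OF sqint_ft[OF g]])
  have "\<bar>pairing (\<Theta> r) k g\<bar> \<le> sqrt B * sqrt (nsq cyl ?m) / (2 * pi)" if r: "r \<in> {0..T}" for r
  proof -
    have s: "sqint cyl (\<Theta> r)" using r by (intro sqint_sol(2)) auto
    have "\<bar>2 * pi * pairing (\<Theta> r) k g\<bar> \<le> sqrt (nsq cyl (\<Theta> r)) * sqrt (nsq cyl ?m)"
      unfolding parseval[OF s g, symmetric] by (rule ip_le_sqrt[OF s m])
    also have "\<dots> \<le> sqrt B * sqrt (nsq cyl ?m)"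
      by (intro mult_right_mono real_sqrt_le_mono B r) simp
    finally show ?thesis by (simp add: abs_mult field_simps)
  qed
  then show ?thesis using that by blast
qed

text \<open>The symbol \<open>m\<^sub>s = k\<^sup>2 + (\<xi> - ks)\<^sup>2\<close> is a quadratic polynomial in \<open>s\<close>. With \<open>V\<close> the pairing of \<open>\<Theta>(r)\<close> with \<open>m\<^sub>r h / m\<^sub>t\<close>, expanding
  \<open>m\<^sub>r\<close> around \<open>t\<close> expresses the pairing of \<open>\<Theta>(r)\<close> with \<open>h\<close> through \<open>V\<close> and terms with a factor \<open>r - t\<close>.
  This gives continuity first, for every \<open>h\<close>, and then the derivative, where the contribution of \<open>m\<^sub>t'\<close> cancels.\<close>

lemma Theta_deriv:
  assumes g: "compact_L2 g" and t: "t \<in> {0..T}"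
  shows "((\<lambda>s. pairing (\<Theta> s) k g) has_real_derivative
     - \<alpha> * (of_int k)\<^sup>2 * pairing (\<omega> t) k (\<lambda>\<xi>. of_real (1 / ((of_int k)\<^sup>2 + (\<xi> - of_int k * t)\<^sup>2)) * g \<xi>)) (at t within {0..T})"
proof (cases "k = 0")
  case True
  have "((\<lambda>s. 0) has_real_derivative 0) (at t within {0..T})" by simp
  then have "((\<lambda>s. pairing (\<Theta> s) 0 g) has_real_derivative 0) (at t within {0..T})"
    by (rule has_real_derivative_transform[OF t, rotated]) (use Theta_zero_mode[OF g] in auto)
  with True show ?thesis by simp
next
  case k: False
  let ?k = "real_of_int k"
  let ?F = "at t within {0..T}"
  have k2: "0 < ?k\<^sup>2" using k by simp
  have mpos: "0 < ?k\<^sup>2 + (\<xi> - ?k * s)\<^sup>2" for \<xi> s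
    using k2 by (simp add: add_pos_nonneg)
  have mne: "?k\<^sup>2 + (\<xi> - ?k * s)\<^sup>2 \<noteq> 0" for \<xi> s
    using mpos[of \<xi> s] by (rule less_imp_neq[symmetric])
  have cancel: "x \<noteq> 0 \<Longrightarrow> x * (1 / x) = 1" for x :: real by simp
  \<comment> \<open>\<open>w h = h / m\<^sub>t\<close>, and \<open>e h\<close> is the derivative of \<open>m\<^sub>r h / m\<^sub>t\<close> in \<open>r\<close> at \<open>r = t\<close>\<close>
  define w where "w h \<xi> = complex_of_real (1 / (?k\<^sup>2 + (\<xi> - ?k * t)\<^sup>2)) * h \<xi>" for h \<xi>
  define e where "e h \<xi> = complex_of_real (- 2 * ?k * (\<xi> - ?k * t)) * w h \<xi>" for h \<xi>
  have w: "compact_L2 (w h)" if "compact_L2 h" for h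
    unfolding w_def[abs_def] by (intro compact_L2_mult that continuous_intros) (use mne in blast)+
  have e: "compact_L2 (e h)" if "compact_L2 h" for h
    unfolding e_def[abs_def] by (intro compact_L2_mult w that continuous_intros)
  define V where "V h r = pairing (\<Theta> r) k (\<lambda>\<xi>. of_real (?k\<^sup>2 + (\<xi> - ?k * r)\<^sup>2) * w h \<xi>)" for h r
  have s: "sqint cyl (\<Theta> r)" if "r \<in> {0..T}" for r
    using that by (intro sqint_sol(2)) auto
  have V: "V h r = pairing (\<Theta> r) k h + (r - t) * pairing (\<Theta> r) k (e h) + (r - t)\<^sup>2 * ?k\<^sup>2 * pairing (\<Theta> r) k (w h)"
    if h: "compact_L2 h" and r: "r \<in> {0..T}" for h r
  proof -
    have "of_real (?k\<^sup>2 + (\<xi> - ?k * r)\<^sup>2) * w h \<xi> =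
       (h \<xi> + of_real (r - t) * e h \<xi>) + of_real ((r - t)\<^sup>2 * ?k\<^sup>2) * w h \<xi>" for \<xi>
    proof -
      have 1: "h \<xi> = of_real (?k\<^sup>2 + (\<xi> - ?k * t)\<^sup>2) * w h \<xi>"
        unfolding w_def mult.assoc[symmetric] of_real_mult[symmetric] cancel[OF mne] by simp
      have 2: "?k\<^sup>2 + (\<xi> - ?k * r)\<^sup>2 = (?k\<^sup>2 + (\<xi> - ?k * t)\<^sup>2) + (r - t) * (- 2 * ?k * (\<xi> - ?k * t)) + (r - t)\<^sup>2 * ?k\<^sup>2"
        by (simp add: power2_eq_square algebra_simps)
      have "of_real (?k\<^sup>2 + (\<xi> - ?k * r)\<^sup>2) * w h \<xi> =
        (of_real (?k\<^sup>2 + (\<xi> - ?k * t)\<^sup>2) * w h \<xi> + of_real (r - t) * (of_real (- 2 * ?k * (\<xi> - ?k * t)) * w h \<xi>))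
        + of_real ((r - t)\<^sup>2 * ?k\<^sup>2) * w h \<xi>"
        unfolding 2 of_real_add of_real_mult distrib_right mult.assoc ..
      then show ?thesis unfolding e_def 1[symmetric] .
    qed
    then have "V h r = pairing (\<Theta> r) k (\<lambda>\<xi>. (h \<xi> + of_real (r - t) * e h \<xi>) + of_real ((r - t)\<^sup>2 * ?k\<^sup>2) * w h \<xi>)"
      unfolding V_def by simp
    also have "\<dots> = pairing (\<Theta> r) k (\<lambda>\<xi>. h \<xi> + of_real (r - t) * e h \<xi>) + (r - t)\<^sup>2 * ?k\<^sup>2 * pairing (\<Theta> r) k (w h)"
    proof (subst pairing_add[OF s[OF r]])
      show "compact_L2 (\<lambda>\<xi>. h \<xi> + of_real (r - t) * e h \<xi>)"
        by (intro compact_L2_add compact_L2_mult e h continuous_intros)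
      show "compact_L2 (\<lambda>\<xi>. of_real ((r - t)\<^sup>2 * ?k\<^sup>2) * w h \<xi>)"
        by (intro compact_L2_mult w h continuous_intros)
    qed (simp only: pairing_real)
    also have "pairing (\<Theta> r) k (\<lambda>\<xi>. h \<xi> + of_real (r - t) * e h \<xi>) = pairing (\<Theta> r) k h + (r - t) * pairing (\<Theta> r) k (e h)"
      by (subst pairing_add[OF s[OF r] h], intro compact_L2_mult e h continuous_intros) (simp only: pairing_real)
    finally show ?thesis .
  qed
  have dV: "(V h has_real_derivative - \<alpha> * ?k\<^sup>2 * pairing (\<omega> t) k (w h) + pairing (\<Theta> t) k (e h)) ?F" if h: "compact_L2 h" for h
  proof -
    have "pairing (\<Theta> t) k (e h) = - pairing (\<Theta> t) k (\<lambda>\<xi>. of_real (2 * ?k * (\<xi> - ?k * t)) * w h \<xi>)"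
      using pairing_real[of "\<Theta> t" k "-1" "\<lambda>\<xi>. of_real (2 * ?k * (\<xi> - ?k * t)) * w h \<xi>"]
      by (simp add: e_def[abs_def])
    then show ?thesis
      using Theta_pairing_deriv[OF w[OF h] t k] unfolding V_def[abs_def] by simp
  qed
  have rt: "((\<lambda>r. r - t) \<longlongrightarrow> 0) ?F"
  proof -
    have "((\<lambda>r. r - t) \<longlongrightarrow> t - t) ?F" by (intro tendsto_intros)
    then show ?thesis by simp
  qed
  have in_S: "\<forall>\<^sub>F r in ?F. r \<in> {0..T}"
    by (simp add: eventually_at_filter)
  have small: "((\<lambda>r. (r - t) * pairing (\<Theta> r) k h) \<longlongrightarrow> 0) ?F" if h: "compact_L2 h" for h
  proof -
    obtain A where A: "\<And>r. r \<in> {0..T} \<Longrightarrow> \<bar>pairing (\<Theta> r) k h\<bar> \<le> A"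
      using pairing_Theta_bounded[OF h] by blast
    show ?thesis
    proof (rule Lim_null_comparison)
      show "\<forall>\<^sub>F r in ?F. norm ((r - t) * pairing (\<Theta> r) k h) \<le> \<bar>r - t\<bar> * A"
        using in_S by eventually_elim (auto simp: abs_mult intro!: mult_left_mono A)
      show "((\<lambda>r. \<bar>r - t\<bar> * A) \<longlongrightarrow> 0) ?F"
        using tendsto_mult_left_zero[OF tendsto_rabs_zero[OF rt]] .
    qed
  qed
  have cont: "((\<lambda>r. pairing (\<Theta> r) k h) \<longlongrightarrow> pairing (\<Theta> t) k h) ?F" if h: "compact_L2 h" for h
  proof -
    have "(V h \<longlongrightarrow> V h t) ?F"
      using DERIV_continuous[OF dV[OF h]] by (simp add: continuous_within)
    then have "((\<lambda>r. V h r - (r - t) * pairing (\<Theta> r) k (e h) - (r - t) * ((r - t) * pairing (\<Theta> r) k (w h)) * ?k\<^sup>2)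
        \<longlongrightarrow> V h t - 0 - 0 * 0 * ?k\<^sup>2) ?F"
      by (intro tendsto_diff tendsto_mult small e w h rt tendsto_const)
    then have "((\<lambda>r. V h r - (r - t) * pairing (\<Theta> r) k (e h) - (r - t) * ((r - t) * pairing (\<Theta> r) k (w h)) * ?k\<^sup>2)
        \<longlongrightarrow> pairing (\<Theta> t) k h) ?F"
      using V[OF h t] by simp
    then show ?thesis
      by (rule Lim_transform_eventually)
        (use in_S in eventually_elim, simp add: V[OF h] power2_eq_square algebra_simps)
  qed
  have "((\<lambda>r. (V g r - V g t) / (r - t) - pairing (\<Theta> r) k (e g) - ((r - t) * pairing (\<Theta> r) k (w g)) * ?k\<^sup>2)
     \<longlongrightarrow> (- \<alpha> * ?k\<^sup>2 * pairing (\<omega> t) k (w g) + pairing (\<Theta> t) k (e g)) - pairing (\<Theta> t) k (e g) - 0 * ?k\<^sup>2) ?F"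
    using dV[OF g] unfolding has_field_derivative_iff
    by (intro tendsto_diff tendsto_mult cont small e w g tendsto_const)
  then have lim: "((\<lambda>r. (V g r - V g t) / (r - t) - pairing (\<Theta> r) k (e g) - ((r - t) * pairing (\<Theta> r) k (w g)) * ?k\<^sup>2)
     \<longlongrightarrow> - \<alpha> * ?k\<^sup>2 * pairing (\<omega> t) k (w g)) ?F" by simp
  have "((\<lambda>r. (pairing (\<Theta> r) k g - pairing (\<Theta> t) k g) / (r - t)) \<longlongrightarrow> - \<alpha> * ?k\<^sup>2 * pairing (\<omega> t) k (w g)) ?F"
  proof (rule Lim_transform_eventually[OF lim])
    have "\<forall>\<^sub>F r in ?F. r \<noteq> t" by (simp add: eventually_at_filter)
    with in_S show "\<forall>\<^sub>F r in ?F. (V g r - V g t) / (r - t) - pairing (\<Theta> r) k (e g) - ((r - t) * pairing (\<Theta> r) k (w g)) * ?k\<^sup>2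
        = (pairing (\<Theta> r) k g - pairing (\<Theta> t) k g) / (r - t)"
    proof eventually_elim
      case (elim r)
      have "V g r - V g t = (pairing (\<Theta> r) k g - pairing (\<Theta> t) k g)
          + (r - t) * (pairing (\<Theta> r) k (e g) + ((r - t) * pairing (\<Theta> r) k (w g)) * ?k\<^sup>2)"
        using V[OF g elim(1)] V[OF g t] by (simp add: power2_eq_square algebra_simps)
      with elim(2) show ?case by (simp add: add_divide_distrib)
    qed
  qed
  then show ?thesis unfolding has_field_derivative_iff w_def .
qed

context
  fixes W :: "real \<Rightarrow> real" and j :: int
  assumes W: "interval_weight j W"
begin

lemma sqint_weighted_fourier:
  assumes "0 \<le> s"
  shows "sqint (weighted W) (fourier (\<omega> s) k)" "sqint (weighted W) (fourier (\<Theta> s) k)"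
  using sqint_weighted[OF W] sqint_fourier[OF sqint_sol(1)[OF assms]] sqint_fourier[OF sqint_sol(2)[OF assms]] by metis+

lemma sqint_state:
  assumes "0 \<le> s"
  shows "sqint (weighted W) (state \<omega> \<theta> k s)"
    "nsq (weighted W) (state \<omega> \<theta> k s) = nsq (weighted W) (fourier (\<omega> s) k) + nsq (weighted W) (fourier (\<Theta> s) k)"
  unfolding state_def[abs_def] by (rule sqint_Pair[OF sqint_weighted_fourier[OF assms]])+

lemma state_bounded:
  obtains B where "\<And>s. s \<in> {0..T} \<Longrightarrow> nsq (weighted W) (state \<omega> \<theta> k s) \<le> B"
proof -
  obtain A where A: "0 \<le> A" "\<And>f :: real \<Rightarrow> complex. sqint lborel f \<Longrightarrow> nsq (weighted W) f \<le> A * nsq lborel f"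
    by (rule sqint_weighted[OF W], rule that)
  obtain B where B: "\<And>t. t \<in> {0..T} \<Longrightarrow> nsq cyl (\<omega> t) \<le> B" "\<And>t. t \<in> {0..T} \<Longrightarrow> nsq cyl (\<Theta> t) \<le> B"
    using bounded_sol by blast
  have le: "nsq (weighted W) (fourier f k) \<le> A * (2 * B)" if f: "sqint cyl f" "nsq cyl f \<le> B" for f
    by (rule order_trans[OF A(2)[OF sqint_fourier[OF f(1)]]], rule mult_left_mono[OF _ A(1)])
      (use nsq_fourier_le[OF f(1), of k] f(2) in linarith)
  have bound: "nsq (weighted W) (state \<omega> \<theta> k s) \<le> A * (2 * B) + A * (2 * B)" if s: "s \<in> {0..T}" for s
  proof -
    have "0 \<le> s" using s by simp
    then show ?thesis
      unfolding sqint_state(2)[OF \<open>0 \<le> s\<close>] by (intro add_mono le sqint_sol B s)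
  qed
  show ?thesis by (rule that, rule bound)
qed

lemma rate_le_state:
  obtains C where "\<And>s. s \<in> {0..T} \<Longrightarrow> AE \<xi> in weighted W. norm (rate \<nu> \<alpha> \<omega> \<theta> k s \<xi>) \<le> C * norm (state \<omega> \<theta> k s \<xi>)"
proof -
  \<comment> \<open>\<open>D\<close> bounds \<open>\<xi> - ks\<close> on the interval\<close>
  define D where "D = \<bar>of_int j\<bar> + 1 + \<bar>of_int k\<bar> * T"
  have le: "norm (rate \<nu> \<alpha> \<omega> \<theta> k s \<xi>) \<le> (\<bar>\<nu>\<bar> * D\<^sup>2 + 1 + \<bar>\<alpha>\<bar>) * norm (state \<omega> \<theta> k s \<xi>)"
    if s: "s \<in> {0..T}" and xi: "\<xi> \<in> {of_int j..<of_int j + 1}" for s \<xi>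
  proof -
    let ?x = "fourier (\<omega> s) k \<xi>" and ?y = "fourier (\<Theta> s) k \<xi>" and ?n = "norm (state \<omega> \<theta> k s \<xi>)"
    have x: "norm ?x \<le> ?n" and y: "norm ?y \<le> ?n"
      unfolding state_def by (rule norm_fst_le, rule norm_snd_le)
    have "\<bar>\<xi> - of_int k * s\<bar> \<le> \<bar>\<xi>\<bar> + \<bar>of_int k\<bar> * \<bar>s\<bar>"
      using abs_triangle_ineq4[of \<xi> "of_int k * s"] by (simp add: abs_mult)
    also have "\<dots> \<le> D" unfolding D_def using xi s by (intro add_mono mult_left_mono) auto
    finally have q: "(\<xi> - of_int k * s)\<^sup>2 \<le> D\<^sup>2"
      using abs_le_square_iff[of "\<xi> - of_int k * s" D] by simp
    have "norm (fst (rate \<nu> \<alpha> \<omega> \<theta> k s \<xi>)) \<le> norm (complex_of_real (- \<nu> * (\<xi> - of_int k * s)\<^sup>2) * ?x) + norm ?y"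
      unfolding rate_def fst_conv by (rule norm_triangle_ineq)
    also have "norm (complex_of_real (- \<nu> * (\<xi> - of_int k * s)\<^sup>2) * ?x) = \<bar>\<nu>\<bar> * (\<xi> - of_int k * s)\<^sup>2 * norm ?x"
      unfolding norm_mult norm_of_real by (simp add: abs_mult)
    also have "\<dots> \<le> \<bar>\<nu>\<bar> * D\<^sup>2 * ?n" by (intro mult_mono x q) auto
    finally have f: "norm (fst (rate \<nu> \<alpha> \<omega> \<theta> k s \<xi>)) \<le> \<bar>\<nu>\<bar> * D\<^sup>2 * ?n + ?n" using y by simp
    have "norm (snd (rate \<nu> \<alpha> \<omega> \<theta> k s \<xi>)) = \<bar>\<alpha>\<bar> * shear_symbol k s \<xi> * norm ?x"
      unfolding rate_def snd_conv norm_mult norm_of_real by (simp add: abs_mult shear_symbol_bounds)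
    also have "\<dots> \<le> \<bar>\<alpha>\<bar> * 1 * ?n" by (intro mult_mono x shear_symbol_bounds) (auto simp: shear_symbol_bounds)
    finally have g: "norm (snd (rate \<nu> \<alpha> \<omega> \<theta> k s \<xi>)) \<le> \<bar>\<alpha>\<bar> * ?n" by simp
    have "norm (rate \<nu> \<alpha> \<omega> \<theta> k s \<xi>) \<le> norm (fst (rate \<nu> \<alpha> \<omega> \<theta> k s \<xi>)) + norm (snd (rate \<nu> \<alpha> \<omega> \<theta> k s \<xi>))"
      using norm_Pair_le[of "fst (rate \<nu> \<alpha> \<omega> \<theta> k s \<xi>)" "snd (rate \<nu> \<alpha> \<omega> \<theta> k s \<xi>)"] by simp
    with f g show ?thesis by (simp add: algebra_simps)
  qed
  show ?thesis by (rule that, rule AE_weighted[OF W], rule le)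
qed

lemma sqint_rate:
  assumes s: "0 \<le> s"
  shows "sqint (weighted W) (rate \<nu> \<alpha> \<omega> \<theta> k s)"
proof -
  note [measurable] = fourier_measurable[OF sqint_sol(1)[OF s], of k] fourier_measurable[OF sqint_sol(2)[OF s], of k]
  obtain C where C: "\<And>q. q \<in> {0..s} \<Longrightarrow> AE \<xi> in weighted W. norm (rate \<nu> \<alpha> \<omega> \<theta> k q \<xi>) \<le> C * norm (state \<omega> \<theta> k q \<xi>)"
    by (rule rate_le_state, rule that)
  have m: "rate \<nu> \<alpha> \<omega> \<theta> k s \<in> borel_measurable (weighted W)"
    unfolding rate_def[abs_def] shear_symbol_def by measurable
  show ?thesis by (rule sqint_bound_AE(1)[OF sqint_state(1)[OF s] m C]) (use s in simp)
qed

text \<open>Multiplication by \<open>W\<close> turns a test function for the measure \<open>W d\<xi>\<close> into an admissible profile, so the weak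
  equations in frequency hold against every square-integrable test function.\<close>

lemma state_energy_deriv:
  assumes t: "t \<in> {0..T}"
  shows "((\<lambda>s. nsq (weighted W) (state \<omega> \<theta> k s)) has_real_derivative 2 * ip (weighted W) (state \<omega> \<theta> k t) (rate \<nu> \<alpha> \<omega> \<theta> k t)) (at t within {0..T})"
proof -
  obtain B where B: "\<And>s. s \<in> {0..T} \<Longrightarrow> nsq (weighted W) (state \<omega> \<theta> k s) \<le> B"
    by (rule state_bounded, rule that)
  obtain C where C: "\<And>s. s \<in> {0..T} \<Longrightarrow> AE \<xi> in weighted W. norm (rate \<nu> \<alpha> \<omega> \<theta> k s \<xi>) \<le> C * norm (state \<omega> \<theta> k s \<xi>)"
    by (rule rate_le_state, rule that)
  have squ: "sqint (weighted W) (state \<omega> \<theta> k s)" and squ': "sqint (weighted W) (rate \<nu> \<alpha> \<omega> \<theta> k s)" if "s \<in> {0..T}" for s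
    using that sqint_state(1) sqint_rate by auto
  show ?thesis
  proof (rule energy_has_derivative[OF _ t squ squ'])
    fix r assume r: "r \<in> {0..T}"
    have "nsq (weighted W) (rate \<nu> \<alpha> \<omega> \<theta> k r) \<le> C\<^sup>2 * nsq (weighted W) (state \<omega> \<theta> k r)"
      by (rule sqint_bound_AE(2)[OF squ[OF r] sqint_measurable[OF squ'[OF r]] C[OF r]])
    then show "nsq (weighted W) (rate \<nu> \<alpha> \<omega> \<theta> k r) \<le> C\<^sup>2 * B"
      using mult_left_mono[OF B[OF r], of "C\<^sup>2"] by simp
  next
    fix H :: "real \<Rightarrow> complex \<times> complex" and r assume H: "sqint (weighted W) H" and r: "r \<in> {0..T}"
    have r0: "0 \<le> r" using r by simp
    note h = ip_Pair(1,2)[OF H]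
    let ?g1 = "\<lambda>\<xi>. of_real (W \<xi>) * cnj (fst (H \<xi>))" and ?g2 = "\<lambda>\<xi>. of_real (W \<xi>) * cnj (snd (H \<xi>))"
    let ?q = "\<lambda>\<xi>. (\<xi> - of_int k * r)\<^sup>2" and ?m = "\<lambda>\<xi>. (of_int k)\<^sup>2 + (\<xi> - of_int k * r)\<^sup>2"
    have split: "ip (weighted W) H (state \<omega> \<theta> k q) = pairing (\<omega> q) k ?g1 + pairing (\<Theta> q) k ?g2" if "q \<in> {0..T}" for q
    proof -
      have "0 \<le> q" using that by simp
      then show ?thesis
        using ip_weighted[OF W h(1) sqint_sol(1), of q "\<lambda>_. 1" k] ip_weighted[OF W h(2) sqint_sol(2), of q "\<lambda>_. 1" k]
        unfolding state_def[abs_def] ip_Pair(3)[OF H sqint_weighted_fourier[OF \<open>0 \<le> q\<close>]] by simp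
    qed
    have "((\<lambda>q. pairing (\<omega> q) k ?g1 + pairing (\<Theta> q) k ?g2) has_real_derivative
       (- \<nu> * pairing (\<omega> r) k (\<lambda>\<xi>. of_real (?q \<xi>) * ?g1 \<xi>) + pairing (\<Theta> r) k ?g1) +
       (- \<alpha> * (of_int k)\<^sup>2 * pairing (\<omega> r) k (\<lambda>\<xi>. of_real (1 / ?m \<xi>) * ?g2 \<xi>))) (at r within {0..T})"
      by (intro DERIV_add omega_pairing_deriv Theta_deriv compact_L2_weight[OF W] h r)
    moreover have "ip (weighted W) H (rate \<nu> \<alpha> \<omega> \<theta> k r) = (- \<nu> * pairing (\<omega> r) k (\<lambda>\<xi>. of_real (?q \<xi>) * ?g1 \<xi>) + pairing (\<Theta> r) k ?g1) +
       (- \<alpha> * (of_int k)\<^sup>2 * pairing (\<omega> r) k (\<lambda>\<xi>. of_real (1 / ?m \<xi>) * ?g2 \<xi>))"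
    proof -
      let ?a = "\<lambda>\<xi>. - \<nu> * ?q \<xi>" and ?b = "\<lambda>\<xi>. - \<alpha> * shear_symbol k r \<xi>"
      let ?A = "\<lambda>\<xi>. of_real (?a \<xi>) * fourier (\<omega> r) k \<xi>" and ?B = "\<lambda>\<xi>. of_real (?b \<xi>) * fourier (\<omega> r) k \<xi>"
      note y = sqint_weighted_fourier(2)[OF r0, of k]
      have sB: "sqint (weighted W) ?B" using ip_Pair(2)[OF squ'[OF r]] by (simp add: rate_def)
      have sA: "sqint (weighted W) ?A" using sqint_diff[OF ip_Pair(1)[OF squ'[OF r]] y] by (simp add: rate_def)
      have "ip (weighted W) H (rate \<nu> \<alpha> \<omega> \<theta> k r) = ip (weighted W) (\<lambda>\<xi>. fst (H \<xi>)) (\<lambda>\<xi>. ?A \<xi> + fourier (\<Theta> r) k \<xi>)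
          + ip (weighted W) (\<lambda>\<xi>. snd (H \<xi>)) ?B"
        unfolding rate_def[abs_def] by (rule ip_Pair(3)[OF H sqint_add[OF sA y] sB])
      also have "ip (weighted W) (\<lambda>\<xi>. fst (H \<xi>)) (\<lambda>\<xi>. ?A \<xi> + fourier (\<Theta> r) k \<xi>)
          = ip (weighted W) (\<lambda>\<xi>. fst (H \<xi>)) ?A + ip (weighted W) (\<lambda>\<xi>. fst (H \<xi>)) (fourier (\<Theta> r) k)"
        by (rule ip_add_right[OF h(1) sA y])
      also have "ip (weighted W) (\<lambda>\<xi>. fst (H \<xi>)) (fourier (\<Theta> r) k) = pairing (\<Theta> r) k ?g1"
        using ip_weighted[OF W h(1) sqint_sol(2)[OF r0], of "\<lambda>_. 1" k] by simp
      also have "ip (weighted W) (\<lambda>\<xi>. fst (H \<xi>)) ?A = pairing (\<omega> r) k (\<lambda>\<xi>. of_real (?a \<xi>) * ?g1 \<xi>)"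
        by (rule ip_weighted[OF W h(1) sqint_sol(1)[OF r0]]) measurable
      also have "\<dots> = - \<nu> * pairing (\<omega> r) k (\<lambda>\<xi>. of_real (?q \<xi>) * ?g1 \<xi>)"
        unfolding pairing_real[symmetric] by (simp add: mult.assoc)
      also have "ip (weighted W) (\<lambda>\<xi>. snd (H \<xi>)) ?B = pairing (\<omega> r) k (\<lambda>\<xi>. of_real (?b \<xi>) * ?g2 \<xi>)"
        by (rule ip_weighted[OF W h(2) sqint_sol(1)[OF r0]]) (simp add: shear_symbol_def)
      also have "\<dots> = - \<alpha> * (of_int k)\<^sup>2 * pairing (\<omega> r) k (\<lambda>\<xi>. of_real (1 / ?m \<xi>) * ?g2 \<xi>)"
        unfolding pairing_real[symmetric] by (simp add: mult.assoc shear_symbol_def)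
      finally show ?thesis .
    qed
    ultimately show "((\<lambda>q. ip (weighted W) H (state \<omega> \<theta> k q)) has_real_derivative ip (weighted W) H (rate \<nu> \<alpha> \<omega> \<theta> k r)) (at r within {0..T})"
      by (intro has_real_derivative_transform[OF r split]) auto
  qed simp
qed

lemma coupling_zero_mode:
  assumes "0 \<le> s"
  shows "ip (weighted W) (fourier (\<omega> s) 0) (fourier (\<Theta> s) 0) = 0"
  using ip_weighted[OF W sqint_weighted_fourier(1)[OF assms] sqint_sol(2)[OF assms], of "\<lambda>_. 1" 0 0]
    Theta_zero_mode[OF compact_L2_weight[OF W sqint_weighted_fourier(1)[OF assms]] assms] by simp

end

end

section \<open>The energy inequality and summation over frequencies\<close>

text \<open>Here \<open>q\<close> stands for \<open>(\<xi> - kt)\<^sup>2\<close> and \<open>\<mu>\<close> for \<open>k\<^sup>2 / (k\<^sup>2 + (\<xi> - kt)\<^sup>2)\<close>. For \<open>\<tau>\<^sup>2 \<le> 1\<close> the rate on the right is at least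
  \<open>(1 + |\<alpha>|)\<^sup>2\<close> and dominates the coupling directly. For \<open>\<tau>\<^sup>2 > 1\<close>, Young's inequality with weight \<open>\<nu>\<tau>\<^sup>2\<close> moves
  the \<open>x\<close> part of the coupling into the dissipation.\<close>

lemma dissipation_absorbs_growth:
  fixes x y :: complex and \<nu> \<alpha> \<mu> q \<tau> :: real
  assumes \<nu>: "0 < \<nu>" and q: "\<tau>\<^sup>2 \<le> q" and \<mu>: "0 \<le> \<mu>" "\<mu> \<le> 1"
  shows "2 * ((x, y) \<bullet> (of_real (- \<nu> * q) * x + y, of_real (- \<alpha> * \<mu>) * x))
    \<le> 2 * (1 + \<bar>\<alpha>\<bar>)\<^sup>2 * (1 + 1 / \<nu>) / (1 + \<tau>\<^sup>2) * ((norm x)\<^sup>2 + (norm y)\<^sup>2)"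
proof -
  define b where "b = 1 + \<bar>\<alpha>\<bar>"
  define X where "X = norm x"
  define Y where "Y = norm y"
  define c where "c = 2 * b\<^sup>2 * (1 + 1 / \<nu>)"
  have b1: "1 \<le> b" by (simp add: b_def)
  have c0: "0 \<le> c" unfolding c_def using \<nu> by simp
  have "(x, y) \<bullet> (of_real (- \<nu> * q) * x + y, of_real (- \<alpha> * \<mu>) * x) = - \<nu> * q * X\<^sup>2 + (1 - \<alpha> * \<mu>) * (x \<bullet> y)"
    by (simp only: scaleR_conv_of_real[symmetric] inner_Pair inner_add_right inner_scaleR_right)
      (simp add: X_def power2_norm_eq_inner inner_commute algebra_simps)
  also have "(1 - \<alpha> * \<mu>) * (x \<bullet> y) \<le> b * (X * Y)"
  proof -
    have "\<bar>1 - \<alpha> * \<mu>\<bar> \<le> 1 + \<bar>\<alpha>\<bar> * \<mu>" using abs_triangle_ineq4[of 1 "\<alpha> * \<mu>"] \<mu> by (simp add: abs_mult)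
    also have "\<dots> \<le> b" unfolding b_def using \<mu> mult_left_le[of \<mu> "\<bar>\<alpha>\<bar>"] by simp
    finally have "\<bar>1 - \<alpha> * \<mu>\<bar> * \<bar>x \<bullet> y\<bar> \<le> b * (X * Y)"
      unfolding X_def Y_def using b1 by (intro mult_mono Cauchy_Schwarz_ineq2) auto
    then show ?thesis using abs_ge_self[of "(1 - \<alpha> * \<mu>) * (x \<bullet> y)"] by (simp add: abs_mult)
  qed
  finally have le: "2 * ((x, y) \<bullet> (of_real (- \<nu> * q) * x + y, of_real (- \<alpha> * \<mu>) * x))
     \<le> - 2 * \<nu> * q * X\<^sup>2 + 2 * b * (X * Y)" by simp
  have "- 2 * \<nu> * q * X\<^sup>2 + 2 * b * (X * Y) \<le> c / (1 + \<tau>\<^sup>2) * (X\<^sup>2 + Y\<^sup>2)"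
  proof (cases "\<tau>\<^sup>2 \<le> 1")
    case True
    have "0 \<le> \<nu> * q * X\<^sup>2" using \<nu> order_trans[OF zero_le_power2 q] by simp
    moreover have "2 * (X * Y) \<le> X\<^sup>2 + Y\<^sup>2" using sum_squares_bound[of X Y] by simp
    then have "b * (2 * (X * Y)) \<le> b * (X\<^sup>2 + Y\<^sup>2)" using b1 by (intro mult_left_mono) auto
    moreover have "b * (X\<^sup>2 + Y\<^sup>2) \<le> c / (1 + \<tau>\<^sup>2) * (X\<^sup>2 + Y\<^sup>2)"
    proof (rule mult_right_mono)
      have "b \<le> b\<^sup>2 * (1 + 1 / \<nu>)"
      proof -
        have "b * 1 \<le> b * b" using b1 by (intro mult_left_mono) auto
        also have "\<dots> = b\<^sup>2 * 1" by (simp add: power2_eq_square)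
        also have "\<dots> \<le> b\<^sup>2 * (1 + 1 / \<nu>)" using \<nu> by (intro mult_left_mono) auto
        finally show ?thesis by simp
      qed
      also have "\<dots> = c / 2" by (simp add: c_def)
      also have "\<dots> \<le> c / (1 + \<tau>\<^sup>2)"
        using True c0 by (intro divide_left_mono) (auto simp: add_pos_nonneg)
      finally show "b \<le> c / (1 + \<tau>\<^sup>2)" .
    qed simp
    ultimately show ?thesis by linarith
  next
    case False
    then have t: "1 < \<tau>\<^sup>2" by simp
    then have t0: "0 < \<nu> * \<tau>\<^sup>2" using \<nu> by (intro mult_pos_pos) linarith+
    have "\<nu> * \<tau>\<^sup>2 * X\<^sup>2 \<le> \<nu> * q * X\<^sup>2" using q \<nu> by (intro mult_right_mono mult_left_mono) auto
    moreover have "0 \<le> \<nu> * q * X\<^sup>2" using \<nu> order_trans[OF zero_le_power2 q] by simp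
    moreover have "2 * b * (X * Y) \<le> \<nu> * \<tau>\<^sup>2 * X\<^sup>2 + b\<^sup>2 / (\<nu> * \<tau>\<^sup>2) * Y\<^sup>2"
    proof -
      define r where "r = sqrt (\<nu> * \<tau>\<^sup>2)"
      have r: "0 < r" "r\<^sup>2 = \<nu> * \<tau>\<^sup>2" using t0 unfolding r_def by (simp only: real_sqrt_gt_0_iff, simp only: real_sqrt_pow2 less_imp_le)
      have "2 * (r * X) * (b / r * Y) \<le> (r * X)\<^sup>2 + (b / r * Y)\<^sup>2" by (rule sum_squares_bound)
      moreover have "2 * (r * X) * (b / r * Y) = 2 * b * (X * Y)" using r(1) by simp
      moreover have "(r * X)\<^sup>2 + (b / r * Y)\<^sup>2 = \<nu> * \<tau>\<^sup>2 * X\<^sup>2 + b\<^sup>2 / (\<nu> * \<tau>\<^sup>2) * Y\<^sup>2"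
        unfolding power_mult_distrib power_divide r(2) ..
      ultimately show ?thesis by simp
    qed
    moreover have "b\<^sup>2 / (\<nu> * \<tau>\<^sup>2) * Y\<^sup>2 \<le> c / (1 + \<tau>\<^sup>2) * Y\<^sup>2"
    proof (rule mult_right_mono)
      have "b\<^sup>2 / (\<nu> * \<tau>\<^sup>2) = 2 * b\<^sup>2 * (1 / \<nu>) / (2 * \<tau>\<^sup>2)" by simp
      also have "\<dots> \<le> c / (2 * \<tau>\<^sup>2)"
        unfolding c_def by (intro divide_right_mono mult_left_mono) auto
      also have "\<dots> \<le> c / (1 + \<tau>\<^sup>2)"
        using t c0 by (intro divide_left_mono mult_pos_pos add_pos_nonneg) linarith+
      finally show "b\<^sup>2 / (\<nu> * \<tau>\<^sup>2) \<le> c / (1 + \<tau>\<^sup>2)" .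
    qed simp
    moreover have "0 \<le> c / (1 + \<tau>\<^sup>2) * X\<^sup>2" using c0 by simp
    ultimately show ?thesis by (simp add: distrib_left)
  qed
  with le show ?thesis by (simp add: c_def b_def X_def Y_def)
qed

text \<open>Replacing \<open>\<xi>\<close> by the end point of its unit interval changes \<open>\<xi> / k\<close> by at most \<open>1\<close>; the rate then changes at most by the
  factor \<open>3\<close>.\<close>

lemma lorentzian_shift:
  fixes a b :: real
  assumes "\<bar>a - b\<bar> \<le> 1"
  shows "1 / (1 + a\<^sup>2) \<le> 3 / (1 + b\<^sup>2)"
proof -
  have 1: "a\<^sup>2 + b\<^sup>2 - 2 * (a * b) \<le> 1"
  proof -
    have "(a - b)\<^sup>2 \<le> 1" using assms by (simp add: abs_square_le_1)
    then show ?thesis by (simp add: power2_diff mult.assoc)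
  qed
  have 2: "4 * (a * b) \<le> 4 * a\<^sup>2 + b\<^sup>2"
  proof -
    have "2 * (2 * a) * b \<le> (2 * a)\<^sup>2 + b\<^sup>2" by (rule sum_squares_bound)
    then show ?thesis by (simp add: power_mult_distrib mult.assoc)
  qed
  have 3: "0 \<le> a\<^sup>2" by simp
  have lin: "1 + q \<le> 3 * (1 + p)" if "p + q - 2 * r \<le> 1" "4 * r \<le> 4 * p + q" "0 \<le> p" for p q r :: real
    using that by argo
  have "1 + b\<^sup>2 \<le> 3 * (1 + a\<^sup>2)" by (rule lin[OF 1 2 3])
  then show ?thesis by (simp add: divide_le_eq le_divide_eq add_pos_nonneg)
qed

lemma gronwall:
  fixes E D A a :: "real \<Rightarrow> real"
  assumes T: "0 < T"
    and E: "\<And>s. s \<in> {0..T} \<Longrightarrow> (E has_real_derivative D s) (at s within {0..T})"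
    and A: "\<And>s. (A has_real_derivative a s) (at s)"
    and le: "\<And>s. s \<in> {0..T} \<Longrightarrow> D s \<le> a s * E s"
  shows "E T \<le> exp (A T - A 0) * E 0"
proof -
  let ?G = "\<lambda>s. E s * exp (- A s)"
  have der: "(?G has_real_derivative (D s - a s * E s) * exp (- A s)) (at s within {0..T})" if "s \<in> {0..T}" for s
    by (rule derivative_eq_intros E[OF that] has_field_derivative_at_within[OF A] refl)+ (simp add: algebra_simps)
  have "?G T \<le> ?G 0"
  proof (rule DERIV_nonpos_imp_decreasing_open[OF less_imp_le[OF T]])
    fix s assume s: "0 < s" "s < T"
    then have s': "s \<in> {0..T}" by simp
    have "(?G has_real_derivative (D s - a s * E s) * exp (- A s)) (at s)"
      using der[OF s'] s by (simp add: at_within_Icc_at)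
    moreover have "(D s - a s * E s) * exp (- A s) \<le> 0"
      using le[OF s'] by (intro mult_nonpos_nonneg) auto
    ultimately show "\<exists>y. (?G has_real_derivative y) (at s) \<and> y \<le> 0" by blast
  next
    show "continuous_on {0..T} ?G"
      unfolding continuous_on_eq_continuous_within using der DERIV_continuous by blast
  qed
  then have "E T * exp (- A T) * exp (A T) \<le> E 0 * exp (- A 0) * exp (A T)"
    by (rule mult_right_mono) simp
  then show ?thesis by (simp add: exp_diff exp_minus field_simps)
qed

text \<open>For \<open>k \<noteq> 0\<close> the primitive of the rate is a multiple of \<open>arctan\<close>, whose total variation is \<open>\<pi>\<close>. For \<open>k = 0\<close> the coupling
  integrates to zero and the energy does not increase.\<close>

lemma interval_energy_bound:
  fixes \<nu> \<alpha> :: real and k j :: int and W :: "real \<Rightarrow> real"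
  assumes sol: "boussinesq_solution \<nu> \<alpha> \<omega> \<theta>" and \<nu>: "0 < \<nu>" and T: "0 < T" and W: "interval_weight j W"
  shows "nsq (weighted W) (fourier (\<omega> T) k) + nsq (weighted W) (fourier (weak_dx (\<theta> T)) k)
    \<le> exp (6 * pi * (1 + \<bar>\<alpha>\<bar>)\<^sup>2 * (1 + 1 / \<nu>)) *
      (nsq (weighted W) (fourier (\<omega> 0) k) + nsq (weighted W) (fourier (weak_dx (\<theta> 0)) k))"
proof -
  let ?M = "weighted W" and ?u = "state \<omega> \<theta> k" and ?u' = "rate \<nu> \<alpha> \<omega> \<theta> k"
  define E where "E s = nsq ?M (?u s)" for s
  define c where "c = 2 * (1 + \<bar>\<alpha>\<bar>)\<^sup>2 * (1 + 1 / \<nu>)"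
  have c0: "0 \<le> c" unfolding c_def using \<nu> by simp
  have squ: "sqint ?M (?u s)" and squ': "sqint ?M (?u' s)" if "s \<in> {0..T}" for s
    using that sqint_state(1)[OF sol W] sqint_rate[OF sol W] by auto
  have dE: "(E has_real_derivative 2 * ip ?M (?u s) (?u' s)) (at s within {0..T})" if "s \<in> {0..T}" for s
    unfolding E_def[abs_def] by (rule state_energy_deriv[OF sol W that])
  have E0: "0 \<le> E s" for s unfolding E_def by simp
  have "E T \<le> exp (3 * c * pi) * E 0"
  proof (cases "k = 0")
    case True
    have "2 * ip ?M (?u s) (?u' s) \<le> 0 * E s" if s: "s \<in> {0..T}" for s
    proof -
      let ?x = "fourier (\<omega> s) 0" and ?y = "fourier (weak_dx (\<theta> s)) 0"
      have s0: "0 \<le> s" using s by simp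
      have i: "integrable ?M (\<lambda>\<xi>. ?x \<xi> \<bullet> ?y \<xi>)" by (rule sqint_inner[OF sqint_weighted_fourier[OF sol W s0]])
      have "?u s \<xi> \<bullet> ?u' s \<xi> \<le> ?x \<xi> \<bullet> ?y \<xi>" for \<xi>
      proof -
        have "?u s \<xi> \<bullet> ?u' s \<xi> = - \<nu> * \<xi>\<^sup>2 * (?x \<xi> \<bullet> ?x \<xi>) + ?x \<xi> \<bullet> ?y \<xi>"
          unfolding state_def rate_def using True by (simp add: shear_symbol_def inner_complex_def algebra_simps)
        moreover have "0 \<le> \<nu> * \<xi>\<^sup>2 * (?x \<xi> \<bullet> ?x \<xi>)" using \<nu> by simp
        ultimately show ?thesis by simp
      qed
      then have "ip ?M (?u s) (?u' s) \<le> ip ?M ?x ?y"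
        unfolding ip_def by (intro integral_mono sqint_inner squ squ' s i)
      also have "\<dots> = 0" by (rule coupling_zero_mode[OF sol W s0])
      finally show ?thesis by simp
    qed
    from gronwall[OF T dE _ this, where A="\<lambda>_. 0"] have "E T \<le> 1 * E 0" by simp
    also have "\<dots> \<le> exp (3 * c * pi) * E 0" using c0 E0 by (intro mult_right_mono) auto
    finally show ?thesis .
  next
    case False
    define A where "A s = 3 * c * arctan (s - of_int j / of_int k)" for s
    define a where "a s = 3 * c * (1 / (1 + (s - of_int j / of_int k)\<^sup>2))" for s
    have dA: "(A has_real_derivative a s) (at s)" for s
      unfolding A_def[abs_def] a_def by (auto intro!: derivative_eq_intros simp: inverse_eq_divide)
    have "2 * ip ?M (?u s) (?u' s) \<le> a s * E s" if s: "s \<in> {0..T}" for s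
    proof -
      have "2 * (?u s \<xi> \<bullet> ?u' s \<xi>) \<le> a s * (?u s \<xi> \<bullet> ?u s \<xi>)" if xi: "\<xi> \<in> {of_int j..<of_int j + 1}" for \<xi>
      proof -
        let ?x = "fourier (\<omega> s) k \<xi>" and ?y = "fourier (weak_dx (\<theta> s)) k \<xi>"
        let ?\<tau> = "s - \<xi> / of_int k" and ?\<mu> = "shear_symbol k s \<xi>"
        have k1: "1 \<le> \<bar>real_of_int k\<bar>" using False by linarith
        have "(\<xi> - of_int k * s)\<^sup>2 = (of_int k)\<^sup>2 * ?\<tau>\<^sup>2"
          using False by (simp add: power_mult_distrib[symmetric] right_diff_distrib power2_commute)
        moreover have "1 * ?\<tau>\<^sup>2 \<le> (real_of_int k)\<^sup>2 * ?\<tau>\<^sup>2"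
          using k1 by (intro mult_right_mono) (simp_all add: abs_le_square_iff[of 1, simplified])
        ultimately have q: "?\<tau>\<^sup>2 \<le> (\<xi> - of_int k * s)\<^sup>2" by simp
        have "2 * (?u s \<xi> \<bullet> ?u' s \<xi>) \<le> c / (1 + ?\<tau>\<^sup>2) * ((norm ?x)\<^sup>2 + (norm ?y)\<^sup>2)"
          using dissipation_absorbs_growth[OF \<nu> q shear_symbol_bounds, of ?x ?y \<alpha>] unfolding state_def rate_def c_def by (simp only: mult.assoc)
        also have "\<dots> \<le> a s * ((norm ?x)\<^sup>2 + (norm ?y)\<^sup>2)"
        proof (rule mult_right_mono)
          have "\<bar>?\<tau> - (s - of_int j / of_int k)\<bar> = \<bar>\<xi> - of_int j\<bar> / \<bar>of_int k\<bar>"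
            using False by (simp add: diff_divide_distrib[symmetric] abs_minus_commute)
          also have "\<dots> \<le> 1 / 1" using xi k1 by (intro frac_le) auto
          finally have "1 / (1 + ?\<tau>\<^sup>2) \<le> 3 / (1 + (s - of_int j / of_int k)\<^sup>2)"
            by (intro lorentzian_shift) simp
          from mult_left_mono[OF this c0] show "c / (1 + ?\<tau>\<^sup>2) \<le> a s" by (simp add: a_def mult_ac)
        qed simp
        also have "(norm ?x)\<^sup>2 + (norm ?y)\<^sup>2 = ?u s \<xi> \<bullet> ?u s \<xi>"
          by (simp add: state_def power2_norm_eq_inner)
        finally show ?thesis .
      qed
      from AE_weighted[OF W this] have "(LINT \<xi>|?M. 2 * (?u s \<xi> \<bullet> ?u' s \<xi>)) \<le> (LINT \<xi>|?M. a s * (?u s \<xi> \<bullet> ?u s \<xi>))"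
        using sqint_inner[OF squ[OF s] squ'[OF s]] sqint_inner[OF squ[OF s] squ[OF s]]
        by (intro integral_mono_AE) auto
      then show ?thesis by (simp add: E_def ip_def)
    qed
    from gronwall[OF T dE dA this] have "E T \<le> exp (A T - A 0) * E 0" .
    also have "\<dots> \<le> exp (3 * c * pi) * E 0"
    proof -
      let ?d = "of_int j / real_of_int k"
      have "arctan (T - ?d) - arctan (0 - ?d) \<le> pi"
        using arctan_ubound[of "T - ?d"] arctan_lbound[of "0 - ?d"] by linarith
      then have "A T - A 0 \<le> 3 * c * pi"
        unfolding A_def right_diff_distrib[symmetric] using c0 by (intro mult_left_mono) auto
      then show ?thesis using E0 by (intro mult_right_mono) auto
    qed
    finally show ?thesis .
  qed
  moreover have "E s = nsq ?M (fourier (\<omega> s) k) + nsq ?M (fourier (weak_dx (\<theta> s)) k)" if "0 \<le> s" for s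
    unfolding E_def by (rule sqint_state(2)[OF sol W that])
  ultimately show ?thesis using T by (simp add: c_def mult_ac)
qed

lemma nn_integral_unit_intervals:
  fixes F :: "real \<Rightarrow> ennreal"
  assumes [measurable]: "F \<in> borel_measurable borel"
  shows "(\<integral>\<^sup>+\<xi>. F \<xi> \<partial>lborel) = (\<integral>\<^sup>+j. \<integral>\<^sup>+\<xi>. indicator {of_int j..<of_int j + 1} \<xi> * F \<xi> \<partial>lborel \<partial>count_space (UNIV :: int set))"
proof -
  interpret C: pair_sigma_finite "count_space (UNIV :: int set)" "lborel :: real measure"
    by (intro pair_sigma_finite.intro sigma_finite_measure_count_space_countable lborel.sigma_finite_measure_axioms) simp
  have "(\<integral>\<^sup>+j. indicator {of_int j..<of_int j + 1} \<xi> * F \<xi> \<partial>count_space (UNIV :: int set)) = F \<xi>" for \<xi>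
  proof -
    have "(\<integral>\<^sup>+j. indicator {of_int j..<of_int j + 1} \<xi> * F \<xi> \<partial>count_space (UNIV :: int set)) =
      (\<Sum>j\<in>{\<lfloor>\<xi>\<rfloor>}. indicator {of_int j..<of_int j + 1} \<xi> * F \<xi>)"
      by (rule nn_integral_count_space') (auto simp: indicator_def split: if_splits dest: floor_unique)
    then show ?thesis by (simp add: indicator_def)
  qed
  then have "(\<integral>\<^sup>+\<xi>. F \<xi> \<partial>lborel) = (\<integral>\<^sup>+\<xi>. \<integral>\<^sup>+j. indicator {of_int j..<of_int j + 1} \<xi> * F \<xi> \<partial>count_space (UNIV :: int set) \<partial>lborel)"
    by simp
  also have "\<dots> = (\<integral>\<^sup>+j. \<integral>\<^sup>+\<xi>. indicator {of_int j..<of_int j + 1} \<xi> * F \<xi> \<partial>lborel \<partial>count_space (UNIV :: int set))"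
    by (rule C.Fubini') (intro measurable_pair_measure_countable1, auto)
  finally show ?thesis .
qed

definition freq_weight :: "nat \<Rightarrow> int \<Rightarrow> int \<Rightarrow> real \<Rightarrow> real" where
  "freq_weight N k j \<xi> = indicator {of_int j..<of_int j + 1} \<xi> * (1 + (of_int k)\<^sup>2 + \<xi>\<^sup>2) ^ N"

lemma interval_weight_freq_weight: "interval_weight j (freq_weight N k j)"
proof -
  have "freq_weight N k j \<xi> \<le> (1 + (of_int k)\<^sup>2 + (\<bar>of_int j\<bar> + 1)\<^sup>2) ^ N" for \<xi>
  proof (cases "\<xi> \<in> {of_int j..<of_int j + 1}")
    case True
    then have "\<bar>\<xi>\<bar> \<le> \<bar>\<bar>real_of_int j\<bar> + 1\<bar>" by auto
    then have "\<xi>\<^sup>2 \<le> (\<bar>of_int j\<bar> + 1)\<^sup>2" by (simp only: abs_le_square_iff)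
    then show ?thesis using True by (auto simp: freq_weight_def intro!: power_mono)
  qed (simp add: freq_weight_def)
  moreover have "freq_weight N k j \<in> borel_measurable borel" unfolding freq_weight_def[abs_def] by measurable
  moreover have "0 \<le> freq_weight N k j \<xi>" for \<xi> by (simp add: freq_weight_def)
  ultimately show ?thesis unfolding interval_weight_def by (auto simp: freq_weight_def)
qed

lemma sobolev_sq_eq:
  assumes f: "sqint cyl f"
  shows "sobolev_sq N f = (\<integral>\<^sup>+k. \<integral>\<^sup>+j. ennreal (nsq (weighted (freq_weight N k j)) (fourier f k))
     \<partial>count_space UNIV \<partial>count_space UNIV)"
  unfolding sobolev_sq_def
proof (rule nn_integral_cong)
  fix k :: int
  note [measurable] = fourier_measurable[OF f, of k]
  have [measurable]: "freq_weight N k j \<in> borel_measurable borel" for j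
    using interval_weight_freq_weight[of j N k] by (simp add: interval_weight_def)
  let ?F = "\<lambda>\<xi>. ennreal ((1 + (of_int k)\<^sup>2 + \<xi>\<^sup>2) ^ N * (cmod (fourier f k \<xi>))\<^sup>2)"
  have "(\<integral>\<^sup>+\<xi>. ?F \<xi> \<partial>lborel) = (\<integral>\<^sup>+j. \<integral>\<^sup>+\<xi>. indicator {of_int j..<of_int j + 1} \<xi> * ?F \<xi> \<partial>lborel \<partial>count_space (UNIV :: int set))"
    by (rule nn_integral_unit_intervals) measurable
  also have "\<dots> = (\<integral>\<^sup>+j. ennreal (nsq (weighted (freq_weight N k j)) (fourier f k)) \<partial>count_space UNIV)"
  proof (rule nn_integral_cong)
    fix j :: int
    have M: "sqint (weighted (freq_weight N k j)) (fourier f k)"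
      using sqint_weighted[OF interval_weight_freq_weight] sqint_fourier[OF f] by metis
    have "ennreal (nsq (weighted (freq_weight N k j)) (fourier f k)) =
      (\<integral>\<^sup>+\<xi>. ennreal ((cmod (fourier f k \<xi>))\<^sup>2) \<partial>weighted (freq_weight N k j))"
      by (rule nn_integral_sqint[OF M, symmetric])
    also have "\<dots> = (\<integral>\<^sup>+\<xi>. ennreal (freq_weight N k j \<xi>) * ennreal ((cmod (fourier f k \<xi>))\<^sup>2) \<partial>lborel)"
      unfolding weighted_def by (rule nn_integral_density) measurable
    also have "\<dots> = (\<integral>\<^sup>+\<xi>. indicator {of_int j..<of_int j + 1} \<xi> * ?F \<xi> \<partial>lborel)"
      by (intro nn_integral_cong) (auto simp: freq_weight_def ennreal_mult'[symmetric] split: split_indicator)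
    finally show "(\<integral>\<^sup>+\<xi>. indicator {of_int j..<of_int j + 1} \<xi> * ?F \<xi> \<partial>lborel) =
      ennreal (nsq (weighted (freq_weight N k j)) (fourier f k))" by simp
  qed
  finally show "(\<integral>\<^sup>+\<xi>. ?F \<xi> \<partial>lborel) = (\<integral>\<^sup>+j. ennreal (nsq (weighted (freq_weight N k j)) (fourier f k)) \<partial>count_space UNIV)" .
qed

lemma sobolev_energy_bound:
  assumes sol: "boussinesq_solution \<nu> \<alpha> \<omega> \<theta>" and \<nu>: "0 < \<nu>" and t: "0 < t"
  shows "sobolev_sq N (\<omega> t) + sobolev_sq N (weak_dx (\<theta> t)) \<le>
    ennreal (exp (6 * pi * (1 + \<bar>\<alpha>\<bar>)\<^sup>2 * (1 + 1 / \<nu>))) * (sobolev_sq N (\<omega> 0) + sobolev_sq N (weak_dx (\<theta> 0)))"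
proof -
  let ?K = "exp (6 * pi * (1 + \<bar>\<alpha>\<bar>)\<^sup>2 * (1 + 1 / \<nu>))"
  let ?M = "\<lambda>k j. weighted (freq_weight N k j)"
  let ?e = "\<lambda>s k j. nsq (?M k j) (fourier (\<omega> s) k) + nsq (?M k j) (fourier (weak_dx (\<theta> s)) k)"
  have S: "sobolev_sq N (\<omega> s) + sobolev_sq N (weak_dx (\<theta> s)) =
     (\<integral>\<^sup>+k. \<integral>\<^sup>+j. ennreal (?e s k j) \<partial>count_space UNIV \<partial>count_space UNIV)" if s: "s \<in> {0..t}" for s
  proof -
    have "0 \<le> s" using s by simp
    note sc = sqint_sol[OF sol this]
    show ?thesis
      unfolding sobolev_sq_eq[OF sc(1)] sobolev_sq_eq[OF sc(2)]
      by (simp add: nn_integral_add[symmetric])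
  qed
  have "sobolev_sq N (\<omega> t) + sobolev_sq N (weak_dx (\<theta> t)) = (\<integral>\<^sup>+k. \<integral>\<^sup>+j. ennreal (?e t k j) \<partial>count_space UNIV \<partial>count_space UNIV)"
    by (rule S) (use t in simp)
  also have "\<dots> \<le> (\<integral>\<^sup>+k. \<integral>\<^sup>+j. ennreal ?K * ennreal (?e 0 k j) \<partial>count_space UNIV \<partial>count_space UNIV)"
  proof (intro nn_integral_mono)
    fix k j :: int
    show "ennreal (?e t k j) \<le> ennreal ?K * ennreal (?e 0 k j)"
      using ennreal_leI[OF interval_energy_bound[OF sol \<nu> t interval_weight_freq_weight, where k=k]]
      by (simp only: ennreal_mult' exp_ge_zero)
  qed
  also have "\<dots> = ennreal ?K * (\<integral>\<^sup>+k. \<integral>\<^sup>+j. ennreal (?e 0 k j) \<partial>count_space UNIV \<partial>count_space UNIV)"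
    by (simp add: nn_integral_cmult)
  also have "(\<integral>\<^sup>+k. \<integral>\<^sup>+j. ennreal (?e 0 k j) \<partial>count_space UNIV \<partial>count_space UNIV) = sobolev_sq N (\<omega> 0) + sobolev_sq N (weak_dx (\<theta> 0))"
    by (rule S[symmetric]) (use t in simp)
  finally show ?thesis .
qed

theorem theorem3p1:
  fixes \<nu> \<alpha> :: real
  assumes "\<nu> > 0" and "\<bar>\<alpha>\<bar> < \<bar>alpha_star \<nu>\<bar>"
  shows "\<exists>C>0. \<forall>N. \<forall>\<omega> \<theta>.
    boussinesq_solution \<nu> \<alpha> \<omega> \<theta> \<and> in_sobolev N (\<omega> 0) \<and> in_sobolev N (weak_dx (\<theta> 0)) \<longrightarrow>
    (\<forall>t>0. in_sobolev N (\<omega> t) \<and> in_sobolev N (weak_dx (\<theta> t)) \<and>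
       sobolev_norm N (\<omega> t) + sobolev_norm N (weak_dx (\<theta> t))
         \<le> C * sobolev_norm N (\<omega> 0) + C * sobolev_norm N (weak_dx (\<theta> 0)))"
proof -
  define K where "K = exp (6 * pi * (1 + \<bar>\<alpha>\<bar>)\<^sup>2 * (1 + 1 / \<nu>))"
  have K0: "0 < K" by (simp add: K_def)
  have "in_sobolev N (\<omega> t) \<and> in_sobolev N (weak_dx (\<theta> t)) \<and>
       sobolev_norm N (\<omega> t) + sobolev_norm N (weak_dx (\<theta> t))
         \<le> 2 * sqrt K * sobolev_norm N (\<omega> 0) + 2 * sqrt K * sobolev_norm N (weak_dx (\<theta> 0))"
    if sol: "boussinesq_solution \<nu> \<alpha> \<omega> \<theta>" and init: "in_sobolev N (\<omega> 0)" "in_sobolev N (weak_dx (\<theta> 0))" and t: "0 < t"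
    for N \<omega> \<theta> t
  proof -
    let ?S = "\<lambda>s. sobolev_sq N (\<omega> s)" and ?S' = "\<lambda>s. sobolev_sq N (weak_dx (\<theta> s))"
    have bound: "?S t + ?S' t \<le> ennreal K * (?S 0 + ?S' 0)"
      unfolding K_def by (rule sobolev_energy_bound[OF sol assms(1) t])
    obtain a b where ab: "?S 0 = ennreal a" "0 \<le> a" "?S' 0 = ennreal b" "0 \<le> b"
      using init unfolding in_sobolev_def by (metis ennreal_cases infinity_ennreal_def less_irrefl)
    have le: "?S t + ?S' t \<le> ennreal (K * (a + b))"
      using bound K0 ab by (simp add: ennreal_mult' flip: ennreal_plus)
    have le1: "?S t \<le> ennreal (K * (a + b))" and le2: "?S' t \<le> ennreal (K * (a + b))"
      using order_trans[OF _ le, of "?S t"] order_trans[OF _ le, of "?S' t"] by (simp_all add: add_increasing add_increasing2)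
    have norm_le: "sobolev_norm N f \<le> sqrt K * sobolev_norm N (\<omega> 0) + sqrt K * sobolev_norm N (weak_dx (\<theta> 0))"
      if "sobolev_sq N f \<le> ennreal (K * (a + b))" for f
    proof -
      have "enn2real (sobolev_sq N f) \<le> K * (a + b)"
        using enn2real_mono[OF that] K0 ab by simp
      then have "sobolev_norm N f \<le> sqrt K * sqrt (a + b)"
        unfolding sobolev_norm_def by (simp add: real_sqrt_mult[symmetric])
      also have "\<dots> \<le> sqrt K * (sqrt a + sqrt b)"
        using K0 ab by (intro mult_left_mono sqrt_add_le_add_sqrt) auto
      finally show ?thesis using ab by (simp add: sobolev_norm_def distrib_left)
    qed
    have "cyl_L2 (\<omega> t)" "cyl_L2 (weak_dx (\<theta> t))"
      using sol t unfolding boussinesq_solution_def by auto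
    moreover have "?S t < \<infinity>" "?S' t < \<infinity>"
      using le1 le2 by (auto intro: le_less_trans)
    ultimately show ?thesis
      unfolding in_sobolev_def using norm_le[OF le1] norm_le[OF le2] by simp
  qed
  then show ?thesis using K0 by (intro exI[of _ "2 * sqrt K"]) auto
qed

end
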